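(* Let $n\geq 2$ and let $\Omega$ and $\Omega'$ be domains in $\mathbb{R}^n$. Suppose that $\Omega$ supports the $p$-Poincaré inequality for some $p>n$, and that there exists a homeomorphism $\varphi:\Omega\to\Omega'$ (onto $\Omega'$) belonging to the Sobolev class $L^1_p(\Omega)$. Then $\Omega'$ has finite geodesic diameter, i.e. $\operatorname{diam}_G(\Omega')<\infty$.
   Context: A domain is a nonempty connected open set. For $1\leq p\leq\infty$, the seminormed Sobolev space $L^1_p(\Omega)$ consists of the locally integrable, weakly differentiable functions $f:\Omega\to\mathbb{R}$ with finite seminorm $\|f\mid L^1_p(\Omega)\|=\|\,|\nabla f|\,\mid L_p(\Omega)\|$ (the function $f$ itself is not required to be in $L_p$). For $p>n$ every class in $L^1_p(\Omega)$ has a unique continuous representative, and elements of $L^1_p(\Omega)$ are identified with this continuous representative. A mapping $\varphi:\Omega\to\mathbb{R}^n$ belongs to $L^1_p(\Omega)$ if each of its coordinate functions does. $C(\Omega)$ denotes the space of bounded continuous functions on $\Omega$ with norm $\|f\mid C(\Omega)\|=\sup_{x\in\Omega}|f(x)|$. For $p>n$, a domain $\Omega\subset\mathbb{R}^n$ supports the $p$-Poincaré inequality if every $f\in L^1_p(\Omega)$ belongs to $C(\Omega)$ and there is a constant $K$, independent of $f$, such that $\inf_{c\in\mathbb{R}}\|f-c\mid C(\Omega)\|\leq K\,\|f\mid L^1_p(\Omega)\|$ for all $f\in L^1_p(\Omega)$. The geodesic diameter of a domain $G\subset\mathbb{R}^n$ is $\operatorname{diam}_G(G)=\sup_{x,y\in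 G}\operatorname{dist}_G(x,y)$, where $\operatorname{dist}_G(x,y)$ is the intrinsic geodesic distance: the infimum of the lengths $\int_0^1|\gamma'(t)|\,dt$ over all rectifiable curves $\gamma:[0,1]\to G$ with $\gamma(0)=x$, $\gamma(1)=y$. (The subscript in $\operatorname{diam}_G$ stands for "geodesic".) *)

theory Defs
  imports "HOL-Analysis.Analysis" "HOL-Probability.Essential_Supremum"
begin

text \<open>A real function on a set \<open>\<Omega>\<close> is a total function on \<open>real ^ 'n\<close> whose values outside \<open>\<Omega>\<close>
  are irrelevant.  Exponents \<open>p\<close> range over \<open>ennreal\<close>, so that \<open>p = \<infinity>\<close> is included.\<close>

definition is_domain :: "'a::topological_space set \<Rightarrow> bool" where
  "is_domain \<Omega> \<longleftrightarrow> \<Omega> \<noteq> {} \<and> open \<Omega> \<and> connected \<Omega>"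


subsection \<open>Test functions and weak gradients\<close>

definition partial_deriv :: "'n::finite \<Rightarrow> (real ^ 'n \<Rightarrow> real) \<Rightarrow> real ^ 'n \<Rightarrow> real" where
  "partial_deriv i f x = frechet_derivative f (at x) (axis i 1)"

primrec C_k :: "nat \<Rightarrow> (real ^ 'n::finite \<Rightarrow> real) \<Rightarrow> bool" where
  "C_k 0 f \<longleftrightarrow> continuous_on UNIV f"
| "C_k (Suc k) f \<longleftrightarrow> (\<forall>x. f differentiable (at x)) \<and> (\<forall>i. C_k k (partial_deriv i f))"

definition test_function :: "(real ^ 'n::finite) set \<Rightarrow> (real ^ 'n \<Rightarrow> real) \<Rightarrow> bool" where
  "test_function \<Omega> \<psi> \<longleftrightarrow>
     (\<forall>k. C_k k \<psi>) \<and> compact (closure {x. \<psi> x \<noteq> 0}) \<and> closure {x. \<psi> x \<noteq> 0} \<subseteq> \<Omega>"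

definition locally_integrable ::
    "'a::euclidean_space set \<Rightarrow> ('a \<Rightarrow> 'b::euclidean_space) \<Rightarrow> bool" where
  "locally_integrable \<Omega> f \<longleftrightarrow> (\<forall>K. compact K \<and> K \<subseteq> \<Omega> \<longrightarrow> f absolutely_integrable_on K)"

definition has_weak_gradient ::
    "(real ^ 'n::finite) set \<Rightarrow> (real ^ 'n \<Rightarrow> real) \<Rightarrow> (real ^ 'n \<Rightarrow> real ^ 'n) \<Rightarrow> bool" where
  "has_weak_gradient \<Omega> f g \<longleftrightarrow>
     locally_integrable \<Omega> g \<and>
     (\<forall>\<psi>. test_function \<Omega> \<psi> \<longrightarrow>
        (\<forall>i. (LINT x:\<Omega>|lebesgue. f x * partial_deriv i \<psi> x) =
             - (LINT x:\<Omega>|lebesgue. g x $ i * \<psi> x)))"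

text \<open>A weak gradient of a locally integrable function on an open set is unique up to null sets;
  the choice below is thus immaterial for \<open>L_p\<close> norms.\<close>

definition weak_gradient ::
    "(real ^ 'n::finite) set \<Rightarrow> (real ^ 'n \<Rightarrow> real) \<Rightarrow> real ^ 'n \<Rightarrow> real ^ 'n" where
  "weak_gradient \<Omega> f = (SOME g. has_weak_gradient \<Omega> f g)"


subsection \<open>The seminormed Sobolev space \<open>L^1_p\<close>\<close>

text \<open>The case distinction on the integral is needed because \<open>enn2real \<infinity> = 0\<close>.\<close>

definition Lp_norm ::
    "ennreal \<Rightarrow> 'a::euclidean_space set \<Rightarrow> ('a \<Rightarrow> 'b::euclidean_space) \<Rightarrow> ennreal" where
  "Lp_norm p \<Omega> g =
     (if p = \<infinity> then esssup (lebesgue_on \<Omega>) (\<lambda>x. ennreal (norm (g x)))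
      else let I = (\<integral>\<^sup>+x. ennreal (norm (g x) powr enn2real p) \<partial>lebesgue_on \<Omega>)
           in if I = \<infinity> then \<infinity> else ennreal (enn2real I powr (1 / enn2real p)))"

definition sobolev_seminorm ::
    "ennreal \<Rightarrow> (real ^ 'n::finite) set \<Rightarrow> (real ^ 'n \<Rightarrow> real) \<Rightarrow> ennreal" where
  "sobolev_seminorm p \<Omega> f = Lp_norm p \<Omega> (weak_gradient \<Omega> f)"

definition sobolev_space ::
    "ennreal \<Rightarrow> (real ^ 'n::finite) set \<Rightarrow> (real ^ 'n \<Rightarrow> real) set" where
  "sobolev_space p \<Omega> =
     {f. locally_integrable \<Omega> f \<and> (\<exists>g. has_weak_gradient \<Omega> f g) \<and> sobolev_seminorm p \<Omega> f < \<infinity>}"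

definition sobolev_map ::
    "ennreal \<Rightarrow> (real ^ 'n::finite) set \<Rightarrow> (real ^ 'n \<Rightarrow> real ^ 'm::finite) \<Rightarrow> bool" where
  "sobolev_map p \<Omega> \<phi> \<longleftrightarrow> (\<forall>i. (\<lambda>x. \<phi> x $ i) \<in> sobolev_space p \<Omega>)"


subsection \<open>The Poincare inequality\<close>

definition cont_representative ::
    "'a::euclidean_space set \<Rightarrow> ('a \<Rightarrow> real) \<Rightarrow> ('a \<Rightarrow> real) \<Rightarrow> bool" where
  "cont_representative \<Omega> f h \<longleftrightarrow> continuous_on \<Omega> h \<and> (AE x in lebesgue_on \<Omega>. f x = h x)"

definition bdd_cont :: "'a::topological_space set \<Rightarrow> ('a \<Rightarrow> real) set" where
  "bdd_cont \<Omega> = {f. continuous_on \<Omega> f \<and> bounded (f ` \<Omega>)}"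

definition C_norm :: "'a set \<Rightarrow> ('a \<Rightarrow> real) \<Rightarrow> ennreal" where
  "C_norm \<Omega> f = (SUP x\<in>\<Omega>. ennreal \<bar>f x\<bar>)"

text \<open>Meant for \<open>p\<close> larger than the dimension.  Elements of \<open>L^1_p\<close> are not assumed to be
  continuous here, so the continuous representative \<open>h\<close> (unique on open \<open>\<Omega>\<close>) is explicit.\<close>

definition supports_poincare :: "ennreal \<Rightarrow> (real ^ 'n::finite) set \<Rightarrow> bool" where
  "supports_poincare p \<Omega> \<longleftrightarrow>
     (\<forall>f\<in>sobolev_space p \<Omega>. \<exists>h. cont_representative \<Omega> f h \<and> h \<in> bdd_cont \<Omega>) \<and>
     (\<exists>K::real. \<forall>f\<in>sobolev_space p \<Omega>. \<forall>h. cont_representative \<Omega> f h \<longrightarrow>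
        (INF c. C_norm \<Omega> (\<lambda>x. h x - c)) \<le> ennreal K * sobolev_seminorm p \<Omega> f)"


subsection \<open>Geodesic distance and diameter\<close>

definition absolutely_continuous_curve :: "(real \<Rightarrow> 'a::real_normed_vector) \<Rightarrow> bool" where
  "absolutely_continuous_curve \<gamma> \<longleftrightarrow>
     (\<forall>\<epsilon>>0. \<exists>\<delta>>0. \<forall>d. d division_of \<Union>d \<and> \<Union>d \<subseteq> {0..1} \<and> (\<Sum>k\<in>d. measure lborel k) < \<delta> \<longrightarrow>
        (\<Sum>k\<in>d. norm (\<gamma> (Sup k) - \<gamma> (Inf k))) < \<epsilon>)"

definition curve_length :: "(real \<Rightarrow> 'a::real_normed_vector) \<Rightarrow> real" where
  "curve_length \<gamma> = integral {0..1} (\<lambda>t. norm (vector_derivative \<gamma> (at t)))"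

text \<open>The formula for \<open>curve_length\<close> gives the length of a rectifiable curve only for an absolutely
  continuous parametrization (a Cantor-type parametrization would give \<open>0\<close>).  Such curves are
  rectifiable, and each rectifiable curve can be so parametrized, e.g. proportionally to arc length.
  The infimum over the empty set is \<open>\<infinity>\<close>.\<close>

definition geodesic_dist :: "'a::euclidean_space set \<Rightarrow> 'a \<Rightarrow> 'a \<Rightarrow> ennreal" where
  "geodesic_dist G x y =
     (INF \<gamma>\<in>{\<gamma>. absolutely_continuous_curve \<gamma> \<and> \<gamma> ` {0..1} \<subseteq> G \<and> \<gamma> 0 = x \<and> \<gamma> 1 = y}.
        ennreal (curve_length \<gamma>))"

definition geodesic_diameter :: "'a::euclidean_space set \<Rightarrow> ennreal" where
  "geodesic_diameter G = (SUP x\<in>G. SUP y\<in>G. geodesic_dist G x y)"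

end

theory Submission
  imports Defs
begin

text \<open>Let \<open>d\<close> be the length of a shortest path in \<open>\<Omega>'\<close> from a point \<open>x\<close>. It is locally
  \<open>1\<close>-Lipschitz, so the difference quotients of \<open>f = d \<circ> \<phi>\<close> are bounded by those of \<open>\<phi>\<close>. Passing
  to the limit, \<open>\<bar>\<integral> f \<partial>\<^sub>i\<psi>\<bar> \<le> \<integral> G \<bar>\<psi>\<bar>\<close> for all test functions, with \<open>G\<close> the sum of the moduli of the
  \<open>i\<close>-th weak derivatives of the coordinates of \<open>\<phi>\<close>; hence \<open>f\<close> has a weak gradient, bounded by that of
  \<open>\<phi>\<close>. The Poincare inequality bounds the oscillation of \<open>f\<close> by a constant independent of \<open>x\<close>, and
  as \<open>\<phi>\<close> maps onto \<open>\<Omega>'\<close> and \<open>d x = 0\<close>, this bounds \<open>d\<close>.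

  The existence of the weak gradient is the Riesz representation theorem in a weighted \<open>L\<^sub>2\<close> space;
  mollification is replaced by polynomial approximation multiplied by test functions.\<close>

subsection \<open>Smooth functions and bumps\<close>

text \<open>The estimate for \<open>d\<close> holds only between the centre and the points of a ball
  inside \<Omega>', so increments of \<open>f\<close> and of \<open>\<phi>\<close> can be compared
  only at small distances, uniformly on each compact subset of \<Omega>. That is enough, since every
  test function has compact support. The gradient bound sees \<open>d\<close> only through its
  Lipschitz constant 1, which is why it does not depend on the base point. The seminorm is that of a
  gradient picked by \<open>SOME\<close>, so two separate facts are needed: some weak gradient of
  \<open>f\<close> exists, and every weak gradient of \<open>f\<close> obeys the pointwise bound.
  The representation theorem gives only the first, without pointwise control. The second comes from
  testing with approximations of the indicator of the set where the bound fails. The heart is a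
  one-sided comparison: a difference quotient of a coordinate of \<open>\<phi>\<close>, integrated
  against a test function, exceeds the integral of the weak derivative by at most a multiple of the
  step. All differentiation under integrals falls on the test function, because
  \<open>\<phi>\<close> is merely continuous.\<close>

lemma partial_deriv_eqI:
  assumes "(f has_derivative D) (at x)"
  shows "partial_deriv i f x = D (axis i 1)"
  using frechet_derivative_at[OF assms] unfolding partial_deriv_def by simp

text \<open>The recursion asks for continuity only at level 0. At the bottom of the induction it
  comes from differentiability.\<close>

lemma C_k_Suc_imp_C_k: "C_k (Suc k) f \<Longrightarrow> C_k k f"
proof (induction k arbitrary: f)
  case 0
  then show ?case
    by (simp add: differentiable_imp_continuous_on differentiable_on_def differentiable_at_withinI)
next
  case (Suc k)
  then show ?case by (metis C_k.simps(2))
qed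

lemma C_k_continuous: "C_k k f \<Longrightarrow> continuous_on UNIV f"
  by (induction k) (use C_k_Suc_imp_C_k in \<open>auto simp del: C_k.simps(2)\<close>)

lemma partial_deriv_linear:
  assumes "bounded_linear f"
  shows "partial_deriv i f = (\<lambda>x. f (axis i 1))"
  using partial_deriv_eqI[OF bounded_linear_imp_has_derivative[OF assms]] by auto

lemma C_k_const: "C_k k (\<lambda>x. c)"
proof (induction k arbitrary: c)
  case (Suc k)
  have "partial_deriv i (\<lambda>x::real^'a. c) = (\<lambda>x. 0)" for i
    using partial_deriv_eqI[OF has_derivative_const] by fast
  then show ?case using Suc by simp
qed simp

lemma C_k_linear:
  assumes "bounded_linear f"
  shows "C_k k f"
proof (cases k)
  case 0
  then show ?thesis using assms linear_continuous_on by simp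
next
  case (Suc l)
  then show ?thesis
    using bounded_linear_imp_differentiable[OF assms] by (simp add: partial_deriv_linear[OF assms] C_k_const)
qed

lemma partial_deriv_add:
  assumes "f differentiable (at x)" "g differentiable (at x)"
  shows "partial_deriv i (\<lambda>x. f x + g x) x = partial_deriv i f x + partial_deriv i g x"
  using partial_deriv_eqI[OF has_derivative_add[OF assms[unfolded frechet_derivative_works]]]
  by (simp add: partial_deriv_def)

lemma partial_deriv_mult:
  assumes "f differentiable (at x)" "g differentiable (at x)"
  shows "partial_deriv i (\<lambda>x. f x * g x) x = f x * partial_deriv i g x + partial_deriv i f x * g x"
  using partial_deriv_eqI[OF has_derivative_mult[OF assms[unfolded frechet_derivative_works]]]
  by (simp add: partial_deriv_def)

lemma C_k_add: "C_k k f \<Longrightarrow> C_k k g \<Longrightarrow> C_k k (\<lambda>x. f x + g x)"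
proof (induction k arbitrary: f g)
  case 0
  then show ?case by (simp add: continuous_on_add)
next
  case (Suc k)
  have "partial_deriv i (\<lambda>x. f x + g x) = (\<lambda>x. partial_deriv i f x + partial_deriv i g x)" for i
    using Suc.prems by (auto simp: partial_deriv_add)
  then show ?case using Suc by simp
qed

lemma C_k_mult: "C_k k f \<Longrightarrow> C_k k g \<Longrightarrow> C_k k (\<lambda>x. f x * g x)"
proof (induction k arbitrary: f g)
  case 0
  then show ?case by (simp add: continuous_on_mult)
next
  case (Suc k)
  have "partial_deriv i (\<lambda>x. f x * g x) =
      (\<lambda>x. f x * partial_deriv i g x + partial_deriv i f x * g x)" for i
    using Suc.prems by (auto simp: partial_deriv_mult)
  moreover have "C_k k f" "C_k k g" using Suc.prems C_k_Suc_imp_C_k by blast+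
  ultimately show ?case using Suc by (simp add: C_k_add)
qed

lemma C_k_polynomial: "real_polynomial_function f \<Longrightarrow> C_k k f"
  by (induction rule: real_polynomial_function.induct)
    (auto intro: C_k_linear C_k_const C_k_add C_k_mult)

section \<open>The flat function exp (-1/s) and bump functions\<close>

definition smooth_cutoff :: "nat \<Rightarrow> real \<Rightarrow> real" where
  "smooth_cutoff j s = (if s > 0 then exp (- inverse s) / s ^ j else 0)"

lemma smooth_cutoff_nonneg: "smooth_cutoff j s \<ge> 0"
  by (simp add: smooth_cutoff_def)

text \<open>The single term of order \<open>j + 2\<close> in the series of exp (1/s) already bounds
  exp (-1/s) by a multiple of s to the power \<open>j + 2\<close>. The two powers left after
  dividing by \<open>s ^ j\<close> force the derivative at 0 to vanish.\<close>

lemma smooth_cutoff_le: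
  obtains c where "\<And>s. smooth_cutoff j s \<le> c * s\<^sup>2" "c > 0"
proof
  let ?c = "fact (j + 2) :: real"
  show "smooth_cutoff j s \<le> ?c * s\<^sup>2" for s
  proof (cases "s > 0")
    case True
    define c where "c = ?c"
    have c: "c > 0" by (simp add: c_def)
    have sm: "summable (\<lambda>n. inverse s ^ n / fact n)"
      using summable_exp[of "inverse s"] by (simp add: field_simps)
    have "(\<Sum>n\<in>{j+2}. inverse s ^ n / fact n) \<le> (\<Sum>n. inverse s ^ n / fact n)"
      by (rule sum_le_suminf[OF sm]) (use True in auto)
    then have "inverse s ^ (j + 2) / c \<le> exp (inverse s)"
      by (simp add: exp_def scaleR_conv_of_real field_simps c_def del: fact_Suc power_Suc add_2_eq_Suc')
    then have "exp (- inverse s) \<le> c * s ^ (j + 2)"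
      using True c by (simp add: exp_minus field_simps)
    then show ?thesis unfolding c_def[symmetric]
      using True by (simp add: smooth_cutoff_def field_simps power_add power2_eq_square)
  qed (simp add: smooth_cutoff_def)
qed simp

text \<open>The family is closed under differentiation up to linear combinations, which is the
  reason for carrying the index \<open>j\<close>. Away from 0 this is the quotient rule or a
  constant; at 0 the quadratic bound makes the difference quotient O(h).\<close>

lemma smooth_cutoff_has_derivative:
  "(smooth_cutoff j has_real_derivative (smooth_cutoff (j + 2) s - j * smooth_cutoff (j + 1) s)) (at s)"
proof (cases s "0::real" rule: linorder_cases)
  case greater
  have "((\<lambda>s. exp (- inverse s) / s ^ j) has_real_derivative
      (exp (- inverse s) * inverse (s^2) * s ^ j - exp (- inverse s) * (j * s ^ (j - 1))) / (s ^ j * s ^ j)) (at s)"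
    using greater by (auto intro!: derivative_eq_intros simp: power2_eq_square)
  \<comment> \<open>The case \<open>j = 0\<close> is separate because of the truncated exponent
    \<open>j - 1\<close>.\<close>
  moreover have "(exp (- inverse s) * inverse (s^2) * s ^ j - exp (- inverse s) * (j * s ^ (j - 1))) / (s ^ j * s ^ j)
     = smooth_cutoff (j + 2) s - j * smooth_cutoff (j + 1) s"
    using greater by (cases j) (auto simp: smooth_cutoff_def field_simps power2_eq_square)
  ultimately have "((\<lambda>s. exp (- inverse s) / s ^ j) has_real_derivative
      (smooth_cutoff (j + 2) s - j * smooth_cutoff (j + 1) s)) (at s)" by simp
  then show ?thesis
    by (rule DERIV_cong_ev[THEN iffD1, OF refl _ refl, rotated])
      (use greater in \<open>auto simp: smooth_cutoff_def intro!: eventually_mono[OF eventually_gt_at_top]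
        eventually_mono[OF order_tendstoD(1)[OF tendsto_ident_at greater]]
        eventually_mono[OF eventually_nhds_in_open[of "{0<..}" s]]\<close>)
next
  case less
  have "((\<lambda>s. 0) has_real_derivative 0) (at s)" by simp
  then have "(smooth_cutoff j has_real_derivative 0) (at s)"
    by (rule DERIV_cong_ev[THEN iffD1, OF refl _ refl, rotated])
      (use less in \<open>auto simp: smooth_cutoff_def intro!: eventually_mono[OF eventually_nhds_in_open[of "{..<0}" s]]\<close>)
  then show ?thesis using less by (simp add: smooth_cutoff_def)
next
  case equal
  obtain c where c: "\<And>s. smooth_cutoff j s \<le> c * s\<^sup>2" "c > 0"
    using smooth_cutoff_le by blast
  have bd: "norm ((smooth_cutoff j h - 0) / h) \<le> c * norm h" for h
  proof -
    have "norm (smooth_cutoff j h) \<le> c * (norm h)\<^sup>2"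
      using c(1)[of h] smooth_cutoff_nonneg[of j h] by simp
    then show ?thesis
      by (cases "h = 0") (auto simp: field_simps power2_eq_square)
  qed
  have "((\<lambda>h. (smooth_cutoff j h - 0) / h) \<longlongrightarrow> 0) (at 0)"
    by (rule Lim_null_comparison[of _ "\<lambda>h. c * norm h"])
      (auto intro!: always_eventually bd[simplified] tendsto_eq_intros)
  then show ?thesis using equal by (simp add: DERIV_def smooth_cutoff_def)
qed

text \<open>The induction runs over all \<open>j\<close> at once, because one derivative raises the
  index by 1 or 2. The chain rule adds a factor \<open>partial_deriv i q\<close>, which is smooth of
  every order.\<close>

lemma C_k_smooth_cutoff:
  assumes "\<And>k. C_k k q"
  shows "C_k k (\<lambda>x. smooth_cutoff j (q x))"
proof (induction k arbitrary: j)
  case 0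
  have "continuous_on UNIV (smooth_cutoff j)"
    using smooth_cutoff_has_derivative DERIV_isCont by (blast intro: continuous_at_imp_continuous_on)
  then show ?case using assms[of 0] by (simp add: continuous_on_compose2[of UNIV "smooth_cutoff j"])
next
  case (Suc k)
  have dq: "(q has_derivative frechet_derivative q (at x)) (at x)" for x
    using assms[of 1] frechet_derivative_works by fastforce
  have d: "((\<lambda>x. smooth_cutoff j (q x)) has_derivative
     (\<lambda>h. (smooth_cutoff (j + 2) (q x) - j * smooth_cutoff (j + 1) (q x)) * frechet_derivative q (at x) h)) (at x)" for x
    using has_derivative_compose[OF dq smooth_cutoff_has_derivative[unfolded has_field_derivative_def]] by simp
  have "partial_deriv i (\<lambda>x. smooth_cutoff j (q x)) =
     (\<lambda>x. (smooth_cutoff (j + 2) (q x) + (- real j) * smooth_cutoff (j + 1) (q x)) * partial_deriv i q x)" for i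
    using partial_deriv_eqI[OF d] by (auto simp: partial_deriv_def)
  moreover have "C_k k (partial_deriv i q)" for i using assms[of "Suc k"] by simp
  moreover have "C_k k (\<lambda>x. (smooth_cutoff (j + 2) (q x) + (- real j) * smooth_cutoff (j + 1) (q x)))"
    by (intro C_k_add C_k_mult C_k_const Suc)
  ultimately show ?case using d by (auto simp: differentiable_def intro: C_k_mult)
qed

lemma test_function_bump:
  fixes a :: "real ^ 'n::finite"
  assumes "cball a r \<subseteq> \<Omega>" "r > 0"
  obtains \<eta> where "test_function \<Omega> \<eta>" "\<And>x. \<eta> x \<ge> 0" "\<And>x. x \<in> ball a r \<Longrightarrow> \<eta> x > 0"
proof
  \<comment> \<open>This is the squared radius minus the squared distance to \<open>a\<close>,
    spelled out in sums and products of coordinates so that it is recognised as a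
    polynomial.\<close>
  define q where "q x = r\<^sup>2 + (- 1) * (\<Sum>i\<in>UNIV. (x $ i + (- (a $ i))) * (x $ i + (- (a $ i))))" for x :: "real ^ 'n"
  have q: "q x = r\<^sup>2 - (dist a x)\<^sup>2" for x
    by (simp add: q_def dist_norm norm_minus_commute[of a] power2_norm_eq_inner inner_vec_def)
  have "real_polynomial_function q"
    unfolding q_def
    by (intro real_polynomial_function.intros real_polynomial_function_sum bounded_linear_vec_nth) auto
  then have "C_k k (\<lambda>x. smooth_cutoff 0 (q x))" for k
    by (intro C_k_smooth_cutoff C_k_polynomial)
  \<comment> \<open>The bump is nonzero exactly on the open ball, so its support is
    \<open>cball a r\<close>, which is compact and lies in \<Omega>.\<close>
  moreover have "{x. smooth_cutoff 0 (q x) \<noteq> 0} = ball a r"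
    using assms by (auto simp: q smooth_cutoff_def abs_less_iff power_mono_iff intro: power_strict_mono)
      (metis abs_le_square_iff abs_of_nonneg abs_of_pos linorder_not_less zero_le_dist)+
  ultimately show "test_function \<Omega> (\<lambda>x. smooth_cutoff 0 (q x))"
    using assms by (simp add: test_function_def)
  show "smooth_cutoff 0 (q x) \<ge> 0" for x by (rule smooth_cutoff_nonneg)
  show "smooth_cutoff 0 (q x) > 0" if "x \<in> ball a r" for x
    using that by (simp add: q smooth_cutoff_def power_strict_mono)
qed

subsection \<open>Weak inequalities against test functions\<close>

definition supp :: "('a::topological_space \<Rightarrow> real) \<Rightarrow> 'a set" where
  "supp \<psi> = closure {x. \<psi> x \<noteq> 0}"

lemma closed_supp [simp]: "closed (supp \<psi>)"
  by (simp add: supp_def)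

lemma supp_subset: "closed K \<Longrightarrow> (\<And>x. x \<notin> K \<Longrightarrow> \<psi> x = 0) \<Longrightarrow> supp \<psi> \<subseteq> K"
  unfolding supp_def by (rule closure_minimal) auto

text \<open>Smoothness is dropped because absolute values of test functions also serve as
  integrands; integrability needs only continuity and compact support.\<close>

definition cc_function :: "'a::euclidean_space set \<Rightarrow> ('a \<Rightarrow> real) \<Rightarrow> bool" where
  "cc_function \<Omega> \<psi> \<longleftrightarrow>
     continuous_on UNIV \<psi> \<and> compact (supp \<psi>) \<and> supp \<psi> \<subseteq> \<Omega>"

lemma cc_functionI:
  assumes "continuous_on UNIV \<psi>" "compact K" "K \<subseteq> \<Omega>" "\<And>x. x \<notin> K \<Longrightarrow> \<psi> x = 0"
  shows "cc_function \<Omega> \<psi>"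
proof -
  have "supp \<psi> \<subseteq> K"
    using assms compact_imp_closed by (intro supp_subset) auto
  then show ?thesis
    unfolding cc_function_def using assms closed_Int_compact[OF closed_supp[of \<psi>] assms(2)]
    by (simp add: Int_absorb2)
qed

lemma not_in_supp: "x \<notin> supp \<psi> \<Longrightarrow> \<psi> x = 0"
  unfolding supp_def using closure_subset[of "{x. \<psi> x \<noteq> 0}"] by auto

lemma test_function_iff: "test_function \<Omega> \<psi> \<longleftrightarrow> (\<forall>k. C_k k \<psi>) \<and> cc_function \<Omega> \<psi>"
  unfolding test_function_def cc_function_def supp_def using C_k.simps(1)[of \<psi>] by blast

lemma test_function_imp_cc_function: "test_function \<Omega> \<psi> \<Longrightarrow> cc_function \<Omega> \<psi>"
  by (simp add: test_function_iff)

lemma test_functionI: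
  assumes "\<And>k. C_k k \<psi>" "compact K" "K \<subseteq> \<Omega>" "\<And>x. x \<notin> K \<Longrightarrow> \<psi> x = 0"
  shows "test_function \<Omega> \<psi>"
  using cc_functionI[OF C_k_continuous[OF assms(1)] assms(2-4)] assms(1)
  by (simp add: test_function_iff)

lemma cc_functionD:
  assumes "cc_function \<Omega> \<psi>"
  shows "continuous_on S \<psi>" "compact (supp \<psi>)" "supp \<psi> \<subseteq> \<Omega>"
  using assms continuous_on_subset[of UNIV \<psi> S] unfolding cc_function_def by simp_all

lemma cc_function_mult:
  assumes "cc_function \<Omega> \<psi>" "continuous_on UNIV f"
  shows "cc_function \<Omega> (\<lambda>x. f x * \<psi> x)"
proof (rule cc_functionI[OF _ cc_functionD(2,3)[OF assms(1)]])
  show "continuous_on UNIV (\<lambda>x. f x * \<psi> x)"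
    by (rule continuous_on_mult[OF assms(2) cc_functionD(1)[OF assms(1)]])
qed (simp add: not_in_supp[of _ \<psi>])

lemma cc_function_abs:
  assumes "cc_function \<Omega> \<psi>"
  shows "cc_function \<Omega> (\<lambda>x. \<bar>\<psi> x\<bar>)"
  using assms unfolding cc_function_def supp_def by (simp add: continuous_on_rabs)

lemma test_functionD:
  assumes "test_function \<Omega> \<psi>"
  shows "C_k k \<psi>" "compact (supp \<psi>)" "supp \<psi> \<subseteq> \<Omega>"
  using assms by (simp_all add: test_function_iff cc_function_def)

lemma test_function_mult:
  assumes "test_function \<Omega> \<psi>" "\<And>k. C_k k f"
  shows "test_function \<Omega> (\<lambda>x. f x * \<psi> x)"
  by (rule test_functionI[OF _ test_functionD(2,3)[OF assms(1)]])
    (simp_all add: assms(2) C_k_mult test_functionD(1)[OF assms(1)] not_in_supp[of _ \<psi>])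

lemma test_function_add:
  assumes "test_function \<Omega> \<psi>" "test_function \<Omega> \<eta>"
  shows "test_function \<Omega> (\<lambda>x. \<psi> x + \<eta> x)"
proof (rule test_functionI)
  show "compact (supp \<psi> \<union> supp \<eta>)"
    by (intro compact_Un assms[THEN test_functionD(2)])
  show "supp \<psi> \<union> supp \<eta> \<subseteq> \<Omega>"
    by (intro Un_least assms[THEN test_functionD(3)])
  show "C_k k (\<lambda>x. \<psi> x + \<eta> x)" for k
    by (intro C_k_add assms[THEN test_functionD(1)])
qed (simp add: not_in_supp[of _ \<psi>] not_in_supp[of _ \<eta>])

lemma test_function_has_derivative:
  assumes "test_function \<Omega> \<psi>"
  shows "(\<psi> has_derivative frechet_derivative \<psi> (at x)) (at x)"
  using test_functionD(1)[OF assms, of "Suc 0"] frechet_derivative_works by auto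

text \<open>Off the closed support the function vanishes on a whole neighbourhood, hence so do its
  derivatives.\<close>

lemma supp_partial_deriv: "supp (partial_deriv i \<psi>) \<subseteq> supp \<psi>"
proof (rule supp_subset[OF closed_supp])
  fix x assume x: "x \<notin> supp \<psi>"
  have "((\<lambda>x. 0) has_derivative (\<lambda>x. 0)) (at x)" by simp
  then have "(\<psi> has_derivative (\<lambda>x. 0)) (at x)"
    by (rule has_derivative_transform_within_open[of _ _ _ _ "- supp \<psi>"])
      (use x in \<open>simp_all add: not_in_supp[of _ \<psi>] open_Compl\<close>)
  then show "partial_deriv i \<psi> x = 0"
    using partial_deriv_eqI by fastforce
qed

lemma test_function_partial_deriv:
  assumes "test_function \<Omega> \<psi>"
  shows "test_function \<Omega> (partial_deriv i \<psi>)"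
proof (rule test_functionI[OF _ test_functionD(2,3)[OF assms]])
  show "C_k k (partial_deriv i \<psi>)" for k
    using test_functionD(1)[OF assms, of "Suc k"] by simp
  show "partial_deriv i \<psi> x = 0" if "x \<notin> supp \<psi>" for x
    using that supp_partial_deriv[of i \<psi>] by (intro not_in_supp[of x "partial_deriv i \<psi>"]) blast
qed

lemma C_k_shift: "C_k k f \<Longrightarrow> C_k k (\<lambda>x. f (x - v))"
proof (induction k arbitrary: f)
  case 0
  then have "continuous_on UNIV f" by simp
  then have "continuous_on UNIV (\<lambda>x. f (x - v))"
    by (rule continuous_on_compose2) (auto intro: continuous_on_diff)
  then show ?case by simp
next
  case (Suc k)
  have d: "((\<lambda>x. f (x - v)) has_derivative frechet_derivative f (at (x - v))) (at x)" for x
  proof -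
    have "(f has_derivative frechet_derivative f (at (x - v))) (at (x - v))"
      using Suc.prems frechet_derivative_works by auto
    then show ?thesis
      by (rule has_derivative_compose[rotated]) (auto intro!: derivative_eq_intros)
  qed
  have "partial_deriv i (\<lambda>x. f (x - v)) = (\<lambda>x. partial_deriv i f (x - v))" for i
    using partial_deriv_eqI[OF d] by (auto simp: partial_deriv_def)
  then show ?case using Suc d by (auto simp: differentiable_def)
qed

section \<open>Local integrability and dominated convergence\<close>

lemma locally_integrable_mult:
  assumes u: "locally_integrable \<Omega> (u :: 'a::euclidean_space \<Rightarrow> real)" and \<psi>: "cc_function \<Omega> \<psi>"
  shows "set_integrable lebesgue \<Omega> (\<lambda>x. u x * \<psi> x)"
proof -
  let ?K = "supp \<psi>"
  have K: "compact ?K" "?K \<subseteq> \<Omega>" and c: "continuous_on UNIV \<psi>"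
    using \<psi> by (auto simp: cc_function_def)
  have c': "continuous_on ?K \<psi>" using c continuous_on_subset by blast
  have "(\<lambda>x. \<psi> x * u x) absolutely_integrable_on ?K"
  proof (rule absolutely_integrable_bounded_measurable_product[OF bilinear_times])
    show "\<psi> \<in> borel_measurable (lebesgue_on ?K)"
      by (intro continuous_imp_measurable_on_sets_lebesgue c') (use K in auto)
    show "bounded (\<psi> ` ?K)"
      using compact_continuous_image[OF c' K(1)] compact_imp_bounded by blast
  qed (use u K in \<open>auto simp: locally_integrable_def\<close>)
  then have "integrable lebesgue (\<lambda>x. indicat_real ?K x *\<^sub>R (\<psi> x * u x))"
    by (simp add: set_integrable_def)
  also have "(\<lambda>x. indicat_real ?K x *\<^sub>R (\<psi> x * u x)) = (\<lambda>x. indicator \<Omega> x *\<^sub>R (u x * \<psi> x))"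
    using K not_in_supp[of _ \<psi>] by (fastforce simp: indicator_def)
  finally show ?thesis by (simp add: set_integrable_def)
qed

lemma continuous_imp_locally_integrable:
  fixes f :: "'a::euclidean_space \<Rightarrow> real"
  assumes "continuous_on \<Omega> f"
  shows "locally_integrable \<Omega> f"
  unfolding locally_integrable_def
proof (intro allI impI)
  fix K assume K: "compact K \<and> K \<subseteq> \<Omega>"
  then have c: "continuous_on K f" using assms continuous_on_subset by blast
  have "(\<lambda>x. f x * 1) absolutely_integrable_on K"
  proof (rule absolutely_integrable_bounded_measurable_product[OF bilinear_times])
    show "f \<in> borel_measurable (lebesgue_on K)"
      by (intro continuous_imp_measurable_on_sets_lebesgue c) (use K lmeasurable_compact fmeasurableD in auto)
    show "bounded (f ` K)"
      using compact_continuous_image[OF c] K compact_imp_bounded by blast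
    show "(\<lambda>x. 1::real) absolutely_integrable_on K"
      using K lmeasurable_compact by (intro absolutely_integrable_on_const) auto
  qed (use K lmeasurable_compact fmeasurableD in auto)
  then show "f absolutely_integrable_on K" by simp
qed

lemma locally_integrable_abs:
  "locally_integrable \<Omega> u \<Longrightarrow> locally_integrable \<Omega> (\<lambda>x. \<bar>u x :: real\<bar>)"
  by (simp add: locally_integrable_def set_integrable_abs)

lemma locally_integrable_component:
  "locally_integrable \<Omega> g \<Longrightarrow> locally_integrable \<Omega> (\<lambda>x. (g x :: real ^ 'n::finite) $ i)"
  unfolding locally_integrable_def
  using absolutely_integrable_component[where b = "axis i 1" and f = g]
  by (auto simp: inner_axis)

lemma locally_integrable_sum:
  fixes u :: "'i \<Rightarrow> 'a::euclidean_space \<Rightarrow> real"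
  assumes "finite I" "\<And>i. i \<in> I \<Longrightarrow> locally_integrable \<Omega> (u i)"
  shows "locally_integrable \<Omega> (\<lambda>x. \<Sum>i\<in>I. u i x)"
  using assms unfolding locally_integrable_def by (auto intro!: absolutely_integrable_sum)

lemma continuous_imp_lebesgue_measurable:
  fixes w :: "'a::euclidean_space \<Rightarrow> 'b::euclidean_space"
  shows "continuous_on UNIV w \<Longrightarrow> w \<in> borel_measurable lebesgue"
  using continuous_imp_measurable_on_sets_lebesgue[of UNIV w] by (simp add: lebesgue_on_UNIV_eq)

text \<open>Dominated convergence with majorant \<open>C * \<bar>u x * \<eta> x\<bar>\<close>. The
  multipliers are controlled only on the support of \<open>\<eta>\<close>, as befits polynomials,
  and convergence almost everywhere admits indicators as limits.\<close>

lemma LINT_mult_tendsto: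
  fixes u :: "'a::euclidean_space \<Rightarrow> real"
  assumes u: "locally_integrable \<Omega> u" and \<eta>: "cc_function \<Omega> \<eta>"
    and w: "\<And>m. continuous_on UNIV (w m)" "w' \<in> borel_measurable lebesgue"
    and lim: "AE x in lebesgue. x \<in> supp \<eta> \<longrightarrow> (\<lambda>m. w m x) \<longlonglongrightarrow> w' x"
    and bd: "\<And>m x. x \<in> supp \<eta> \<Longrightarrow> \<bar>w m x\<bar> \<le> C"
  shows "(\<lambda>m. LINT x:\<Omega>|lebesgue. u x * (w m x * \<eta> x)) \<longlonglongrightarrow> (LINT x:\<Omega>|lebesgue. u x * (w' x * \<eta> x))"
  unfolding set_lebesgue_integral_def
proof (rule integral_dominated_convergence)
  have i: "integrable lebesgue (\<lambda>x. indicator \<Omega> x *\<^sub>R (u x * \<eta> x))"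
    using locally_integrable_mult[OF u \<eta>] by (simp add: set_integrable_def)
  then show "integrable lebesgue (\<lambda>x. C * norm (indicator \<Omega> x *\<^sub>R (u x * \<eta> x)))"
    by (intro integrable_mult_right integrable_norm)
  have [measurable]: "(\<lambda>x. indicator \<Omega> x *\<^sub>R (u x * \<eta> x)) \<in> borel_measurable lebesgue"
    using i by (rule borel_measurable_integrable)
  have [measurable]: "w m \<in> borel_measurable lebesgue" for m
    by (rule continuous_imp_lebesgue_measurable[OF w(1)])
  note w(2)[measurable]
  \<comment> \<open>\<open>u\<close> is not known to be measurable by itself, so the multiplier is
    pulled out of the integrable product of \<open>u\<close> and \<open>\<eta>\<close>.\<close>
  have eq: "indicat_real \<Omega> x *\<^sub>R (u x * (v * \<eta> x)) = v * (indicator \<Omega> x *\<^sub>R (u x * \<eta> x))" for v x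
    by simp
  show "(\<lambda>x. indicat_real \<Omega> x *\<^sub>R (u x * (w' x * \<eta> x))) \<in> borel_measurable lebesgue"
    unfolding eq by measurable
  show "(\<lambda>x. indicat_real \<Omega> x *\<^sub>R (u x * (w m x * \<eta> x))) \<in> borel_measurable lebesgue" for m
    unfolding eq by measurable
  show "AE x in lebesgue. (\<lambda>m. indicat_real \<Omega> x *\<^sub>R (u x * (w m x * \<eta> x)))
      \<longlonglongrightarrow> indicat_real \<Omega> x *\<^sub>R (u x * (w' x * \<eta> x))"
    using lim
  proof eventually_elim
    case (elim x)
    then show ?case
      by (cases "x \<in> supp \<eta>") (auto intro!: tendsto_intros simp: not_in_supp[of x \<eta>])
  qed
  show "AE x in lebesgue. norm (indicat_real \<Omega> x *\<^sub>R (u x * (w m x * \<eta> x)))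
      \<le> C * norm (indicat_real \<Omega> x *\<^sub>R (u x * \<eta> x))" for m
  proof (rule AE_I2)
    fix x
    show "norm (indicat_real \<Omega> x *\<^sub>R (u x * (w m x * \<eta> x))) \<le> C * norm (indicat_real \<Omega> x *\<^sub>R (u x * \<eta> x))"
    proof (cases "x \<in> supp \<eta>")
      case True
      have "\<bar>w m x\<bar> * norm (indicat_real \<Omega> x *\<^sub>R (u x * \<eta> x)) \<le> C * norm (indicat_real \<Omega> x *\<^sub>R (u x * \<eta> x))"
        by (rule mult_right_mono[OF bd[OF True]]) simp
      then show ?thesis unfolding eq norm_mult by simp
    qed (simp add: not_in_supp[of x \<eta>])
  qed
qed

section \<open>From tested inequalities to pointwise ones\<close>

lemma polynomial_approx_sequence:
  fixes v :: "'a::euclidean_space \<Rightarrow> real"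
  assumes "compact K" "continuous_on K v"
  obtains P C where "\<And>m. real_polynomial_function (P m)"
    "\<And>x. x \<in> K \<Longrightarrow> (\<lambda>m. P m x) \<longlonglongrightarrow> v x" "\<And>m x. x \<in> K \<Longrightarrow> \<bar>P m x\<bar> \<le> C"
proof -
  have "\<exists>P. real_polynomial_function P \<and> (\<forall>x\<in>K. \<bar>v x - P x\<bar> < inverse (real (Suc m)))" for m
    by (rule Stone_Weierstrass_real_polynomial_function[OF assms, of "inverse (real (Suc m))"])
      (simp, blast)
  then obtain P where P: "\<And>m. real_polynomial_function (P m)"
      "\<And>m x. x \<in> K \<Longrightarrow> \<bar>v x - P m x\<bar> < inverse (real (Suc m))"
    by metis
  obtain C where C: "\<And>x. x \<in> K \<Longrightarrow> \<bar>v x\<bar> \<le> C"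
    using compact_imp_bounded[OF compact_continuous_image[OF assms(2,1)]]
    by (auto simp: bounded_iff)
  show thesis
  proof
    show "(\<lambda>m. P m x) \<longlonglongrightarrow> v x" if "x \<in> K" for x
    proof -
      have "(\<lambda>m. P m x - v x) \<longlonglongrightarrow> 0"
        by (rule Lim_null_comparison[OF _ LIMSEQ_inverse_real_of_nat])
          (use P(2)[OF that] in \<open>auto simp: abs_minus_commute intro!: always_eventually less_imp_le\<close>)
      then show ?thesis by (simp add: LIM_zero_iff)
    qed
    \<comment> \<open>All approximation errors are below 1, which turns a bound for \<open>v\<close>
      into one uniform in \<open>m\<close>.\<close>
    show "\<bar>P m x\<bar> \<le> C + 1" if "x \<in> K" for m x
    proof -
      have "inverse (real (Suc m)) \<le> 1" by (simp add: field_simps)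
      then show ?thesis using P(2)[OF that, of m] C[OF that] by linarith
    qed
  qed (rule P(1))
qed

text \<open>Polynomial multiples of one bump are test functions, and by Stone--Weierstrass they reach all
  continuous multiples of it, hence its restriction to the set where \<open>g > G\<close>.\<close>

lemma weak_bound_imp_AE_le_local:
  fixes g G :: "real ^ 'n::finite \<Rightarrow> real"
  assumes g: "locally_integrable \<Omega> g" and G: "locally_integrable \<Omega> G"
    and bound: "\<And>\<psi>. test_function \<Omega> \<psi> \<Longrightarrow>
      (LINT x:\<Omega>|lebesgue. g x * \<psi> x) \<le> (LINT x:\<Omega>|lebesgue. G x * \<bar>\<psi> x\<bar>)"
    and r: "cball a r \<subseteq> \<Omega>" "r > 0"
  shows "AE x in lebesgue. x \<in> ball a r \<longrightarrow> g x \<le> G x"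
proof -
  let ?K = "cball a r"
  obtain \<eta> where \<eta>: "test_function \<Omega> \<eta>" "\<And>x. \<eta> x \<ge> 0" "\<And>x. x \<in> ball a r \<Longrightarrow> \<eta> x > 0"
    using test_function_bump[OF r] by blast
  have cc: "cc_function \<Omega> \<eta>" by (rule test_function_imp_cc_function[OF \<eta>(1)])
  have abs_cont: "continuous_on UNIV (\<lambda>x. \<bar>w x\<bar>)" if "continuous_on UNIV w" for w :: "real ^ 'n \<Rightarrow> real"
    using that by (rule continuous_on_rabs)
  have s1: "(LINT x:\<Omega>|lebesgue. g x * (v x * \<eta> x)) \<le> (LINT x:\<Omega>|lebesgue. G x * (\<bar>v x\<bar> * \<eta> x))"
    if v: "continuous_on UNIV v" for v
  proof -
    obtain P C where P: "\<And>m. real_polynomial_function (P m)"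
      "\<And>x. x \<in> supp \<eta> \<Longrightarrow> (\<lambda>m. P m x) \<longlonglongrightarrow> v x" "\<And>m x. x \<in> supp \<eta> \<Longrightarrow> \<bar>P m x\<bar> \<le> C"
      using polynomial_approx_sequence[OF cc_functionD(2)[OF cc] continuous_on_subset[OF v subset_UNIV]]
      by blast
    have Pc: "continuous_on UNIV (P m)" for m
      using C_k_polynomial[OF P(1), where k = 0] by simp
    show ?thesis
    proof (rule LIMSEQ_le)
      show "(\<lambda>m. LINT x:\<Omega>|lebesgue. g x * (P m x * \<eta> x)) \<longlonglongrightarrow> (LINT x:\<Omega>|lebesgue. g x * (v x * \<eta> x))"
        by (rule LINT_mult_tendsto[OF g cc Pc continuous_imp_lebesgue_measurable[OF v] _ P(3)]) (use P(2) in auto)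
      show "(\<lambda>m. LINT x:\<Omega>|lebesgue. G x * (\<bar>P m x\<bar> * \<eta> x)) \<longlonglongrightarrow> (LINT x:\<Omega>|lebesgue. G x * (\<bar>v x\<bar> * \<eta> x))"
        by (rule LINT_mult_tendsto[OF G cc abs_cont[OF Pc] continuous_imp_lebesgue_measurable[OF abs_cont[OF v]], where C = C])
          (use P(2,3) in \<open>auto intro!: AE_I2 tendsto_rabs\<close>)
      have "(LINT x:\<Omega>|lebesgue. g x * (P m x * \<eta> x)) \<le> (LINT x:\<Omega>|lebesgue. G x * (\<bar>P m x\<bar> * \<eta> x))" for m
        using bound[OF test_function_mult[OF \<eta>(1) C_k_polynomial[OF P(1)], of m]] \<eta>(2)
        by (simp add: abs_mult)
      then show "\<exists>N. \<forall>n\<ge>N. (LINT x:\<Omega>|lebesgue. g x * (P n x * \<eta> x)) \<le> (LINT x:\<Omega>|lebesgue. G x * (\<bar>P n x\<bar> * \<eta> x))"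
        by blast
    qed
  qed
  \<comment> \<open>The closed ball is compact, so \<open>g\<close> and \<open>G\<close> are
    integrable over it and \<open>E\<close> is measurable.\<close>
  define E where "E = {x \<in> ?K. G x < g x}"
  have E: "E \<in> sets lebesgue"
  proof -
    have "set_integrable lebesgue ?K g" "set_integrable lebesgue ?K G"
      using g G r by (auto simp: locally_integrable_def)
    then have [measurable]: "(\<lambda>x. indicator ?K x *\<^sub>R g x) \<in> borel_measurable lebesgue"
      "(\<lambda>x. indicator ?K x *\<^sub>R G x) \<in> borel_measurable lebesgue"
      unfolding set_integrable_def by (auto dest: borel_measurable_integrable)
    have "{x \<in> space lebesgue. indicator ?K x *\<^sub>R G x < indicator ?K x *\<^sub>R g x} \<in> sets lebesgue"
      by measurable
    also have "{x \<in> space lebesgue. indicator ?K x *\<^sub>R G x < indicator ?K x *\<^sub>R g x} = E"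
      by (auto simp: E_def indicator_def)
    finally show ?thesis .
  qed
  then have mE: "indicat_real E \<in> borel_measurable lebesgue" by simp
  \<comment> \<open>The definition of \<open>measurable_on\<close> supplies continuous functions
    converging to the indicator off a negligible set.\<close>
  then have "indicat_real E measurable_on UNIV"
    using measurable_on_iff_borel_measurable[of UNIV "indicat_real E"] by (simp add: lebesgue_on_UNIV_eq)
  then obtain N h where N: "negligible N" and h: "\<And>n. continuous_on UNIV (h n)"
      "\<And>x. x \<notin> N \<Longrightarrow> (\<lambda>n. h n x) \<longlonglongrightarrow> indicat_real E x"
    unfolding measurable_on_def by auto
  \<comment> \<open>Clipping to the interval from 0 to 1 keeps the limit, gives a uniform bound and
    removes the absolute value in the inequality for continuous multipliers.\<close>
  define v where "v n x = max 0 (min 1 (h n x))" for n :: nat and x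
  have v: "continuous_on UNIV (v n)" for n
    unfolding v_def by (intro continuous_on_max continuous_on_min continuous_on_const h)
  have vlim: "AE x in lebesgue. (\<lambda>n. v n x) \<longlonglongrightarrow> indicat_real E x"
  proof -
    have "(\<lambda>n. v n x) \<longlonglongrightarrow> max 0 (min 1 (indicat_real E x))" if "x \<notin> N" for x
      unfolding v_def using h(2)[OF that] by (intro tendsto_intros)
    then have "(\<lambda>n. v n x) \<longlonglongrightarrow> indicat_real E x" if "x \<notin> N" for x
      using that by (auto simp: indicator_def split: if_splits)
    moreover have "AE x in lebesgue. x \<notin> N"
      using N by (simp add: negligible_iff_null_sets AE_not_in)
    ultimately show ?thesis by auto
  qed
  have vb: "\<bar>v n x\<bar> \<le> 1" "\<bar>v n x\<bar> = v n x" for n x by (auto simp: v_def)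
  have le: "(LINT x:\<Omega>|lebesgue. g x * (indicat_real E x * \<eta> x)) \<le> (LINT x:\<Omega>|lebesgue. G x * (indicat_real E x * \<eta> x))"
  proof (rule LIMSEQ_le)
    show "(\<lambda>m. LINT x:\<Omega>|lebesgue. g x * (v m x * \<eta> x)) \<longlonglongrightarrow> (LINT x:\<Omega>|lebesgue. g x * (indicat_real E x * \<eta> x))"
      by (rule LINT_mult_tendsto[OF g cc v mE _ vb(1)]) (use vlim in auto)
    show "(\<lambda>m. LINT x:\<Omega>|lebesgue. G x * (v m x * \<eta> x)) \<longlonglongrightarrow> (LINT x:\<Omega>|lebesgue. G x * (indicat_real E x * \<eta> x))"
      by (rule LINT_mult_tendsto[OF G cc v mE _ vb(1)]) (use vlim in auto)
  qed (use s1[OF v] vb in auto)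
  have int: "integrable lebesgue (\<lambda>x. indicat_real \<Omega> x *\<^sub>R (u x * (indicat_real E x * \<eta> x)))"
    if "locally_integrable \<Omega> u" for u :: "real ^ 'n \<Rightarrow> real"
  proof -
    have "integrable lebesgue (\<lambda>x. indicat_real E x *\<^sub>R (indicat_real \<Omega> x *\<^sub>R (u x * \<eta> x)))"
      by (rule integrable_mult_indicator[OF E])
        (use locally_integrable_mult[OF that cc] in \<open>simp add: set_integrable_def\<close>)
    then show ?thesis by (simp add: mult_ac)
  qed
  \<comment> \<open>This integrand is nonnegative by the choice of \<open>E\<close>, yet its
    integral is at most 0. It therefore vanishes almost everywhere, and positivity of
    \<open>\<eta>\<close> on the open ball leaves no room for \<open>E\<close> there.\<close>
  let ?d = "\<lambda>x. indicat_real \<Omega> x *\<^sub>R (g x * (indicat_real E x * \<eta> x)) - indicat_real \<Omega> x *\<^sub>R (G x * (indicat_real E x * \<eta> x))"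
  have d: "integrable lebesgue ?d" by (intro Bochner_Integration.integrable_diff int g G)
  have pos: "0 \<le> ?d x" for x
    using \<eta>(2)[of x] by (auto simp: indicator_def E_def mult_right_mono)
  have "integral\<^sup>L lebesgue ?d \<le> 0"
    unfolding Bochner_Integration.integral_diff[OF int[OF g] int[OF G]]
    using le by (simp add: set_lebesgue_integral_def)
  moreover have "integral\<^sup>L lebesgue ?d \<ge> 0"
    by (rule Bochner_Integration.integral_nonneg) (rule pos)
  ultimately have "AE x in lebesgue. ?d x = 0"
    using integral_nonneg_eq_0_iff_AE[OF d] pos by force
  then show ?thesis
  proof eventually_elim
    case (elim x)
    show ?case
    proof (intro impI leI notI)
      assume x: "x \<in> ball a r" "G x < g x"
      then have "x \<in> E" "x \<in> \<Omega>" using r by (auto simp: E_def)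
      then show False using elim x \<eta>(3)[OF x(1)] by (simp add: mult_less_cancel_right)
    qed
  qed
qed

text \<open>By the Lindelof property countably many balls cover \<Omega>, so the exceptional null
  sets of the local result can be united.\<close>

lemma weak_bound_imp_AE_le:
  fixes g G :: "real ^ 'n::finite \<Rightarrow> real"
  assumes \<Omega>: "open \<Omega>" and g: "locally_integrable \<Omega> g" and G: "locally_integrable \<Omega> G"
    and bound: "\<And>\<psi>. test_function \<Omega> \<psi> \<Longrightarrow>
      (LINT x:\<Omega>|lebesgue. g x * \<psi> x) \<le> (LINT x:\<Omega>|lebesgue. G x * \<bar>\<psi> x\<bar>)"
  shows "AE x in lebesgue. x \<in> \<Omega> \<longrightarrow> g x \<le> G x"
proof -
  define \<F> where "\<F> = {ball a r | a r. cball a r \<subseteq> \<Omega> \<and> r > 0}"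
  obtain \<G> where \<G>: "\<G> \<subseteq> \<F>" "countable \<G>" "\<Union>\<G> = \<Union>\<F>"
    using Lindelof[of \<F>] unfolding \<F>_def by force
  have un: "\<Union>\<F> = \<Omega>"
  proof
    show "\<Omega> \<subseteq> \<Union>\<F>"
    proof
      fix x assume "x \<in> \<Omega>"
      then obtain r where "r > 0" "cball x r \<subseteq> \<Omega>" using \<Omega> open_contains_cball by blast
      then show "x \<in> \<Union>\<F>" unfolding \<F>_def by (auto intro!: exI[of _ "ball x r"])
    qed
  qed (force simp: \<F>_def)
  have "AE x in lebesgue. \<forall>B\<in>\<G>. x \<in> B \<longrightarrow> g x \<le> G x"
    unfolding AE_ball_countable[OF \<G>(2)]
  proof
    fix B assume "B \<in> \<G>"
    then obtain a r where "B = ball a r" "cball a r \<subseteq> \<Omega>" "r > 0" using \<G>(1) by (auto simp: \<F>_def)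
    then show "AE x in lebesgue. x \<in> B \<longrightarrow> g x \<le> G x"
      using weak_bound_imp_AE_le_local[OF g G bound] by blast
  qed
  then show ?thesis
    by eventually_elim (use \<G>(3) un in blast)
qed

subsection \<open>Difference quotients\<close>

text \<open>The Minkowski sum of \<open>K\<close> with a small closed ball is compact, while the
  mere union of balls around the points of \<open>K\<close> would need an extra argument.\<close>

lemma compact_thickening:
  fixes K :: "'a::euclidean_space set"
  assumes "compact K" "open \<Omega>" "K \<subseteq> \<Omega>"
  obtains \<delta> K' where "\<delta> > 0" "compact K'" "K' \<subseteq> \<Omega>" "\<And>x. x \<in> K \<Longrightarrow> cball x \<delta> \<subseteq> K'"
proof -
  obtain \<delta> where \<delta>: "\<delta> > 0" "(\<Union>x\<in>K. cball x \<delta>) \<subseteq> \<Omega>"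
    using compact_subset_open_imp_cball_epsilon_subset[OF assms] by blast
  let ?K' = "\<Union>x\<in>K. \<Union>y\<in>cball 0 \<delta>. {x + y}"
  have "cball x \<delta> \<subseteq> ?K'" if "x \<in> K" for x
  proof
    fix z assume "z \<in> cball x \<delta>"
    then have "z = x + (z - x)" "z - x \<in> cball 0 \<delta>" by (auto simp: dist_norm norm_minus_commute)
    then show "z \<in> ?K'" using that by blast
  qed
  moreover have "?K' \<subseteq> \<Omega>"
  proof -
    have "x + y \<in> cball x \<delta>" if "y \<in> cball 0 \<delta>" for x y :: 'a
      using that by (simp add: dist_norm)
    then show ?thesis using \<delta>(2) by blast
  qed
  moreover have "compact ?K'" by (rule compact_sums'[OF assms(1) compact_cball])
  ultimately show thesis using \<delta>(1) that by blast
qed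

lemma partial_deriv_shift:
  assumes "test_function \<Omega> \<psi>"
  shows "partial_deriv i (\<lambda>x. \<psi> (x - v)) = (\<lambda>x. partial_deriv i \<psi> (x - v))"
proof
  fix x
  have "((\<lambda>x. \<psi> (x - v)) has_derivative frechet_derivative \<psi> (at (x - v))) (at x)"
    by (rule has_derivative_compose[OF _ test_function_has_derivative[OF assms]])
      (auto intro!: derivative_eq_intros)
  then show "partial_deriv i (\<lambda>x. \<psi> (x - v)) x = partial_deriv i \<psi> (x - v)"
    using partial_deriv_eqI by (fastforce simp: partial_deriv_def)
qed

lemma has_real_derivative_shift:
  assumes "test_function \<Omega> \<psi>"
  shows "((\<lambda>s. \<psi> (x - s *\<^sub>R axis i 1)) has_real_derivative - partial_deriv i \<psi> (x - s *\<^sub>R axis i 1)) (at s within S)"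
proof -
  let ?D = "frechet_derivative \<psi> (at (x - s *\<^sub>R axis i 1))"
  have D: "(\<psi> has_derivative ?D) (at (x - s *\<^sub>R axis i 1))"
    by (rule test_function_has_derivative[OF assms])
  have "((\<lambda>s. \<psi> (x - s *\<^sub>R axis i 1)) has_derivative (\<lambda>h. ?D (- (h *\<^sub>R axis i 1)))) (at s within S)"
    by (rule has_derivative_compose[where f = "\<lambda>s. x - s *\<^sub>R axis i 1" and g = \<psi>, OF _ D])
      (auto intro!: derivative_eq_intros)
  moreover have "(\<lambda>h. ?D (- (h *\<^sub>R axis i 1))) = (*) (- partial_deriv i \<psi> (x - s *\<^sub>R axis i 1))"
    using linear_scale[OF has_derivative_linear[OF D]] linear_neg[OF has_derivative_linear[OF D]]
    by (simp add: partial_deriv_def fun_eq_iff)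
  ultimately show ?thesis
    unfolding has_field_derivative_def by simp
qed

text \<open>All translates of \<open>\<psi>\<close> by at most \<open>\<delta>\<close> then vanish off the compact set \<open>K' \<subseteq> \<Omega>\<close>.\<close>

definition thick_supp :: "'a::euclidean_space set \<Rightarrow> ('a \<Rightarrow> real) \<Rightarrow> real \<Rightarrow> 'a set \<Rightarrow> bool" where
  "thick_supp \<Omega> \<psi> \<delta> K' \<longleftrightarrow>
     \<delta> > 0 \<and> compact K' \<and> K' \<subseteq> \<Omega> \<and> (\<forall>x\<in>supp \<psi>. cball x \<delta> \<subseteq> K')"

lemma thick_suppD:
  assumes "thick_supp \<Omega> \<psi> \<delta> K'"
  shows "\<delta> > 0" "compact K'" "K' \<subseteq> \<Omega>" "\<And>x. x \<in> supp \<psi> \<Longrightarrow> cball x \<delta> \<subseteq> K'"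
  using assms unfolding thick_supp_def by auto

lemma thick_supp_zero:
  assumes "thick_supp \<Omega> \<psi> \<delta> K'" "norm v \<le> \<delta>" "x \<notin> K'"
  shows "\<psi> (x - v) = 0"
proof (rule not_in_supp[of "x - v" \<psi>])
  show "x - v \<notin> supp \<psi>"
  proof
    assume "x - v \<in> supp \<psi>"
    moreover have "x \<in> cball (x - v) \<delta>" using assms(2) by (simp add: dist_norm)
    ultimately show False using thick_suppD(4)[OF assms(1)] assms(3) by blast
  qed
qed

lemma thick_supp_mono:
  assumes "thick_supp \<Omega> \<psi> \<delta> K'" "supp \<eta> \<subseteq> supp \<psi>"
  shows "thick_supp \<Omega> \<eta> \<delta> K'"
  using assms unfolding thick_supp_def by blast

lemma thick_supp_exists:
  assumes "open \<Omega>" "cc_function \<Omega> \<psi>"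
  obtains \<delta> K' where "thick_supp \<Omega> \<psi> \<delta> K'"
  using compact_thickening[OF cc_functionD(2)[OF assms(2)] assms(1) cc_functionD(3)[OF assms(2)]]
  unfolding thick_supp_def by metis

lemma test_function_shift:
  assumes "test_function \<Omega> \<psi>" "thick_supp \<Omega> \<psi> \<delta> K'" "norm v \<le> \<delta>"
  shows "test_function \<Omega> (\<lambda>x. \<psi> (x - v))"
  by (rule test_functionI[OF C_k_shift[OF test_functionD(1)[OF assms(1)]] thick_suppD(2,3)[OF assms(2)]
      thick_supp_zero[OF assms(2,3)]])

lemma LINT_restrict:
  fixes f :: "'a::euclidean_space \<Rightarrow> real"
  assumes "K \<subseteq> \<Omega>" "\<And>x. x \<notin> K \<Longrightarrow> f x = 0"
  shows "(LINT x:\<Omega>|lebesgue. f x) = (LINT x:K|lebesgue. f x)"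
    and "set_integrable lebesgue \<Omega> f \<longleftrightarrow> set_integrable lebesgue K f"
proof -
  have "(\<lambda>x. indicat_real \<Omega> x *\<^sub>R f x) = (\<lambda>x. indicat_real K x *\<^sub>R f x)"
    using assms by (fastforce simp: indicator_def)
  then show "(LINT x:\<Omega>|lebesgue. f x) = (LINT x:K|lebesgue. f x)"
    and "set_integrable lebesgue \<Omega> f \<longleftrightarrow> set_integrable lebesgue K f"
    by (simp_all add: set_lebesgue_integral_def set_integrable_def)
qed

text \<open>Estimates error terms: a multiplier that is uniformly small and lives on a fixed compact
  set contributes little, whatever the locally integrable \<open>u\<close> is.\<close>

lemma LINT_mult_bound:
  fixes u :: "'a::euclidean_space \<Rightarrow> real"
  assumes u: "locally_integrable \<Omega> u" and w: "continuous_on UNIV w"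
    and K: "compact K" "K \<subseteq> \<Omega>" and z: "\<And>x. x \<notin> K \<Longrightarrow> w x = 0" and b: "\<And>x. \<bar>w x\<bar> \<le> \<epsilon>"
  shows "(LINT x:\<Omega>|lebesgue. \<bar>u x\<bar> * \<bar>w x\<bar>) \<le> \<epsilon> * (LINT x:K|lebesgue. \<bar>u x\<bar>)"
    and "\<bar>LINT x:\<Omega>|lebesgue. u x * w x\<bar> \<le> \<epsilon> * (LINT x:K|lebesgue. \<bar>u x\<bar>)"
proof -
  have cc: "cc_function \<Omega> w" by (rule cc_functionI[OF w K z])
  have z': "x \<notin> K \<Longrightarrow> \<bar>u x\<bar> * \<bar>w x\<bar> = 0" for x using z by simp
  have i: "set_integrable lebesgue \<Omega> (\<lambda>x. u x * w x)"
    by (rule locally_integrable_mult[OF u cc])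
  have j: "set_integrable lebesgue \<Omega> (\<lambda>x. \<bar>u x\<bar> * \<bar>w x\<bar>)"
    by (rule locally_integrable_mult[OF locally_integrable_abs[OF u] cc_function_abs[OF cc]])
  have k: "set_integrable lebesgue K (\<lambda>x. \<bar>u x\<bar>)"
    using locally_integrable_abs[OF u] K by (simp add: locally_integrable_def)
  have "(LINT x:\<Omega>|lebesgue. \<bar>u x\<bar> * \<bar>w x\<bar>) = (LINT x:K|lebesgue. \<bar>u x\<bar> * \<bar>w x\<bar>)"
    by (rule LINT_restrict(1)[OF K(2) z'])
  also have "\<dots> \<le> (LINT x:K|lebesgue. \<epsilon> * \<bar>u x\<bar>)"
  proof (rule set_integral_mono)
    show "set_integrable lebesgue K (\<lambda>x. \<bar>u x\<bar> * \<bar>w x\<bar>)"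
      using j LINT_restrict(2)[OF K(2) z'] by simp
    show "\<bar>u x\<bar> * \<bar>w x\<bar> \<le> \<epsilon> * \<bar>u x\<bar>" for x
      using mult_left_mono[OF b[of x], of "\<bar>u x\<bar>"] by (simp add: mult.commute)
  qed (use k in simp)
  finally show 1: "(LINT x:\<Omega>|lebesgue. \<bar>u x\<bar> * \<bar>w x\<bar>) \<le> \<epsilon> * (LINT x:K|lebesgue. \<bar>u x\<bar>)" by simp
  have "\<bar>LINT x:\<Omega>|lebesgue. u x * w x\<bar> \<le> (LINT x:\<Omega>|lebesgue. \<bar>u x\<bar> * \<bar>w x\<bar>)"
    using set_integral_norm_bound[OF i] by (simp add: abs_mult)
  with 1 show "\<bar>LINT x:\<Omega>|lebesgue. u x * w x\<bar> \<le> \<epsilon> * (LINT x:K|lebesgue. \<bar>u x\<bar>)" by linarith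
qed

text \<open>The parameter sits in the smooth factor, so \<open>u\<close> need only be locally
  integrable. Uniform continuity of the partial derivative makes the difference quotients of the
  translated \<open>\<psi>\<close> converge uniformly, inside one compact set.\<close>

lemma LINT_shift_has_derivative:
  fixes u :: "real ^ 'n::finite \<Rightarrow> real"
  assumes u: "locally_integrable \<Omega> u" and \<psi>: "test_function \<Omega> \<psi>"
    and K': "thick_supp \<Omega> \<psi> \<delta> K'" and s: "\<bar>s\<bar> < \<delta>"
  shows "((\<lambda>s. LINT x:\<Omega>|lebesgue. u x * \<psi> (x - s *\<^sub>R axis i 1)) has_real_derivative
      - (LINT x:\<Omega>|lebesgue. u x * partial_deriv i \<psi> (x - s *\<^sub>R axis i 1))) (at s)"
proof -
  let ?e = "axis i (1::real)"
  let ?\<psi>' = "partial_deriv i \<psi>"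
  define F where "F s = (LINT x:\<Omega>|lebesgue. u x * \<psi> (x - s *\<^sub>R ?e))" for s
  define D where "D = - (LINT x:\<Omega>|lebesgue. u x * ?\<psi>' (x - s *\<^sub>R ?e))"
  define A where "A = (LINT x:K'|lebesgue. \<bar>u x\<bar>)"
  have A: "A \<ge> 0" unfolding A_def set_lebesgue_integral_def by (rule Bochner_Integration.integral_nonneg) simp
  have \<psi>': "test_function \<Omega> ?\<psi>'" by (rule test_function_partial_deriv[OF \<psi>])
  note K'' = thick_supp_mono[OF K' supp_partial_deriv, of i]
  have ns: "norm (\<tau> *\<^sub>R ?e) \<le> \<delta>" if "\<bar>\<tau>\<bar> \<le> \<delta>" for \<tau> using that by simp
  have i1: "set_integrable lebesgue \<Omega> (\<lambda>x. u x * \<psi> (x - \<tau> *\<^sub>R ?e))" if "\<bar>\<tau>\<bar> \<le> \<delta>" for \<tau>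
    by (rule locally_integrable_mult[OF u test_function_imp_cc_function[OF test_function_shift[OF \<psi> K' ns[OF that]]]])
  have i2: "set_integrable lebesgue \<Omega> (\<lambda>x. u x * ?\<psi>' (x - \<tau> *\<^sub>R ?e))" if "\<bar>\<tau>\<bar> \<le> \<delta>" for \<tau>
    by (rule locally_integrable_mult[OF u test_function_imp_cc_function[OF test_function_shift[OF \<psi>' K'' ns[OF that]]]])
  have "((\<lambda>h. (F (s + h) - F s) / h) \<longlongrightarrow> D) (at 0)"
  proof (rule tendstoI)
    fix \<epsilon>' :: real assume \<epsilon>': "\<epsilon>' > 0"
    \<comment> \<open>The summand 1 covers the case \<open>A = 0\<close>.\<close>
    define \<epsilon> where "\<epsilon> = \<epsilon>' / (A + 1)"
    have \<epsilon>: "\<epsilon> > 0" "\<epsilon> * A < \<epsilon>'" using A \<epsilon>' by (auto simp: \<epsilon>_def field_simps)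
    \<comment> \<open>A compact set containing every point \<open>x - \<tau> *\<^sub>R ?e\<close>
      with \<open>x\<close> in \<open>K'\<close> that the mean value estimate visits.\<close>
    define S where "S = (\<Union>x\<in>K'. \<Union>y\<in>cball 0 \<delta>. {x + y})"
    have "compact S" unfolding S_def by (rule compact_sums'[OF thick_suppD(2)[OF K'] compact_cball])
    then have "uniformly_continuous_on S ?\<psi>'"
      by (intro compact_uniformly_continuous cc_functionD(1)[OF test_function_imp_cc_function[OF \<psi>']])
    then obtain d where d: "d > 0" "\<And>a b. a \<in> S \<Longrightarrow> b \<in> S \<Longrightarrow> dist b a < d \<Longrightarrow> dist (?\<psi>' b) (?\<psi>' a) < \<epsilon>"
      unfolding uniformly_continuous_on_def using \<epsilon>(1) by metis
    have in_S: "x - \<tau> *\<^sub>R ?e \<in> S" if "x \<in> K'" "\<bar>\<tau>\<bar> \<le> \<delta>" for x \<tau>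
      unfolding S_def using that(2) by (intro UN_I[OF that(1)] UN_I[of "- (\<tau> *\<^sub>R ?e)"]) auto
    have "dist ((F (s + h) - F s) / h) D < \<epsilon>'" if h: "h \<noteq> 0" "\<bar>h\<bar> < min d (\<delta> - \<bar>s\<bar>)" for h
    proof -
      have sh: "\<bar>s + h\<bar> \<le> \<delta>" "\<bar>s\<bar> \<le> \<delta>" using h s by linarith+
      define q where "q x = (\<psi> (x - (s + h) *\<^sub>R ?e) - \<psi> (x - s *\<^sub>R ?e)) / h + ?\<psi>' (x - s *\<^sub>R ?e)" for x
      have "\<bar>LINT x:\<Omega>|lebesgue. u x * q x\<bar> \<le> \<epsilon> * A"
        unfolding A_def
      proof (rule LINT_mult_bound(2)[OF u _ thick_suppD(2,3)[OF K']])
        have c: "continuous_on UNIV (\<lambda>x. \<psi> (x - \<tau> *\<^sub>R ?e))" "continuous_on UNIV (\<lambda>x. ?\<psi>' (x - \<tau> *\<^sub>R ?e))"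
          if "\<bar>\<tau>\<bar> \<le> \<delta>" for \<tau>
          using test_function_shift[OF \<psi> K' ns[OF that]] test_function_shift[OF \<psi>' K'' ns[OF that]]
          by (blast intro: cc_functionD(1) test_function_imp_cc_function)+
        show "continuous_on UNIV q"
          unfolding q_def using h(1)
          by (intro continuous_on_add continuous_on_divide continuous_on_diff c sh continuous_on_const) auto
        show z: "q x = 0" if "x \<notin> K'" for x
          using thick_supp_zero[OF K' ns[OF sh(1)] that] thick_supp_zero[OF K' ns[OF sh(2)] that]
            thick_supp_zero[OF K'' ns[OF sh(2)] that]
          by (simp add: q_def)
        show "\<bar>q x\<bar> \<le> \<epsilon>" for x
        proof (cases "x \<in> K'")
          case True
          \<comment> \<open>The linear term cancels the derivative at \<open>s\<close>. What remains
            is a difference of two nearby values of \<open>?\<psi>'\<close>, so the mean value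
            inequality has the small constant \<open>\<epsilon>\<close>.\<close>
          let ?f = "\<lambda>\<tau>. \<psi> (x - \<tau> *\<^sub>R ?e) + \<tau> * ?\<psi>' (x - s *\<^sub>R ?e)"
          have "norm (?f (s + h) - ?f s) \<le> \<epsilon> * norm (s + h - s)"
          proof (rule field_differentiable_bound[of "cball s \<bar>h\<bar>"])
            fix \<tau> assume \<tau>: "\<tau> \<in> cball s \<bar>h\<bar>"
            then have \<tau>': "\<bar>\<tau>\<bar> \<le> \<delta>" "\<bar>\<tau> - s\<bar> < d" using h s by (auto simp: dist_real_def)
            show "(?f has_field_derivative (- ?\<psi>' (x - \<tau> *\<^sub>R ?e) + ?\<psi>' (x - s *\<^sub>R ?e))) (at \<tau> within cball s \<bar>h\<bar>)"
              by (auto intro!: derivative_eq_intros has_real_derivative_shift[OF \<psi>])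
            have "dist (x - \<tau> *\<^sub>R ?e) (x - s *\<^sub>R ?e) = \<bar>\<tau> - s\<bar>"
              by (simp add: dist_norm flip: scaleR_diff_left)
            then show "norm (- ?\<psi>' (x - \<tau> *\<^sub>R ?e) + ?\<psi>' (x - s *\<^sub>R ?e)) \<le> \<epsilon>"
              using d(2)[OF in_S[OF True sh(2)] in_S[OF True \<tau>'(1)]] \<tau>'(2)
              by (simp add: dist_real_def abs_minus_commute)
          qed (auto simp: dist_real_def)
          moreover have "q x * h = (\<psi> (x - (s + h) *\<^sub>R ?e) - \<psi> (x - s *\<^sub>R ?e)) + ?\<psi>' (x - s *\<^sub>R ?e) * h"
            using h(1) by (simp add: q_def distrib_right)
          ultimately have "\<bar>q x * h\<bar> \<le> \<epsilon> * \<bar>h\<bar>" by (simp add: algebra_simps)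
          then show ?thesis using h(1) by (simp add: abs_mult)
        qed (use z \<epsilon>(1) in auto)
      qed
      moreover have "(LINT x:\<Omega>|lebesgue. u x * q x) = (F (s + h) - F s) / h - D"
      proof -
        have "(LINT x:\<Omega>|lebesgue. u x * q x) = (LINT x:\<Omega>|lebesgue.
            (u x * \<psi> (x - (s + h) *\<^sub>R ?e) - u x * \<psi> (x - s *\<^sub>R ?e)) / h + u x * ?\<psi>' (x - s *\<^sub>R ?e))"
          by (rule arg_cong[where f = "\<lambda>f. set_lebesgue_integral lebesgue \<Omega> f"])
            (auto simp: q_def fun_eq_iff field_simps)
        also have "\<dots> = (F (s + h) - F s) / h - D"
          using i1[OF sh(1)] i1[OF sh(2)] i2[OF sh(2)] by (simp add: F_def D_def)
        finally show ?thesis .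
      qed
      ultimately show ?thesis using \<epsilon>(2) by (simp add: dist_real_def)
    qed
    then show "\<forall>\<^sub>F h in at 0. dist ((F (s + h) - F s) / h) D < \<epsilon>'"
      unfolding eventually_at using d(1) s by (intro exI[of _ "min d (\<delta> - \<bar>s\<bar>)"]) (auto simp: dist_real_def)
  qed
  then show ?thesis unfolding DERIV_def F_def D_def .
qed

lemma lborel_integral_shift:
  fixes f :: "'a::euclidean_space \<Rightarrow> real"
  assumes "f \<in> borel_measurable borel"
  shows "(\<integral>x. f (c + x) \<partial>lborel) = integral\<^sup>L lborel f"
  using integral_distr[of "(+) c" lborel borel f] assms by (simp add: lborel_distr_plus)

text \<open>Translation invariance is applied to Borel functions under \<open>lborel\<close>, hence
  the zero extension of \<open>u\<close> and the passage through the completion. On the support of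
  \<open>\<psi>\<close> both \<open>x\<close> and \<open>x + v\<close> lie in \<Omega>, so the
  extension does not alter the integral.\<close>

lemma LINT_shift:
  fixes u :: "real ^ 'n::finite \<Rightarrow> real"
  assumes \<Omega>: "open \<Omega>" and u: "continuous_on \<Omega> u" and \<psi>: "test_function \<Omega> \<psi>"
    and K': "thick_supp \<Omega> \<psi> \<delta> K'" and v: "norm v \<le> \<delta>"
  shows "(LINT x:\<Omega>|lebesgue. u x * \<psi> (x - v)) = (LINT x:\<Omega>|lebesgue. u (x + v) * \<psi> x)"
proof -
  let ?U = "\<lambda>x. indicat_real \<Omega> x *\<^sub>R u x"
  have [measurable]: "?U \<in> borel_measurable borel"
    using \<Omega> by (intro borel_measurable_continuous_on_indicator u) auto
  have [measurable]: "\<psi> \<in> borel_measurable borel"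
    using cc_functionD(1)[OF test_function_imp_cc_function[OF \<psi>], of UNIV]
    by (rule borel_measurable_continuous_onI)
  have "(LINT x:\<Omega>|lebesgue. u x * \<psi> (x - v)) = (\<integral>x. ?U x * \<psi> (x - v) \<partial>lebesgue)"
    by (simp add: set_lebesgue_integral_def mult.assoc)
  also have "\<dots> = (\<integral>x. ?U x * \<psi> (x - v) \<partial>lborel)"
    by (rule integral_completion) measurable
  also have "\<dots> = (\<integral>x. ?U (v + x) * \<psi> ((v + x) - v) \<partial>lborel)"
    by (rule lborel_integral_shift[symmetric]) measurable
  also have "\<dots> = (\<integral>x. ?U (v + x) * \<psi> ((v + x) - v) \<partial>lebesgue)"
    by (rule integral_completion[symmetric]) measurable
  also have "\<dots> = (LINT x:\<Omega>|lebesgue. u (x + v) * \<psi> x)"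
    unfolding set_lebesgue_integral_def
  proof (rule Bochner_Integration.integral_cong[OF refl])
    fix x
    show "?U (v + x) * \<psi> (v + x - v) = indicat_real \<Omega> x *\<^sub>R (u (x + v) * \<psi> x)"
    proof (cases "x \<in> supp \<psi>")
      case True
      then have "cball x \<delta> \<subseteq> \<Omega>" using thick_suppD(3,4)[OF K'] by blast
      moreover have "x \<in> cball x \<delta>" "v + x \<in> cball x \<delta>"
        using v thick_suppD(1)[OF K'] by (simp_all add: dist_norm)
      ultimately have "x \<in> \<Omega>" "v + x \<in> \<Omega>" by blast+
      then show ?thesis by (simp add: add.commute)
    qed (simp add: not_in_supp[of x \<psi>])
  qed
  finally show ?thesis .
qed


lemma cc_function_bounded:
  assumes "cc_function \<Omega> \<psi>"
  obtains L where "\<And>x. \<bar>\<psi> x\<bar> \<le> L" "L \<ge> 0"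
proof -
  have "bounded (\<psi> ` supp \<psi>)"
    by (intro compact_imp_bounded compact_continuous_image cc_functionD[OF assms])
  then obtain L where L: "\<And>x. x \<in> supp \<psi> \<Longrightarrow> \<bar>\<psi> x\<bar> \<le> L" by (auto simp: bounded_iff)
  have "\<bar>\<psi> x\<bar> \<le> max L 0" for x
    using L[of x] not_in_supp[of x \<psi>] by (cases "x \<in> supp \<psi>") auto
  then show thesis using that[of "max L 0"] by simp
qed

text \<open>Continuity is required on the support only: a translate \<open>u (x + v)\<close> is
  controlled there, but for other points of \<Omega> the argument may leave \<Omega>.\<close>

lemma continuous_mult_cc_integrable:
  fixes f :: "'a::euclidean_space \<Rightarrow> real"
  assumes "cc_function \<Omega> \<psi>" "continuous_on (supp \<psi>) f"
  shows "set_integrable lebesgue \<Omega> (\<lambda>x. f x * \<psi> x)"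
proof -
  have "continuous_on (supp \<psi>) (\<lambda>x. f x * \<psi> x)"
    by (intro continuous_on_mult assms(2) cc_functionD(1)[OF assms(1)])
  then have "set_integrable lebesgue (supp \<psi>) (\<lambda>x. f x * \<psi> x)"
    using continuous_imp_locally_integrable cc_functionD(2)[OF assms(1)]
    unfolding locally_integrable_def by blast
  then show ?thesis
    using LINT_restrict(2)[OF cc_functionD(3)[OF assms(1)], of "\<lambda>x. f x * \<psi> x"] not_in_supp[of _ \<psi>] by simp
qed

lemma thick_supp_continuous_difference:
  assumes "thick_supp \<Omega> \<psi> \<delta> K'" "continuous_on \<Omega> u" "norm v \<le> \<delta>"
  shows "continuous_on (supp \<psi>) (\<lambda>x. u (x + v) - u x :: real)"
proof -
  have *: "x + v \<in> \<Omega>" "x \<in> \<Omega>" if "x \<in> supp \<psi>" for x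
  proof -
    have "cball x \<delta> \<subseteq> \<Omega>" using thick_suppD(3,4)[OF assms(1)] that by blast
    moreover have "x + v \<in> cball x \<delta>" "x \<in> cball x \<delta>"
      using assms(3) thick_suppD(1)[OF assms(1)] by (simp_all add: dist_norm)
    ultimately show "x + v \<in> \<Omega>" "x \<in> \<Omega>" by blast+
  qed
  show ?thesis
    by (intro continuous_on_diff continuous_on_compose2[OF assms(2)] continuous_on_add
        continuous_on_id continuous_on_const) (use * in auto)
qed

text \<open>Testing \<open>u (x + t e) - u x\<close> against a smooth \<open>P \<psi>\<close> and moving the translation to the test
  function brings in the weak gradient; a polynomial \<open>P\<close> close to the sign of the difference on
  the support of \<open>\<psi>\<close> then yields the \<open>L\<^sub>1\<close> bound.\<close>

lemma LINT_difference_bound: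
  fixes u :: "real ^ 'n::finite \<Rightarrow> real"
  assumes \<Omega>: "open \<Omega>" and u: "continuous_on \<Omega> u" and g: "locally_integrable \<Omega> g"
    and weak: "\<And>\<eta>. test_function \<Omega> \<eta> \<Longrightarrow>
      (LINT x:\<Omega>|lebesgue. u x * partial_deriv i \<eta> x) = - (LINT x:\<Omega>|lebesgue. g x * \<eta> x)"
    and \<psi>: "test_function \<Omega> \<psi>"
  shows "\<exists>C. \<forall>\<^sub>F t in at_right 0. (LINT x:\<Omega>|lebesgue. \<bar>u (x + t *\<^sub>R axis i 1) - u x\<bar> * \<bar>\<psi> x\<bar>)
      \<le> t * ((LINT x:\<Omega>|lebesgue. \<bar>g x\<bar> * \<bar>\<psi> x\<bar>) + C * t)"
proof -
  let ?e = "axis i (1::real)" and ?K = "supp \<psi>"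
  have cc: "cc_function \<Omega> \<psi>" by (rule test_function_imp_cc_function[OF \<psi>])
  note K = cc_functionD(2,3)[OF cc]
  have ul: "locally_integrable \<Omega> u" by (rule continuous_imp_locally_integrable[OF u])
  have ga: "locally_integrable \<Omega> (\<lambda>x. \<bar>g x\<bar>)" by (rule locally_integrable_abs[OF g])
  obtain \<delta> K' where K': "thick_supp \<Omega> \<psi> \<delta> K'" using thick_supp_exists[OF \<Omega> cc] by blast
  note \<delta> = thick_suppD(1)[OF K']
  obtain L where L: "\<And>x. \<bar>partial_deriv i \<psi> x\<bar> \<le> L" "L \<ge> 0"
    using cc_function_bounded[OF test_function_imp_cc_function[OF test_function_partial_deriv[OF \<psi>]]] by blast
  have Lip: "\<bar>\<psi> (x - s *\<^sub>R ?e) - \<psi> x\<bar> \<le> L * \<bar>s\<bar>" for x s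
    using field_differentiable_bound[OF convex_UNIV has_real_derivative_shift[OF \<psi>], where x = s and y = 0 and B = L] L(1)
    by simp
  have ns: "norm (\<tau> *\<^sub>R ?e) \<le> \<delta>" if "\<bar>\<tau>\<bar> \<le> \<delta>" for \<tau> using that by simp
  define A' where "A' = (LINT x:K'|lebesgue. \<bar>g x\<bar>)"
  have A': "A' \<ge> 0" unfolding A'_def set_lebesgue_integral_def by (rule Bochner_Integration.integral_nonneg) simp
  show ?thesis
  proof (intro exI eventually_at_rightI)
    fix t assume t': "t \<in> {0<..<\<delta>}"
    then have t: "0 < t" "t < \<delta>" by auto
    \<comment> \<open>Bounds the integral of \<open>\<bar>g x\<bar>\<close> against every translate
      of \<open>\<bar>\<psi>\<bar>\<close> by \<open>s\<close> in the interval from 0 to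
      \<open>t\<close>. The term \<open>L * A' * t\<close> is the cost of the translation, as
      \<open>\<psi>\<close> has Lipschitz constant \<open>L\<close> along the axis.\<close>
    define B where "B = (LINT x:\<Omega>|lebesgue. \<bar>g x\<bar> * \<bar>\<psi> x\<bar>) + L * A' * t"
    have B: "B \<ge> 0"
      unfolding B_def set_lebesgue_integral_def using L A' t
      by (intro add_nonneg_nonneg Bochner_Integration.integral_nonneg mult_nonneg_nonneg) auto
    define a where "a x = u (x + t *\<^sub>R ?e) - u x" for x
    have a: "continuous_on ?K a"
      unfolding a_def by (rule thick_supp_continuous_difference[OF K' u ns]) (use t in simp)
    have gs: "(LINT x:\<Omega>|lebesgue. \<bar>g x\<bar> * \<bar>\<psi> (x - s *\<^sub>R ?e)\<bar>) \<le> B"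
      and gi: "set_integrable lebesgue \<Omega> (\<lambda>x. \<bar>g x\<bar> * \<bar>\<psi> (x - s *\<^sub>R ?e)\<bar>)" if s: "0 < s" "s < t" for s
    proof -
      let ?w = "\<lambda>x. \<psi> (x - s *\<^sub>R ?e) - \<psi> x"
      have s\<delta>: "\<bar>s\<bar> \<le> \<delta>" using s t by simp
      have cs: "cc_function \<Omega> (\<lambda>x. \<psi> (x - s *\<^sub>R ?e))"
        by (rule test_function_imp_cc_function[OF test_function_shift[OF \<psi> K' ns[OF s\<delta>]]])
      have wc: "continuous_on UNIV ?w"
        by (intro continuous_on_diff cc_functionD(1)[OF cs] cc_functionD(1)[OF cc])
      have wz: "?w x = 0" if "x \<notin> K'" for x
        using thick_supp_zero[OF K' ns[OF s\<delta>] that] thick_supp_zero[OF K' _ that, of 0] \<delta> by simp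
      have wb: "\<bar>?w x\<bar> \<le> L * t" for x
        using Lip[of x s] mult_left_mono[of s t L] s L(2) by simp
      have cw: "cc_function \<Omega> ?w" by (rule cc_functionI[OF wc thick_suppD(2,3)[OF K'] wz])
      show i1: "set_integrable lebesgue \<Omega> (\<lambda>x. \<bar>g x\<bar> * \<bar>\<psi> (x - s *\<^sub>R ?e)\<bar>)"
        by (rule locally_integrable_mult[OF ga cc_function_abs[OF cs]])
      have i2: "set_integrable lebesgue \<Omega> (\<lambda>x. \<bar>g x\<bar> * \<bar>\<psi> x\<bar>)"
        by (rule locally_integrable_mult[OF ga cc_function_abs[OF cc]])
      have i3: "set_integrable lebesgue \<Omega> (\<lambda>x. \<bar>g x\<bar> * \<bar>?w x\<bar>)"
        by (rule locally_integrable_mult[OF ga cc_function_abs[OF cw]])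
      have "(LINT x:\<Omega>|lebesgue. \<bar>g x\<bar> * \<bar>\<psi> (x - s *\<^sub>R ?e)\<bar>)
          \<le> (LINT x:\<Omega>|lebesgue. \<bar>g x\<bar> * \<bar>\<psi> x\<bar> + \<bar>g x\<bar> * \<bar>?w x\<bar>)"
      proof (rule set_integral_mono[OF i1 set_integral_add(1)[OF i2 i3]])
        fix x
        have "\<bar>\<psi> (x - s *\<^sub>R ?e)\<bar> \<le> \<bar>\<psi> x\<bar> + \<bar>?w x\<bar>" by linarith
        then show "\<bar>g x\<bar> * \<bar>\<psi> (x - s *\<^sub>R ?e)\<bar> \<le> \<bar>g x\<bar> * \<bar>\<psi> x\<bar> + \<bar>g x\<bar> * \<bar>?w x\<bar>"
          unfolding distrib_left[symmetric] by (rule mult_left_mono) simp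
      qed
      also have "\<dots> = (LINT x:\<Omega>|lebesgue. \<bar>g x\<bar> * \<bar>\<psi> x\<bar>) + (LINT x:\<Omega>|lebesgue. \<bar>g x\<bar> * \<bar>?w x\<bar>)"
        by (rule set_integral_add(2)[OF i2 i3])
      also have "(LINT x:\<Omega>|lebesgue. \<bar>g x\<bar> * \<bar>?w x\<bar>) \<le> L * t * A'"
        unfolding A'_def by (rule LINT_mult_bound(1)[OF g wc thick_suppD(2,3)[OF K'] wz wb])
      finally show "(LINT x:\<Omega>|lebesgue. \<bar>g x\<bar> * \<bar>\<psi> (x - s *\<^sub>R ?e)\<bar>) \<le> B"
        by (simp add: B_def mult_ac)
    qed
    define X where "X = (LINT x:\<Omega>|lebesgue. \<bar>a x\<bar> * \<bar>\<psi> x\<bar>)"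
    define Z where "Z = (LINT x:?K|lebesgue. (1::real))"
    have XZ: "X \<ge> 0" "Z \<ge> 0" unfolding X_def Z_def set_lebesgue_integral_def
      by (intro Bochner_Integration.integral_nonneg; simp)+
    have iX: "set_integrable lebesgue \<Omega> (\<lambda>x. \<bar>a x\<bar> * \<bar>\<psi> x\<bar>)"
    proof -
      have "supp (\<lambda>x. \<bar>\<psi> x\<bar>) = ?K" by (simp add: supp_def)
      then show ?thesis
        using continuous_mult_cc_integrable[OF cc_function_abs[OF cc]] continuous_on_rabs[OF a] by simp
    qed
    have iZ: "set_integrable lebesgue ?K (\<lambda>x. 1::real)"
      using K lmeasurable_compact by (intro absolutely_integrable_on_const) auto
    \<comment> \<open>\<open>X\<close>, \<open>Z\<close> and \<open>B\<close> are fixed numbers, so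
      the error vanishes as \<open>\<epsilon>\<close> tends to 0, even though it contains
      \<open>X\<close> itself. \<open>Z\<close> is the measure of the support and collects the
      errors that are constant in \<open>x\<close>.\<close>
    have key: "X \<le> t * B + \<epsilon> * (t * B + Z + X)" if \<epsilon>: "\<epsilon> > 0" for \<epsilon>
    proof -
      \<comment> \<open>A continuous stand-in for the sign of \<open>y = a x * \<psi> x\<close>: the
        \<open>\<epsilon>\<close> in the denominator removes the jump, and \<open>y * v x\<close>
        still is at least \<open>\<bar>y\<bar> - \<epsilon>\<close>.\<close>
      define v where "v x = a x * \<psi> x / (\<epsilon> + \<bar>a x * \<psi> x\<bar>)" for x
      have nz: "\<epsilon> + \<bar>a x * \<psi> x\<bar> > 0" for x using \<epsilon> by (simp add: add_pos_nonneg)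
      have "continuous_on ?K v"
        unfolding v_def
        by (intro continuous_on_divide continuous_on_add continuous_on_rabs continuous_on_mult
            continuous_on_const a cc_functionD(1)[OF cc]) (use nz in \<open>force simp: less_le\<close>)
      then obtain P where P: "real_polynomial_function P" "\<And>x. x \<in> ?K \<Longrightarrow> \<bar>v x - P x\<bar> < \<epsilon>"
        using Stone_Weierstrass_real_polynomial_function[OF K(1) _ \<epsilon>] by blast
      have v1: "\<bar>v x\<bar> \<le> 1" for x using nz[of x] \<epsilon> by (simp add: v_def abs_divide)
      define \<eta> where "\<eta> x = P x * \<psi> x" for x
      have \<eta>: "test_function \<Omega> \<eta>"
        unfolding \<eta>_def by (rule test_function_mult[OF \<psi> C_k_polynomial[OF P(1)]])
      have \<eta>b: "\<bar>\<eta> x\<bar> \<le> (1 + \<epsilon>) * \<bar>\<psi> x\<bar>" for x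
      proof (cases "x \<in> ?K")
        case True
        then have "\<bar>P x\<bar> \<le> 1 + \<epsilon>" using P(2)[OF True] v1[of x] by linarith
        then show ?thesis by (simp add: \<eta>_def abs_mult mult_right_mono)
      qed (simp add: \<eta>_def not_in_supp[of x \<psi>])
      have s\<eta>: "supp \<eta> \<subseteq> ?K"
        by (rule supp_subset[OF closed_supp]) (simp add: \<eta>_def not_in_supp[of _ \<psi>])
      note \<eta>K' = thick_supp_mono[OF K' s\<eta>]
      let ?I = "\<lambda>s. LINT x:\<Omega>|lebesgue. u x * \<eta> (x - s *\<^sub>R ?e)"
      \<comment> \<open>The intermediate point depends on \<open>\<eta>\<close>, hence on
        \<open>\<epsilon>\<close>; this is why the bound by \<open>B\<close> was proved for all
        \<open>s\<close> below \<open>t\<close>.\<close>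
      obtain s where s: "0 < s" "s < t"
        and I: "?I t - ?I 0 = (t - 0) * - (LINT x:\<Omega>|lebesgue. u x * partial_deriv i \<eta> (x - s *\<^sub>R ?e))"
        using MVT2[of 0 t ?I, OF t(1) LINT_shift_has_derivative[OF ul \<eta> \<eta>K']] t by auto
      have s\<delta>: "\<bar>s\<bar> \<le> \<delta>" "\<bar>t\<bar> \<le> \<delta>" using s t by auto
      note \<eta>s = test_function_shift[OF \<eta> \<eta>K' ns[OF s\<delta>(1)]]
      have "(LINT x:\<Omega>|lebesgue. u x * partial_deriv i \<eta> (x - s *\<^sub>R ?e))
          = - (LINT x:\<Omega>|lebesgue. g x * \<eta> (x - s *\<^sub>R ?e))"
        using weak[OF \<eta>s] by (simp add: partial_deriv_shift[OF \<eta>])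
      then have I': "?I t - ?I 0 = t * (LINT x:\<Omega>|lebesgue. g x * \<eta> (x - s *\<^sub>R ?e))"
        using I by simp
      have ig: "set_integrable lebesgue \<Omega> (\<lambda>x. g x * \<eta> (x - s *\<^sub>R ?e))"
        by (rule locally_integrable_mult[OF g test_function_imp_cc_function[OF \<eta>s]])
      have "\<bar>LINT x:\<Omega>|lebesgue. g x * \<eta> (x - s *\<^sub>R ?e)\<bar> \<le> (LINT x:\<Omega>|lebesgue. \<bar>g x * \<eta> (x - s *\<^sub>R ?e)\<bar>)"
        using set_integral_norm_bound[OF ig] by simp
      also have "\<dots> \<le> (LINT x:\<Omega>|lebesgue. (1 + \<epsilon>) * (\<bar>g x\<bar> * \<bar>\<psi> (x - s *\<^sub>R ?e)\<bar>))"
      proof (rule set_integral_mono)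
        show "\<bar>g x * \<eta> (x - s *\<^sub>R ?e)\<bar> \<le> (1 + \<epsilon>) * (\<bar>g x\<bar> * \<bar>\<psi> (x - s *\<^sub>R ?e)\<bar>)" for x
          using mult_left_mono[OF \<eta>b[of "x - s *\<^sub>R ?e"], of "\<bar>g x\<bar>"] by (simp add: abs_mult mult_ac)
      qed (use set_integrable_abs[OF ig] gi[OF s] in auto)
      also have "\<dots> \<le> (1 + \<epsilon>) * B"
        using gs[OF s] \<epsilon> by simp
      finally have 1: "?I t - ?I 0 \<le> t * ((1 + \<epsilon>) * B)"
        unfolding I' using t(1) by (intro mult_left_mono) auto
      have "?I t = (LINT x:\<Omega>|lebesgue. u (x + t *\<^sub>R ?e) * \<eta> x)"
        by (rule LINT_shift[OF \<Omega> u \<eta> \<eta>K' ns[OF s\<delta>(2)]])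
      have \<eta>cc: "cc_function \<Omega> \<eta>" by (rule test_function_imp_cc_function[OF \<eta>])
      have ia: "set_integrable lebesgue \<Omega> (\<lambda>x. a x * \<eta> x)"
        by (rule continuous_mult_cc_integrable[OF \<eta>cc continuous_on_subset[OF a s\<eta>]])
      have iu: "set_integrable lebesgue \<Omega> (\<lambda>x. u x * \<eta> x)"
        by (rule locally_integrable_mult[OF ul \<eta>cc])
      have "?I t - ?I 0 = (LINT x:\<Omega>|lebesgue. a x * \<eta> x)"
      proof -
        have "(LINT x:\<Omega>|lebesgue. u (x + t *\<^sub>R ?e) * \<eta> x) = (LINT x:\<Omega>|lebesgue. a x * \<eta> x + u x * \<eta> x)"
          by (simp add: a_def left_diff_distrib)
        also have "\<dots> = (LINT x:\<Omega>|lebesgue. a x * \<eta> x) + (LINT x:\<Omega>|lebesgue. u x * \<eta> x)"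
          by (rule set_integral_add(2)[OF ia iu])
        finally show ?thesis using \<open>?I t = _\<close> by simp
      qed
      also have "\<dots> = (LINT x:?K|lebesgue. a x * \<eta> x)"
        by (rule LINT_restrict(1)[OF K(2)]) (simp add: \<eta>_def not_in_supp[of _ \<psi>])
      finally have 2: "?I t - ?I 0 = (LINT x:?K|lebesgue. a x * \<eta> x)" .
      have z: "\<bar>a x\<bar> * \<bar>\<psi> x\<bar> = 0" if "x \<notin> ?K" for x using that not_in_supp[of x \<psi>] by simp
      have iXK: "set_integrable lebesgue ?K (\<lambda>x. \<bar>a x\<bar> * \<bar>\<psi> x\<bar>)"
        using iX LINT_restrict(2)[OF K(2) z] by simp
      have iaK: "set_integrable lebesgue ?K (\<lambda>x. a x * \<eta> x)"
        by (rule set_integrable_subset[OF ia]) (use K lmeasurable_compact fmeasurableD in auto)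
      have XK: "X = (LINT x:?K|lebesgue. \<bar>a x\<bar> * \<bar>\<psi> x\<bar>)"
        unfolding X_def by (rule LINT_restrict(1)[OF K(2) z])
      have iXK': "set_integrable lebesgue ?K (\<lambda>x. (1 - \<epsilon>) * (\<bar>a x\<bar> * \<bar>\<psi> x\<bar>))"
        by (rule set_integrable_mult_right) (rule iXK)
      have iZ': "set_integrable lebesgue ?K (\<lambda>x. \<epsilon> * 1)"
        by (rule set_integrable_mult_right) (rule iZ)
      have "(1 - \<epsilon>) * X - \<epsilon> * Z = (LINT x:?K|lebesgue. (1 - \<epsilon>) * (\<bar>a x\<bar> * \<bar>\<psi> x\<bar>) - \<epsilon> * 1)"
        unfolding XK Z_def set_integral_diff(2)[OF iXK' iZ'] set_integral_mult_right ..
      also have "\<dots> \<le> (LINT x:?K|lebesgue. a x * \<eta> x)"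
      proof (rule set_integral_mono)
        show "set_integrable lebesgue ?K (\<lambda>x. (1 - \<epsilon>) * (\<bar>a x\<bar> * \<bar>\<psi> x\<bar>) - \<epsilon> * 1)"
          by (rule set_integral_diff(1)[OF iXK' iZ'])
        \<comment> \<open>The two losses are \<open>\<epsilon>\<close> for replacing the sign by
          \<open>v\<close> and \<open>\<epsilon> * \<bar>y\<bar>\<close> for replacing
          \<open>v\<close> by the polynomial.\<close>
        show "(1 - \<epsilon>) * (\<bar>a x\<bar> * \<bar>\<psi> x\<bar>) - \<epsilon> * 1 \<le> a x * \<eta> x" if x: "x \<in> ?K" for x
        proof -
          define y where "y = a x * \<psi> x"
          have v: "v x = y / (\<epsilon> + \<bar>y\<bar>)" by (simp add: v_def y_def)
          have n: "\<epsilon> + \<bar>y\<bar> > 0" using \<epsilon> by (simp add: add_pos_nonneg)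
          have "y * v x = \<bar>y\<bar> * \<bar>y\<bar> / (\<epsilon> + \<bar>y\<bar>)" by (simp add: v)
          moreover have "\<bar>y\<bar> - \<epsilon> \<le> \<bar>y\<bar> * \<bar>y\<bar> / (\<epsilon> + \<bar>y\<bar>)"
          proof (rule mult_imp_le_div_pos[OF n])
            have "(b - \<epsilon>) * (\<epsilon> + b) \<le> b * b" for b using \<epsilon> by (simp add: algebra_simps)
            then show "(\<bar>y\<bar> - \<epsilon>) * (\<epsilon> + \<bar>y\<bar>) \<le> \<bar>y\<bar> * \<bar>y\<bar>" .
          qed
          moreover have "\<bar>y * (P x - v x)\<bar> \<le> \<bar>y\<bar> * \<epsilon>"
            using P(2)[OF x] by (simp add: abs_mult abs_minus_commute mult_left_mono)
          moreover have "a x * \<eta> x = y * v x + y * (P x - v x)"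
            by (simp add: \<eta>_def y_def algebra_simps)
          ultimately have "\<bar>y\<bar> - \<epsilon> - \<epsilon> * \<bar>y\<bar> \<le> a x * \<eta> x" by (simp add: mult.commute) 
          then show ?thesis by (simp add: y_def abs_mult algebra_simps)
        qed
      qed (rule iaK)
      also have "\<dots> \<le> t * ((1 + \<epsilon>) * B)" using 1 2 by simp
      finally show ?thesis by (simp add: algebra_simps)
    qed
    have "X \<le> t * B"
    proof (rule field_le_epsilon)
      fix e :: real assume e: "e > 0"
      define M where "M = t * B + Z + X"
      have M: "M \<ge> 0" using XZ B t by (simp add: M_def)
      have "X \<le> t * B + e / (M + 1) * M" unfolding M_def[symmetric]
        using key[of "e / (M + 1)"] e M by (simp add: M_def)
      also have "e / (M + 1) * M \<le> e" using e M by (simp add: field_simps)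
      finally show "X \<le> t * B + e" by simp
    qed
    then show "(LINT x:\<Omega>|lebesgue. \<bar>u (x + t *\<^sub>R ?e) - u x\<bar> * \<bar>\<psi> x\<bar>)
      \<le> t * ((LINT x:\<Omega>|lebesgue. \<bar>g x\<bar> * \<bar>\<psi> x\<bar>) + (L * A') * t)"
      by (simp add: X_def a_def B_def)
  qed (rule \<delta>)
qed


text \<open>The left side is the modulus of the derivative at 0 of the integral of \<open>f\<close>
  against the translated \<open>\<psi>\<close>. Moving the translation to \<open>f\<close> exposes
  its increments, which \<open>near\<close> replaces by those of the \<open>u j\<close>; the
  difference bound for each \<open>u j\<close>, divided by \<open>t\<close>, has the right side as
  its limit.\<close>

lemma LINT_partial_deriv_bound:
  fixes f :: "real ^ 'n::finite \<Rightarrow> real"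
  assumes \<Omega>: "open \<Omega>" and f: "continuous_on \<Omega> f" and J: "finite J"
    and u: "\<And>j. j \<in> J \<Longrightarrow> continuous_on \<Omega> (u j)" and g: "\<And>j. j \<in> J \<Longrightarrow> locally_integrable \<Omega> (g j)"
    and weak: "\<And>j \<eta>. j \<in> J \<Longrightarrow> test_function \<Omega> \<eta> \<Longrightarrow>
      (LINT x:\<Omega>|lebesgue. u j x * partial_deriv i \<eta> x) = - (LINT x:\<Omega>|lebesgue. g j x * \<eta> x)"
    and near: "\<And>K. compact K \<Longrightarrow> K \<subseteq> \<Omega> \<Longrightarrow>
      \<exists>d>0. \<forall>x\<in>K. \<forall>y. dist x y < d \<longrightarrow> \<bar>f y - f x\<bar> \<le> (\<Sum>j\<in>J. \<bar>u j y - u j x\<bar>)"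
    and \<psi>: "test_function \<Omega> \<psi>"
  shows "\<bar>LINT x:\<Omega>|lebesgue. f x * partial_deriv i \<psi> x\<bar> \<le> (LINT x:\<Omega>|lebesgue. (\<Sum>j\<in>J. \<bar>g j x\<bar>) * \<bar>\<psi> x\<bar>)"
proof -
  let ?e = "axis i (1::real)"
  have cc: "cc_function \<Omega> \<psi>" by (rule test_function_imp_cc_function[OF \<psi>])
  have fl: "locally_integrable \<Omega> f" by (rule continuous_imp_locally_integrable[OF f])
  obtain \<delta> K' where K': "thick_supp \<Omega> \<psi> \<delta> K'" using thick_supp_exists[OF \<Omega> cc] by blast
  note \<delta> = thick_suppD(1)[OF K']
  obtain d where d: "d > 0"
      "\<And>x y. x \<in> supp \<psi> \<Longrightarrow> dist x y < d \<Longrightarrow> \<bar>f y - f x\<bar> \<le> (\<Sum>j\<in>J. \<bar>u j y - u j x\<bar>)"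
    using near[OF cc_functionD(2,3)[OF cc]] by blast
  define I where "I t = (LINT x:\<Omega>|lebesgue. f x * \<psi> (x - t *\<^sub>R ?e))" for t
  define D where "D = - (LINT x:\<Omega>|lebesgue. f x * partial_deriv i \<psi> x)"
  define B where "B j = (LINT x:\<Omega>|lebesgue. \<bar>g j x\<bar> * \<bar>\<psi> x\<bar>)" for j
  have s\<psi>: "supp (\<lambda>x. \<bar>\<psi> x\<bar>) = supp \<psi>" by (simp add: supp_def)
  \<comment> \<open>Folding the eventual estimate into a predicate makes the choice of one constant
    per \<open>j\<close> a first-order step.\<close>
  define Q where "Q j C \<longleftrightarrow> (\<forall>\<^sub>F t in at_right 0.
      (LINT x:\<Omega>|lebesgue. \<bar>u j (x + t *\<^sub>R ?e) - u j x\<bar> * \<bar>\<psi> x\<bar>) \<le> t * (B j + C * t))" for j C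
  have "\<forall>j\<in>J. \<exists>C. Q j C"
    unfolding B_def Q_def using LINT_difference_bound[OF \<Omega> u g weak \<psi>] by simp
  then obtain C where "\<forall>j\<in>J. Q j (C j)" by metis
  then have C: "\<forall>j\<in>J. \<forall>\<^sub>F t in at_right 0.
      (LINT x:\<Omega>|lebesgue. \<bar>u j (x + t *\<^sub>R ?e) - u j x\<bar> * \<bar>\<psi> x\<bar>) \<le> t * (B j + C j * t)"
    by (simp only: Q_def)
  have "(I has_real_derivative D) (at 0)"
    using LINT_shift_has_derivative[OF fl \<psi> K', of 0 i] \<delta> by (simp add: I_def[abs_def] D_def)
  then have "((\<lambda>t. (I t - I 0) / t) \<longlongrightarrow> D) (at 0)"
    by (simp add: DERIV_def)
  \<comment> \<open>Only the right-hand limit is used, as the increments are estimated for positive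
    \<open>t\<close>.\<close>
  then have "((\<lambda>t. (I t - I 0) / t) \<longlongrightarrow> D) (at_right 0)"
    by (rule tendsto_mono[rotated]) (simp add: at_le)
  then have lim1: "((\<lambda>t. \<bar>(I t - I 0) / t\<bar>) \<longlongrightarrow> \<bar>D\<bar>) (at_right 0)"
    by (rule tendsto_rabs)
  have lim2: "((\<lambda>t. \<Sum>j\<in>J. B j + C j * t) \<longlongrightarrow> (\<Sum>j\<in>J. B j + C j * 0)) (at_right 0)"
    by (intro tendsto_intros)
  have "\<forall>\<^sub>F t in at_right 0. t \<in> {0<..<min \<delta> d}"
    by (rule eventually_at_rightI[of 0 "min \<delta> d"]) (use \<delta> d in auto)
  moreover have "\<forall>\<^sub>F t in at_right 0. \<forall>j\<in>J.
      (LINT x:\<Omega>|lebesgue. \<bar>u j (x + t *\<^sub>R ?e) - u j x\<bar> * \<bar>\<psi> x\<bar>) \<le> t * (B j + C j * t)"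
    using C J by (simp add: eventually_ball_finite)
  ultimately have "\<forall>\<^sub>F t in at_right 0. \<bar>(I t - I 0) / t\<bar> \<le> (\<Sum>j\<in>J. B j + C j * t)"
  proof eventually_elim
    case (elim t)
    then have t: "t > 0" "t < \<delta>" "t < d" by auto
    have nt: "norm (t *\<^sub>R ?e) \<le> \<delta>" using t by simp
    let ?a = "\<lambda>x. f (x + t *\<^sub>R ?e) - f x"
    have ia: "set_integrable lebesgue \<Omega> (\<lambda>x. ?a x * \<psi> x)"
      by (rule continuous_mult_cc_integrable[OF cc thick_supp_continuous_difference[OF K' f nt]])
    have i0: "set_integrable lebesgue \<Omega> (\<lambda>x. f x * \<psi> x)" by (rule locally_integrable_mult[OF fl cc])
    have iu: "set_integrable lebesgue \<Omega> (\<lambda>x. \<bar>u j (x + t *\<^sub>R ?e) - u j x\<bar> * \<bar>\<psi> x\<bar>)" if "j \<in> J" for j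
      using continuous_mult_cc_integrable[OF cc_function_abs[OF cc]]
        continuous_on_rabs[OF thick_supp_continuous_difference[OF K' u[OF that] nt]] by (simp add: s\<psi>)
    have "I t = (LINT x:\<Omega>|lebesgue. f (x + t *\<^sub>R ?e) * \<psi> x)"
      unfolding I_def by (rule LINT_shift[OF \<Omega> f \<psi> K' nt])
    also have "\<dots> = (LINT x:\<Omega>|lebesgue. ?a x * \<psi> x + f x * \<psi> x)"
      by (simp add: left_diff_distrib)
    also have "\<dots> = (LINT x:\<Omega>|lebesgue. ?a x * \<psi> x) + I 0"
      using set_integral_add(2)[OF ia i0] by (simp add: I_def)
    finally have "\<bar>I t - I 0\<bar> \<le> (LINT x:\<Omega>|lebesgue. \<bar>?a x * \<psi> x\<bar>)"
      using set_integral_norm_bound[OF ia] by simp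
    also have "\<dots> \<le> (LINT x:\<Omega>|lebesgue. \<Sum>j\<in>J. \<bar>u j (x + t *\<^sub>R ?e) - u j x\<bar> * \<bar>\<psi> x\<bar>)"
    proof (rule set_integral_mono)
      show "set_integrable lebesgue \<Omega> (\<lambda>x. \<bar>?a x * \<psi> x\<bar>)" by (rule set_integrable_abs[OF ia])
      show "set_integrable lebesgue \<Omega> (\<lambda>x. \<Sum>j\<in>J. \<bar>u j (x + t *\<^sub>R ?e) - u j x\<bar> * \<bar>\<psi> x\<bar>)"
        by (rule absolutely_integrable_sum[OF J iu])
      show "\<bar>?a x * \<psi> x\<bar> \<le> (\<Sum>j\<in>J. \<bar>u j (x + t *\<^sub>R ?e) - u j x\<bar> * \<bar>\<psi> x\<bar>)" for x
      proof (cases "x \<in> supp \<psi>")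
        case True
        then have "\<bar>?a x\<bar> \<le> (\<Sum>j\<in>J. \<bar>u j (x + t *\<^sub>R ?e) - u j x\<bar>)"
          using t by (intro d(2)) (auto simp: dist_norm)
        then show ?thesis
          unfolding sum_distrib_right[symmetric] abs_mult by (rule mult_right_mono) simp
      qed (simp add: not_in_supp[of x \<psi>])
    qed
    also have "\<dots> = (\<Sum>j\<in>J. LINT x:\<Omega>|lebesgue. \<bar>u j (x + t *\<^sub>R ?e) - u j x\<bar> * \<bar>\<psi> x\<bar>)"
      using iu unfolding set_lebesgue_integral_def set_integrable_def
      by (simp add: sum_distrib_left Bochner_Integration.integral_sum)
    also have "\<dots> \<le> (\<Sum>j\<in>J. t * (B j + C j * t))"
      using elim by (intro sum_mono) auto
    finally show ?case using t(1) by (simp add: abs_divide divide_le_eq sum_distrib_left mult.commute)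
  qed
  then have "\<bar>D\<bar> \<le> (\<Sum>j\<in>J. B j + C j * 0)"
    by (intro tendsto_le[OF _ lim2 lim1]) (auto simp: trivial_limit_at_right_real)
  also have "\<dots> = (LINT x:\<Omega>|lebesgue. (\<Sum>j\<in>J. \<bar>g j x\<bar>) * \<bar>\<psi> x\<bar>)"
    using locally_integrable_mult[OF locally_integrable_abs[OF g] cc_function_abs[OF cc]]
    unfolding set_lebesgue_integral_def set_integrable_def B_def
    by (simp add: sum_distrib_left sum_distrib_right Bochner_Integration.integral_sum)
  finally show ?thesis by (simp add: D_def)
qed

subsection \<open>Riesz representation in \<open>L\<^sub>2\<close>\<close>

text \<open>For \<open>c > 0\<close> the minimiser \<open>t = - b / c\<close> gives the claim; for
  \<open>c = 0\<close> an affine function bounded below must be constant.\<close>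

lemma discriminant_nonneg_quadratic:
  fixes a b c :: real
  assumes nonneg: "\<And>t. 0 \<le> a + 2 * t * b + t\<^sup>2 * c" and c: "c \<ge> 0"
  shows "b\<^sup>2 \<le> a * c"
proof (cases "c = 0")
  case True
  have "b = 0"
  proof (rule ccontr)
    assume "b \<noteq> 0"
    \<comment> \<open>At this \<open>t\<close> the affine function takes the value -1.\<close>
    then show False using nonneg[of "- (a + 1) / (2 * b)"] True by (simp add: field_simps)
  qed
  then show ?thesis using True by simp
next
  case False
  then show ?thesis using nonneg[of "- b / c"] c by (simp add: field_simps power2_eq_square)
qed

lemma integrable_mult_L2:
  fixes f g :: "'a \<Rightarrow> real"
  assumes [measurable]: "f \<in> borel_measurable M" "g \<in> borel_measurable M"
    and f: "integrable M (\<lambda>x. (f x)\<^sup>2)" and g: "integrable M (\<lambda>x. (g x)\<^sup>2)"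
  shows "integrable M (\<lambda>x. f x * g x)"
proof (rule Bochner_Integration.integrable_bound[OF Bochner_Integration.integrable_add[OF f g]])
  have "\<bar>a * b\<bar> \<le> a\<^sup>2 + b\<^sup>2" for a b :: real
  proof -
    have "0 \<le> (\<bar>a\<bar> - \<bar>b\<bar>)\<^sup>2" by simp
    then have "2 * \<bar>a * b\<bar> \<le> a\<^sup>2 + b\<^sup>2" by (simp add: power2_diff abs_mult)
    moreover have "0 \<le> a\<^sup>2 + b\<^sup>2" by simp
    ultimately show ?thesis by linarith
  qed
  then show "AE x in M. norm (f x * g x) \<le> norm ((f x)\<^sup>2 + (g x)\<^sup>2)" by simp
qed measurable

lemma integrable_add_L2:
  fixes f g :: "'a \<Rightarrow> real"
  assumes "f \<in> borel_measurable M" "g \<in> borel_measurable M"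
    and f: "integrable M (\<lambda>x. (f x)\<^sup>2)" and g: "integrable M (\<lambda>x. (g x)\<^sup>2)"
  shows "integrable M (\<lambda>x. (f x + t * g x)\<^sup>2)"
    and "(\<integral>x. (f x + t * g x)\<^sup>2 \<partial>M) = (\<integral>x. (f x)\<^sup>2 \<partial>M) + 2 * t * (\<integral>x. f x * g x \<partial>M) + t\<^sup>2 * (\<integral>x. (g x)\<^sup>2 \<partial>M)"
proof -
  have e: "(f x + t * g x)\<^sup>2 = (f x)\<^sup>2 + (2 * t) * (f x * g x) + t\<^sup>2 * (g x)\<^sup>2" for x
    by (simp add: power2_sum power_mult_distrib)
  note i = f g integrable_mult_L2[OF assms]
  show "integrable M (\<lambda>x. (f x + t * g x)\<^sup>2)"
    unfolding e by (intro Bochner_Integration.integrable_add integrable_mult_right i)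
  show "(\<integral>x. (f x + t * g x)\<^sup>2 \<partial>M) = (\<integral>x. (f x)\<^sup>2 \<partial>M) + 2 * t * (\<integral>x. f x * g x \<partial>M) + t\<^sup>2 * (\<integral>x. (g x)\<^sup>2 \<partial>M)"
    unfolding e using i by simp
qed

lemma Cauchy_Schwarz_L2:
  fixes f g :: "'a \<Rightarrow> real"
  assumes "f \<in> borel_measurable M" "g \<in> borel_measurable M"
    and "integrable M (\<lambda>x. (f x)\<^sup>2)" "integrable M (\<lambda>x. (g x)\<^sup>2)"
  shows "(\<integral>x. f x * g x \<partial>M)\<^sup>2 \<le> (\<integral>x. (f x)\<^sup>2 \<partial>M) * (\<integral>x. (g x)\<^sup>2 \<partial>M)"
proof (rule discriminant_nonneg_quadratic)
  show "0 \<le> (\<integral>x. (f x)\<^sup>2 \<partial>M) + 2 * t * (\<integral>x. f x * g x \<partial>M) + t\<^sup>2 * (\<integral>x. (g x)\<^sup>2 \<partial>M)" for t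
    unfolding integrable_add_L2(2)[OF assms, symmetric] by (rule Bochner_Integration.integral_nonneg) simp
qed (rule Bochner_Integration.integral_nonneg, simp)

text \<open>Completeness of the space, in the Riesz-Fischer manner. Increments decay like 16^-k in
  squared norm, so they stay summable after weighting by 4^k. Hence almost everywhere the weighted
  squares are bounded, and the increments themselves are dominated by the geometric series of
  2^-k.\<close>

lemma L2_fast_Cauchy_converges:
  fixes v :: "nat \<Rightarrow> 'a \<Rightarrow> real"
  assumes [measurable]: "\<And>k. v k \<in> borel_measurable M"
    and int: "\<And>j k. integrable M (\<lambda>x. (v j x - v k x)\<^sup>2)"
    and Cauchy: "\<And>j k. k \<le> j \<Longrightarrow> (\<integral>x. (v j x - v k x)\<^sup>2 \<partial>M) \<le> 4 * (1/16) ^ k"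
  obtains u where "u \<in> borel_measurable M" "\<And>k. integrable M (\<lambda>x. (u x - v k x)\<^sup>2)"
    "\<And>k. (\<integral>x. (u x - v k x)\<^sup>2 \<partial>M) \<le> 4 * (1/16) ^ k"
proof
  define d where "d k x = v (Suc k) x - v k x" for k x
  have [measurable]: "d k \<in> borel_measurable M" for k unfolding d_def by measurable
  have "(\<integral>\<^sup>+x. (\<Sum>k. ennreal (4 ^ k * (d k x)\<^sup>2)) \<partial>M) = (\<Sum>k. \<integral>\<^sup>+x. ennreal (4 ^ k * (d k x)\<^sup>2) \<partial>M)"
    by (rule nn_integral_suminf) measurable
  also have "\<dots> \<le> (\<Sum>k. ennreal (4 * (1/4) ^ k))"
  proof (rule suminf_le)
    fix k
    have i: "integrable M (\<lambda>x. 4 ^ k * (d k x)\<^sup>2)" unfolding d_def by (intro integrable_mult_right int)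
    have "(\<integral>\<^sup>+x. ennreal (4 ^ k * (d k x)\<^sup>2) \<partial>M) = ennreal (\<integral>x. 4 ^ k * (d k x)\<^sup>2 \<partial>M)"
      by (rule nn_integral_eq_integral[OF i]) simp
    also have "\<dots> \<le> ennreal (4 ^ k * (4 * (1/16) ^ k))"
      using Cauchy[of k "Suc k"] by (intro ennreal_leI) (simp add: d_def)
    also have "4 ^ k * (4 * (1/16) ^ k) = 4 * (1/4 :: real) ^ k"
      by (simp add: power_mult_distrib[symmetric])
    finally show "(\<integral>\<^sup>+x. ennreal (4 ^ k * (d k x)\<^sup>2) \<partial>M) \<le> ennreal (4 * (1/4) ^ k)" .
  qed auto
  also have "\<dots> < \<infinity>"
    by (subst suminf_ennreal2) (auto intro!: summable_mult summable_geometric)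
  finally have "AE x in M. (\<Sum>k. ennreal (4 ^ k * (d k x)\<^sup>2)) \<noteq> \<infinity>"
    by (intro nn_integral_PInf_AE) auto
  then have conv: "AE x in M. convergent (\<lambda>k. v k x)"
  proof eventually_elim
    case (elim x)
    then have "summable (\<lambda>k. 4 ^ k * (d k x)\<^sup>2)"
      by (intro summable_suminf_not_top) auto
    then have "Bseq (\<lambda>k. 4 ^ k * (d k x)\<^sup>2)"
      by (intro convergent_imp_Bseq) (auto simp: convergent_def dest: summable_LIMSEQ_zero)
    then obtain S where S: "S > 0" "\<And>k. norm (4 ^ k * (d k x)\<^sup>2) \<le> S" by (auto simp: Bseq_def)
    have d_le: "\<bar>d k x\<bar> \<le> sqrt S * (1/2) ^ k" for k
    proof -
      have "(2 ^ k * \<bar>d k x\<bar>)\<^sup>2 \<le> S"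
        using S(2)[of k] by (simp add: power_mult_distrib power_mult[symmetric] mult.commute[of k] power_mult)
      then have "2 ^ k * \<bar>d k x\<bar> \<le> sqrt S" by (rule real_le_rsqrt)
      then show ?thesis by (simp add: field_simps)
    qed
    have "summable (\<lambda>k. sqrt S * (1/2) ^ k)"
      by (intro summable_mult summable_geometric) simp
    then have "summable (\<lambda>k. d k x)"
      by (rule summable_comparison_test') (simp add: d_le)
    then have "(\<lambda>k. v 0 x + (\<Sum>j<k. d j x)) \<longlonglongrightarrow> v 0 x + (\<Sum>j. d j x)"
      by (intro tendsto_add tendsto_const summable_LIMSEQ)
    moreover have "v 0 x + (\<Sum>j<k. d j x) = v k x" for k
      unfolding d_def using sum_lessThan_telescope[of "\<lambda>j. v j x" k] by simp
    ultimately show ?case by (auto simp: convergent_def)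
  qed
  define u where "u x = lim (\<lambda>k. v k x)" for x
  show [measurable]: "u \<in> borel_measurable M" unfolding u_def by measurable
  fix k
  \<comment> \<open>Fatou's lemma in \<open>j\<close> passes the Cauchy estimate to the
    limit.\<close>
  have "(\<integral>\<^sup>+x. ennreal ((u x - v k x)\<^sup>2) \<partial>M) = (\<integral>\<^sup>+x. liminf (\<lambda>j. ennreal ((v j x - v k x)\<^sup>2)) \<partial>M)"
  proof (rule nn_integral_cong_AE)
    show "AE x in M. ennreal ((u x - v k x)\<^sup>2) = liminf (\<lambda>j. ennreal ((v j x - v k x)\<^sup>2))"
      using conv
    proof eventually_elim
      case (elim x)
      then have "(\<lambda>j. v j x) \<longlonglongrightarrow> u x" by (simp add: u_def convergent_LIMSEQ_iff)
      then have "(\<lambda>j. ennreal ((v j x - v k x)\<^sup>2)) \<longlonglongrightarrow> ennreal ((u x - v k x)\<^sup>2)"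
        by (intro tendsto_ennrealI tendsto_intros)
      then show ?case by (rule lim_imp_Liminf[OF sequentially_bot, symmetric])
    qed
  qed
  also have "\<dots> \<le> liminf (\<lambda>j. \<integral>\<^sup>+x. ennreal ((v j x - v k x)\<^sup>2) \<partial>M)"
    by (rule nn_integral_liminf) measurable
  also have "\<dots> \<le> ennreal (4 * (1/16) ^ k)"
  proof (rule Liminf_le)
    show "\<forall>\<^sub>F j in sequentially. (\<integral>\<^sup>+x. ennreal ((v j x - v k x)\<^sup>2) \<partial>M) \<le> ennreal (4 * (1/16) ^ k)"
      using eventually_ge_at_top[of k]
    proof eventually_elim
      case (elim j)
      have "(\<integral>\<^sup>+x. ennreal ((v j x - v k x)\<^sup>2) \<partial>M) = ennreal (\<integral>x. (v j x - v k x)\<^sup>2 \<partial>M)"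
        by (rule nn_integral_eq_integral[OF int]) simp
      also have "\<dots> \<le> ennreal (4 * (1/16) ^ k)" by (intro ennreal_leI Cauchy elim)
      finally show ?case .
    qed
  qed simp
  finally have le: "(\<integral>\<^sup>+x. ennreal ((u x - v k x)\<^sup>2) \<partial>M) \<le> ennreal (4 * (1/16) ^ k)" .
  show i: "integrable M (\<lambda>x. (u x - v k x)\<^sup>2)"
    by (rule integrableI_nonneg) (use le in \<open>auto intro: le_less_trans\<close>)
  have "ennreal (\<integral>x. (u x - v k x)\<^sup>2 \<partial>M) \<le> ennreal (4 * (1/16) ^ k)"
    using le by (subst (asm) nn_integral_eq_integral[OF i]) auto
  then show "(\<integral>x. (u x - v k x)\<^sup>2 \<partial>M) \<le> 4 * (1/16) ^ k"
    by (subst (asm) ennreal_le_iff) auto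
qed

text \<open>Direct method: \<open>u\<close> is the limit of a minimising sequence of the squared
  norm minus \<open>2 * L v\<close>. The space \<open>V\<close> need not be closed, so
  \<open>u\<close> may lie outside it and the variational equation is derived at the almost minimal
  \<open>v k\<close> before passing to the limit.\<close>

lemma L2_Riesz_representation:
  fixes L :: "('a \<Rightarrow> real) \<Rightarrow> real"
  assumes V: "V \<noteq> {}" and meas: "\<And>v. v \<in> V \<Longrightarrow> v \<in> borel_measurable M"
    and sq: "\<And>v. v \<in> V \<Longrightarrow> integrable M (\<lambda>x. (v x)\<^sup>2)"
    and closed: "\<And>v w c. v \<in> V \<Longrightarrow> w \<in> V \<Longrightarrow> (\<lambda>x. v x + c * w x) \<in> V"
    and lin: "\<And>v w c. v \<in> V \<Longrightarrow> w \<in> V \<Longrightarrow> L (\<lambda>x. v x + c * w x) = L v + c * L w"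
    and bound: "\<And>v. v \<in> V \<Longrightarrow> \<bar>L v\<bar> \<le> C * sqrt (\<integral>x. (v x)\<^sup>2 \<partial>M)"
  obtains u where "u \<in> borel_measurable M" "integrable M (\<lambda>x. (u x)\<^sup>2)"
    "\<And>v. v \<in> V \<Longrightarrow> L v = (\<integral>x. u x * v x \<partial>M)"
proof -
  define N where "N v = (\<integral>x. (v x)\<^sup>2 \<partial>M)" for v :: "'a \<Rightarrow> real"
  define J where "J v = N v - 2 * L v" for v
  have N0: "N v \<ge> 0" for v unfolding N_def by (rule Bochner_Integration.integral_nonneg) simp
  have N_lin: "N (\<lambda>x. v x + c * w x) = N v + 2 * c * (\<integral>x. v x * w x \<partial>M) + c\<^sup>2 * N w"
    if "v \<in> V" "w \<in> V" for v w c
    unfolding N_def by (rule integrable_add_L2(2)) (use that meas sq in auto)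
  have J_lin: "J (\<lambda>x. v x + c * w x) = J v + 2 * c * ((\<integral>x. v x * w x \<partial>M) - L w) + c\<^sup>2 * N w"
    if "v \<in> V" "w \<in> V" for v w c
    unfolding J_def N_lin[OF that] lin[OF that] by (simp add: algebra_simps)
  have J_below: "- C\<^sup>2 \<le> J v" if "v \<in> V" for v
  proof -
    have "0 \<le> (sqrt (N v) - C)\<^sup>2" by simp
    then have "2 * (C * sqrt (N v)) \<le> N v + C\<^sup>2" using N0[of v] by (simp add: power2_diff mult_ac)
    then show ?thesis using bound[OF that] unfolding J_def N_def[symmetric] by linarith
  qed
  then have bdd: "bdd_below (J ` V)" by (auto intro!: bdd_belowI2)
  define m where "m = (INF v\<in>V. J v)"
  have m: "m \<le> J v" if "v \<in> V" for v unfolding m_def by (rule cINF_lower[OF bdd that])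
  \<comment> \<open>The rate 16^-k is the one that the convergence lemma consumes.\<close>
  have "\<exists>v\<in>V. J v < m + (1/16) ^ k" for k :: nat
    using cINF_less_iff[OF V bdd, of "m + (1/16) ^ k"] by (simp add: m_def)
  then obtain v where vV: "\<And>k. v k \<in> V" and vJ: "\<And>k. J (v k) < m + (1/16) ^ k" by metis
  have dN: "N (\<lambda>x. v j x - v k x) \<le> 4 * (1/16) ^ k" if "k \<le> j" for j k
  proof -
    define b where "b = (\<integral>x. v j x * v k x \<partial>M)"
    \<comment> \<open>The midpoint of \<open>v j\<close> and \<open>v k\<close>, written so that two
      uses of \<open>closed\<close> place it in \<open>V\<close>. With the parallelogram law,
      \<open>m \<le> J h\<close> makes the sequence Cauchy.\<close>
    define h where "h x = v j x + (1/2) * (v k x + (-1) * v j x)" for x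
    have h: "h = (\<lambda>x. (v j x + v k x) / 2)" by (auto simp: h_def field_simps)
    have "m \<le> J h" unfolding h_def by (intro m closed vV)
    also have "J h = (N (v j) + 2 * b + N (v k)) / 4 - (L (v j) + L (v k))"
    proof -
      have "N h = N (\<lambda>x. v j x + 1 * v k x) / 4"
        unfolding N_def h by (simp add: power_divide)
      also have "\<dots> = (N (v j) + 2 * b + N (v k)) / 4"
        unfolding N_lin[OF vV vV] by (simp add: b_def)
      finally have "N h = (N (v j) + 2 * b + N (v k)) / 4" .
      moreover have "L h = L (v j) + (1/2) * (L (v k) + (-1) * L (v j))"
        unfolding h_def lin[OF vV closed[OF vV vV]] lin[OF vV vV] ..
      ultimately show ?thesis unfolding J_def by (simp add: field_simps)
    qed
    finally have "4 * m \<le> N (v j) + 2 * b + N (v k) - 4 * (L (v j) + L (v k))" by (simp add: field_simps)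
    moreover have "N (\<lambda>x. v j x - v k x) = N (v j) - 2 * b + N (v k)"
      using N_lin[OF vV vV, of j "-1" k] by (simp add: b_def)
    moreover have "N (v j) - 2 * L (v j) < m + (1/16) ^ j" "N (v k) - 2 * L (v k) < m + (1/16) ^ k"
      using vJ[of j] vJ[of k] by (simp_all add: J_def)
    moreover have "(1/16 :: real) ^ j \<le> (1/16) ^ k" using that by (intro power_decreasing) auto
    ultimately show ?thesis by argo
  qed
  have dint: "integrable M (\<lambda>x. (v j x - v k x)\<^sup>2)" for j k
    using integrable_add_L2(1)[OF meas[OF vV] meas[OF vV] sq[OF vV] sq[OF vV], of j "-1" k] by simp
  obtain u where u: "u \<in> borel_measurable M" "\<And>k. integrable M (\<lambda>x. (u x - v k x)\<^sup>2)"
    "\<And>k. (\<integral>x. (u x - v k x)\<^sup>2 \<partial>M) \<le> 4 * (1/16) ^ k"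
    using L2_fast_Cauchy_converges[of v M, OF meas[OF vV] dint dN[unfolded N_def]] by blast
  have ud: "(\<lambda>x. u x - v k x) \<in> borel_measurable M" for k
    using u(1) meas[OF vV] by (rule borel_measurable_diff)
  have usq: "integrable M (\<lambda>x. (u x)\<^sup>2)"
    using integrable_add_L2(1)[OF ud[of 0] meas[OF vV[of 0]] u(2) sq[OF vV[of 0]], of 1] by simp
  show thesis
  proof
    fix w assume w: "w \<in> V"
    have "\<bar>(\<integral>x. u x * w x \<partial>M) - L w\<bar> \<le> 3 * sqrt (N w) * (1/4) ^ k" for k
    proof -
      \<comment> \<open>\<open>b\<close> is the defect of the variational equation at
        \<open>v k\<close>, and \<open>a\<close> is the error of replacing \<open>u\<close> by
        \<open>v k\<close>.\<close>
      define b where "b = (\<integral>x. v k x * w x \<partial>M) - L w"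
      define a where "a = (\<integral>x. (u x - v k x) * w x \<partial>M)"
      have s: "sqrt ((1/16) ^ k) = (1/4 :: real) ^ k"
        by (rule real_sqrt_unique) (simp_all add: power2_eq_square power_mult_distrib[symmetric])
      have "b\<^sup>2 \<le> (1/16) ^ k * N w"
      \<comment> \<open>As \<open>v k\<close> is minimal up to 16^-k, the quadratic in
        \<open>t\<close> obtained by moving in direction \<open>w\<close> cannot drop below
        -16^-k.\<close>
      proof (rule discriminant_nonneg_quadratic)
        fix t
        have "m \<le> J (\<lambda>x. v k x + t * w x)" by (intro m closed vV w)
        then show "0 \<le> (1/16) ^ k + 2 * t * b + t\<^sup>2 * N w"
          using vJ[of k] unfolding J_lin[OF vV w] b_def by simp
      qed (rule N0)
      then have "\<bar>b\<bar> \<le> sqrt ((1/16) ^ k * N w)" by (metis real_sqrt_abs real_sqrt_le_mono)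
      moreover have "a\<^sup>2 \<le> 4 * (1/16) ^ k * N w"
      proof -
        have "a\<^sup>2 \<le> (\<integral>x. (u x - v k x)\<^sup>2 \<partial>M) * N w"
          unfolding a_def N_def by (rule Cauchy_Schwarz_L2[OF ud meas[OF w] u(2) sq[OF w]])
        also have "\<dots> \<le> 4 * (1/16) ^ k * N w" by (rule mult_right_mono[OF u(3) N0])
        finally show ?thesis .
      qed
      then have "\<bar>a\<bar> \<le> sqrt (4 * (1/16) ^ k * N w)" by (metis real_sqrt_abs real_sqrt_le_mono)
      moreover have "(\<integral>x. u x * w x \<partial>M) = a + (\<integral>x. v k x * w x \<partial>M)"
        unfolding a_def left_diff_distrib
        using integrable_mult_L2[OF u(1) meas[OF w] usq sq[OF w]] integrable_mult_L2[OF meas[OF vV] meas[OF w] sq[OF vV] sq[OF w], of k]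
        by simp
      moreover define r where "r = (1/4) ^ k * sqrt (N w)"
      ultimately have "\<bar>b\<bar> \<le> r" "\<bar>a\<bar> \<le> 2 * r" "(\<integral>x. u x * w x \<partial>M) - L w = a + b"
        by (simp_all add: real_sqrt_mult s b_def)
      then have "\<bar>(\<integral>x. u x * w x \<partial>M) - L w\<bar> \<le> 3 * r" by linarith
      then show ?thesis by (simp add: r_def mult_ac)
    qed
    moreover have "(\<lambda>k. 3 * sqrt (N w) * (1/4) ^ k) \<longlonglongrightarrow> 3 * sqrt (N w) * 0"
      by (intro tendsto_mult tendsto_const LIMSEQ_power_zero) simp
    ultimately have "\<bar>(\<integral>x. u x * w x \<partial>M) - L w\<bar> \<le> 3 * sqrt (N w) * 0"
      by (intro LIMSEQ_le_const) auto
    then show "L w = (\<integral>x. u x * w x \<partial>M)" by simp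
  qed (rule u(1), rule usq)
qed

subsection \<open>Representation of weakly bounded functionals\<close>

text \<open>The zero extension is the pointwise limit of restrictions to a compact exhaustion of
  \<Omega>.\<close>

lemma locally_integrable_measurable:
  fixes g :: "'a::euclidean_space \<Rightarrow> 'b::euclidean_space"
  assumes "open \<Omega>" "locally_integrable \<Omega> g"
  shows "(\<lambda>x. indicat_real \<Omega> x *\<^sub>R g x) \<in> borel_measurable lebesgue"
proof -
  obtain C where C: "\<And>n. compact (C n)" "\<And>n. C n \<subseteq> \<Omega>" "\<Union>(range C) = \<Omega>"
      "\<And>K. \<lbrakk>compact K; K \<subseteq> \<Omega>\<rbrakk> \<Longrightarrow> \<exists>N::nat. \<forall>n\<ge>N. K \<subseteq> C n"
    using open_Union_compact_subsets[OF assms(1)] by metis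
  show ?thesis
  proof (rule borel_measurable_LIMSEQ_metric)
    show "(\<lambda>x. indicat_real (C n) x *\<^sub>R g x) \<in> borel_measurable lebesgue" for n
      using assms(2) C(1,2) unfolding locally_integrable_def set_integrable_def
      by (auto dest: borel_measurable_integrable)
    show "(\<lambda>n. indicat_real (C n) x *\<^sub>R g x) \<longlonglongrightarrow> indicat_real \<Omega> x *\<^sub>R g x" for x
    proof (cases "x \<in> \<Omega>")
      case True
      then obtain N where "\<forall>n\<ge>N. {x} \<subseteq> C n" using C(4)[of "{x}"] by auto
      then show ?thesis
        using True by (intro tendsto_eventually eventually_sequentiallyI[of N]) auto
    next
      case False
      then have "x \<notin> C n" for n using C(2) by blast
      then show ?thesis using False by simp
    qed
  qed
qed

text \<open>\<open>w\<close> is a weighted sum of indicators of a compact exhaustion. The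
  coefficient 2^-k / (1 + I k) makes both the series for \<open>w\<close> and the integrals of its
  products with \<open>G\<close> summable. Each compact set lies in some \<open>C N\<close>, where
  \<open>w\<close> is at least \<open>a N > 0\<close>.\<close>

lemma integrable_positive_weight:
  fixes G :: "'a::euclidean_space \<Rightarrow> real"
  assumes \<Omega>: "open \<Omega>" and G: "locally_integrable \<Omega> G" and G0: "\<And>x. G x \<ge> 0"
  obtains w where "w \<in> borel_measurable lebesgue" "set_integrable lebesgue \<Omega> (\<lambda>x. G x * w x)"
    "\<And>x. x \<in> \<Omega> \<Longrightarrow> w x > 0"
    "\<And>K. compact K \<Longrightarrow> K \<subseteq> \<Omega> \<Longrightarrow> \<exists>c>0. \<forall>x\<in>K. c \<le> w x"
proof -
  obtain C where C: "\<And>n. compact (C n)" "\<And>n. C n \<subseteq> \<Omega>" "\<Union>(range C) = \<Omega>"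
      "\<And>K. \<lbrakk>compact K; K \<subseteq> \<Omega>\<rbrakk> \<Longrightarrow> \<exists>N::nat. \<forall>n\<ge>N. K \<subseteq> C n"
    using open_Union_compact_subsets[OF \<Omega>] by metis
  define I where "I k = (\<integral>x. indicat_real (C k) x * G x \<partial>lebesgue)" for k
  have I0: "I k \<ge> 0" for k unfolding I_def by (rule Bochner_Integration.integral_nonneg) (simp add: G0)
  define a where "a k = (1/2) ^ k / (1 + I k)" for k
  have a0: "a k > 0" for k using I0[of k] by (simp add: a_def)
  have a1: "a k \<le> (1/2) ^ k" and aI: "a k * I k \<le> (1/2) ^ k" for k
    using mult_left_le[of "1 / (1 + I k)" "(1/2) ^ k"] mult_left_le[of "I k / (1 + I k)" "(1/2) ^ k"] I0[of k]
    by (simp_all add: a_def)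
  have sm2: "summable (\<lambda>k. (1/2 :: real) ^ k)" by (rule summable_geometric) simp
  define w where "w x = (\<Sum>k. a k * indicat_real (C k) x)" for x
  have sm: "summable (\<lambda>k. a k * indicat_real (C k) x)" for x
    by (rule summable_comparison_test'[OF sm2, of 0]) (use a1 a0 in \<open>auto simp: indicator_def less_imp_le\<close>)
  have wC: "a N \<le> w x" if "x \<in> C N" for x N
  proof -
    have "(\<Sum>k\<in>{N}. a k * indicat_real (C k) x) \<le> w x"
      unfolding w_def by (rule sum_le_suminf[OF sm]) (use a0 in \<open>auto simp: less_imp_le\<close>)
    then show ?thesis using that by simp
  qed
  have [measurable]: "C k \<in> sets lebesgue" for k
    using C(1) lmeasurable_compact fmeasurableD by blast
  show thesis
  proof
    show "w \<in> borel_measurable lebesgue" unfolding w_def by measurable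
    show "w x > 0" if "x \<in> \<Omega>" for x
      using that C(3) wC a0 by (metis UN_E less_le_trans)
    show "\<exists>c>0. \<forall>x\<in>K. c \<le> w x" if K: "compact K" "K \<subseteq> \<Omega>" for K
    proof -
      obtain N where "K \<subseteq> C N" using C(4)[OF K] by blast
      then show ?thesis using wC a0[of N] by blast
    qed
    have i: "integrable lebesgue (\<lambda>x. indicat_real (C k) x * G x)" for k
      using G C(1,2) by (auto simp: locally_integrable_def set_integrable_def)
    have "integrable lebesgue (\<lambda>x. \<Sum>k. a k * (indicat_real (C k) x * G x))"
    proof (rule integrable_suminf)
      show "integrable lebesgue (\<lambda>x. a k * (indicat_real (C k) x * G x))" for k
        by (rule integrable_mult_right) (rule i)
      have "summable (\<lambda>k. norm (a k * (indicat_real (C k) x * G x)))" for x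
        using summable_mult2[OF sm, of x "G x"] a0 G0 by (simp add: abs_mult mult_ac less_imp_le)
      then show "AE x in lebesgue. summable (\<lambda>k. norm (a k * (indicat_real (C k) x * G x)))" by simp
      have "(\<integral>x. norm (a k * (indicat_real (C k) x * G x)) \<partial>lebesgue) = a k * I k" for k
        using a0[of k] G0 by (simp add: I_def abs_mult less_imp_le)
      then show "summable (\<lambda>k. \<integral>x. norm (a k * (indicat_real (C k) x * G x)) \<partial>lebesgue)"
        using a0 I0 by (intro summable_comparison_test'[OF sm2, of 0]) (simp add: aI less_imp_le)
    qed
    moreover have "(\<Sum>k. a k * (indicat_real (C k) x * G x)) = indicator \<Omega> x *\<^sub>R (G x * w x)" for x
    proof -
      have "(\<Sum>k. a k * (indicat_real (C k) x * G x)) = G x * w x"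
        unfolding w_def using suminf_mult[OF sm, of "G x" x] by (simp add: mult_ac)
      moreover have "w x = 0" if "x \<notin> \<Omega>"
      proof -
        have "x \<notin> C k" for k using that C(2) by blast
        then show ?thesis by (simp add: w_def)
      qed
      ultimately show ?thesis by (cases "x \<in> \<Omega>") auto
    qed
    ultimately show "set_integrable lebesgue \<Omega> (\<lambda>x. G x * w x)"
      by (simp add: set_integrable_def)
  qed
qed

text \<open>The functional is bounded on the Hilbert space \<open>L\<^sub>2\<close> of the measure \<open>(G / w) dx\<close>, where the
  weight \<open>w\<close> makes \<open>G w\<close> integrable: \<open>\<integral> G \<bar>\<psi>\<bar> dx\<close> is the inner product of \<open>w\<close> and \<open>\<bar>\<psi>\<bar>\<close> in it.\<close>

lemma weak_functional_representation:
  fixes L :: "(real ^ 'n::finite \<Rightarrow> real) \<Rightarrow> real"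
  assumes \<Omega>: "open \<Omega>" and G: "locally_integrable \<Omega> G" and G0: "\<And>x. G x \<ge> 0"
    and lin: "\<And>\<psi> \<eta> c. test_function \<Omega> \<psi> \<Longrightarrow> test_function \<Omega> \<eta> \<Longrightarrow>
      L (\<lambda>x. \<psi> x + c * \<eta> x) = L \<psi> + c * L \<eta>"
    and bound: "\<And>\<psi>. test_function \<Omega> \<psi> \<Longrightarrow> \<bar>L \<psi>\<bar> \<le> (LINT x:\<Omega>|lebesgue. G x * \<bar>\<psi> x\<bar>)"
  obtains g where "locally_integrable \<Omega> g"
    "\<And>\<psi>. test_function \<Omega> \<psi> \<Longrightarrow> L \<psi> = (LINT x:\<Omega>|lebesgue. g x * \<psi> x)"
proof -
  obtain w where w: "w \<in> borel_measurable lebesgue" "set_integrable lebesgue \<Omega> (\<lambda>x. G x * w x)"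
    "\<And>x. x \<in> \<Omega> \<Longrightarrow> w x > 0"
    "\<And>K. compact K \<Longrightarrow> K \<subseteq> \<Omega> \<Longrightarrow> \<exists>c>0. \<forall>x\<in>K. c \<le> w x"
    using integrable_positive_weight[OF \<Omega> G G0] by metis
  note [measurable] = w(1) locally_integrable_measurable[OF \<Omega> G]
  define W where "W x = indicat_real \<Omega> x *\<^sub>R G x / w x" for x
  have [measurable]: "W \<in> borel_measurable lebesgue" unfolding W_def by measurable
  have W0: "W x \<ge> 0" for x using w(3)[of x] G0[of x] by (cases "x \<in> \<Omega>") (auto simp: W_def)
  have Ww: "W x * w x = indicat_real \<Omega> x * G x" for x
    using w(3)[of x] by (cases "x \<in> \<Omega>") (auto simp: W_def)
  have W\<Omega>: "indicat_real \<Omega> x * W x = W x" for x by (simp add: W_def indicator_def)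
  \<comment> \<open>On a compact set \<open>w\<close> is bounded away from 0, so dividing by it
    preserves integrability.\<close>
  have Wl: "locally_integrable \<Omega> W"
    unfolding locally_integrable_def
  proof (intro allI impI)
    fix K assume K: "compact K \<and> K \<subseteq> \<Omega>"
    then obtain c where c: "c > 0" "\<forall>x\<in>K. c \<le> w x" using w(4) by blast
    have [measurable]: "K \<in> sets lebesgue" using K lmeasurable_compact fmeasurableD by blast
    have "set_integrable lebesgue K G" using G K by (simp add: locally_integrable_def)
    then have i: "integrable lebesgue (\<lambda>x. (1 / c) * (indicat_real K x *\<^sub>R G x))"
      unfolding set_integrable_def by (rule integrable_mult_right)
    have "integrable lebesgue (\<lambda>x. indicat_real K x *\<^sub>R W x)"
    proof (rule Bochner_Integration.integrable_bound[OF i])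
      show "AE x in lebesgue. norm (indicat_real K x *\<^sub>R W x) \<le> norm (1 / c * (indicat_real K x *\<^sub>R G x))"
      proof (rule AE_I2)
        fix x
        show "norm (indicat_real K x *\<^sub>R W x) \<le> norm (1 / c * (indicat_real K x *\<^sub>R G x))"
        proof (cases "x \<in> K")
          case True
          then have x: "x \<in> \<Omega>" "c \<le> w x" using K c(2) by auto
          then have "G x / w x \<le> G x / c" using c(1) G0[of x] by (intro divide_left_mono mult_pos_pos) auto
          then show ?thesis using True x c(1) G0[of x] by (simp add: W_def abs_mult)
        qed simp
      qed
    qed measurable
    then show "set_integrable lebesgue K W" by (simp add: set_integrable_def)
  qed
  define M where "M = density lebesgue (\<lambda>x. ennreal (W x))"
  have meas_M: "f \<in> borel_measurable M \<longleftrightarrow> f \<in> borel_measurable lebesgue" for f :: "real ^ 'n \<Rightarrow> real"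
    unfolding M_def by simp
  have int_M: "integrable M f \<longleftrightarrow> integrable lebesgue (\<lambda>x. W x * f x)"
    if "f \<in> borel_measurable lebesgue" for f :: "real ^ 'n \<Rightarrow> real"
    unfolding M_def using integrable_density[OF that, of W] W0 by simp
  have lint_M: "integral\<^sup>L M f = (\<integral>x. W x * f x \<partial>lebesgue)"
    if "f \<in> borel_measurable lebesgue" for f :: "real ^ 'n \<Rightarrow> real"
    unfolding M_def using integral_density[OF that, of W] W0 by simp
  have tf_meas: "\<psi> \<in> borel_measurable lebesgue" if "test_function \<Omega> \<psi>" for \<psi>
    by (rule continuous_imp_lebesgue_measurable[OF cc_functionD(1)[OF test_function_imp_cc_function[OF that]]])
  have tf_sq: "integrable M (\<lambda>x. (\<psi> x)\<^sup>2)" if "test_function \<Omega> \<psi>" for \<psi>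
  proof -
    have cc: "cc_function \<Omega> \<psi>" by (rule test_function_imp_cc_function[OF that])
    have "set_integrable lebesgue \<Omega> (\<lambda>x. W x * (\<psi> x * \<psi> x))"
      by (rule locally_integrable_mult[OF Wl cc_function_mult[OF cc cc_functionD(1)[OF cc]]])
    then have "integrable lebesgue (\<lambda>x. W x * (\<psi> x)\<^sup>2)"
      unfolding set_integrable_def by (simp add: mult.assoc[symmetric] W\<Omega> power2_eq_square)
    then show ?thesis using tf_meas[OF that] by (subst int_M) auto
  qed
  have wM: "w \<in> borel_measurable M" using w(1) meas_M by simp
  have w_sq: "integrable M (\<lambda>x. (w x)\<^sup>2)"
  proof (subst int_M)
    have "W x * (w x)\<^sup>2 = indicat_real \<Omega> x *\<^sub>R (G x * w x)" for x
      using Ww[of x] by (simp add: power2_eq_square mult.assoc[symmetric])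
    then show "integrable lebesgue (\<lambda>x. W x * (w x)\<^sup>2)" using w(2) by (simp add: set_integrable_def)
  qed measurable
  \<comment> \<open>Because \<open>W\<close> times \<open>w\<close> is \<open>G\<close> on \<Omega>,
    the hypothesis reads as an inner product with \<open>w\<close> in the weighted space, and
    Cauchy-Schwarz applies.\<close>
  have LM: "\<bar>L \<psi>\<bar> \<le> sqrt (\<integral>x. (w x)\<^sup>2 \<partial>M) * sqrt (\<integral>x. (\<psi> x)\<^sup>2 \<partial>M)" if \<psi>: "test_function \<Omega> \<psi>" for \<psi>
  proof -
    note [measurable] = tf_meas[OF \<psi>]
    have "\<bar>L \<psi>\<bar> \<le> (LINT x:\<Omega>|lebesgue. G x * \<bar>\<psi> x\<bar>)" by (rule bound[OF \<psi>])
    also have "\<dots> = (\<integral>x. W x * (w x * \<bar>\<psi> x\<bar>) \<partial>lebesgue)"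
      unfolding set_lebesgue_integral_def by (simp add: mult.assoc[symmetric] Ww)
    also have "\<dots> = (\<integral>x. w x * \<bar>\<psi> x\<bar> \<partial>M)" by (rule lint_M[symmetric]) measurable
    finally have "\<bar>L \<psi>\<bar> \<le> (\<integral>x. w x * \<bar>\<psi> x\<bar> \<partial>M)" .
    moreover have "(\<integral>x. w x * \<bar>\<psi> x\<bar> \<partial>M)\<^sup>2 \<le> (\<integral>x. (w x)\<^sup>2 \<partial>M) * (\<integral>x. \<bar>\<psi> x\<bar>\<^sup>2 \<partial>M)"
      using tf_sq[OF \<psi>] w_sq by (intro Cauchy_Schwarz_L2 wM) (simp_all add: meas_M)
    then have "(\<integral>x. w x * \<bar>\<psi> x\<bar> \<partial>M) \<le> sqrt ((\<integral>x. (w x)\<^sup>2 \<partial>M) * (\<integral>x. (\<psi> x)\<^sup>2 \<partial>M))"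
      by (intro real_le_rsqrt) simp
    ultimately show ?thesis by (simp add: real_sqrt_mult)
  qed
  have "\<exists>u. u \<in> borel_measurable M \<and> integrable M (\<lambda>x. (u x)\<^sup>2) \<and>
    (\<forall>v\<in>{\<psi>. test_function \<Omega> \<psi>}. L v = (\<integral>x. u x * v x \<partial>M))"
  proof (rule L2_Riesz_representation[of "{\<psi>. test_function \<Omega> \<psi>}" M L "sqrt (\<integral>x. (w x)\<^sup>2 \<partial>M)"])
    have "test_function \<Omega> (\<lambda>x. 0)" by (rule test_functionI[of _ "{}"]) (auto intro: C_k_const)
    then show "{\<psi>. test_function \<Omega> \<psi>} \<noteq> {}" by blast
    show "(\<lambda>x. v x + c * z x) \<in> {\<psi>. test_function \<Omega> \<psi>}"
      if "v \<in> {\<psi>. test_function \<Omega> \<psi>}" "z \<in> {\<psi>. test_function \<Omega> \<psi>}" for v z c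
      using that by (simp add: test_function_add test_function_mult C_k_const)
  qed (use tf_sq tf_meas meas_M lin LM in auto)
  then obtain u where u: "u \<in> borel_measurable M" "integrable M (\<lambda>x. (u x)\<^sup>2)"
    "\<And>\<psi>. test_function \<Omega> \<psi> \<Longrightarrow> L \<psi> = (\<integral>x. u x * \<psi> x \<partial>M)" by blast
  have [measurable]: "u \<in> borel_measurable lebesgue" using u(1) meas_M by simp
  show thesis
  proof
    \<comment> \<open>Multiplying by the density \<open>W\<close> turns the weighted inner product
      back into a plain integral. Local integrability follows from
      \<open>\<bar>u x\<bar> \<le> 1 + (u x)\<^sup>2\<close>.\<close>
    show "locally_integrable \<Omega> (\<lambda>x. W x * u x)"
      unfolding locally_integrable_def
    proof (intro allI impI)
      fix K assume K: "compact K \<and> K \<subseteq> \<Omega>"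
      have [measurable]: "K \<in> sets lebesgue" using K lmeasurable_compact fmeasurableD by blast
      have "integrable lebesgue (\<lambda>x. W x * (u x)\<^sup>2)" using u(2) by (subst (asm) int_M) auto
      moreover have "integrable lebesgue (\<lambda>x. indicat_real K x *\<^sub>R W x)"
        using Wl K by (simp add: locally_integrable_def set_integrable_def)
      ultimately have i: "integrable lebesgue (\<lambda>x. indicat_real K x *\<^sub>R W x + W x * (u x)\<^sup>2)"
        by (rule Bochner_Integration.integrable_add[rotated])
      have "integrable lebesgue (\<lambda>x. indicat_real K x *\<^sub>R (W x * u x))"
      proof (rule Bochner_Integration.integrable_bound[OF i])
        have "\<bar>u x\<bar> \<le> 1 + (u x)\<^sup>2" for x
        proof -
          have "0 \<le> (1 - \<bar>u x\<bar>)\<^sup>2" by simp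
          then show ?thesis by (simp add: power2_diff)
        qed
        then have "W x * \<bar>u x\<bar> \<le> W x + W x * (u x)\<^sup>2" for x
          using mult_left_mono[OF _ W0, of "\<bar>u x\<bar>" "1 + (u x)\<^sup>2" x] by (simp add: distrib_left)
        then show "AE x in lebesgue. norm (indicat_real K x *\<^sub>R (W x * u x))
            \<le> norm (indicat_real K x *\<^sub>R W x + W x * (u x)\<^sup>2)"
          using W0 by (intro AE_I2) (auto simp: indicator_def abs_mult)
      qed measurable
      then show "set_integrable lebesgue K (\<lambda>x. W x * u x)" by (simp add: set_integrable_def)
    qed
    show "L \<psi> = (LINT x:\<Omega>|lebesgue. W x * u x * \<psi> x)" if \<psi>: "test_function \<Omega> \<psi>" for \<psi>
    proof -
      note [measurable] = tf_meas[OF \<psi>]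
      have "L \<psi> = (\<integral>x. W x * (u x * \<psi> x) \<partial>lebesgue)"
        unfolding u(3)[OF \<psi>] by (rule lint_M) measurable
      then show ?thesis
        unfolding set_lebesgue_integral_def by (simp add: mult.assoc[symmetric] W\<Omega>)
    qed
  qed
qed

subsection \<open>Geodesic distance\<close>

text \<open>At a point of non-differentiability \<open>vector_derivative\<close> is an arbitrary vector, so lengths are
  only computed for curves that are differentiable off a finite set.\<close>

definition rectifiable_join :: "'a::euclidean_space set \<Rightarrow> 'a \<Rightarrow> 'a \<Rightarrow> real \<Rightarrow> bool" where
  "rectifiable_join G x y l \<longleftrightarrow> (\<exists>\<gamma> L S. L-lipschitz_on {0..1} \<gamma> \<and> \<gamma> ` {0..1} \<subseteq> G \<and> \<gamma> 0 = x \<and> \<gamma> 1 = y \<and>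
     finite S \<and> (\<forall>t\<in>{0..1} - S. \<gamma> differentiable (at t)) \<and>
     ((\<lambda>t. norm (vector_derivative \<gamma> (at t))) has_integral l) {0..1})"

lemma lipschitz_imp_absolutely_continuous_curve:
  fixes \<gamma> :: "real \<Rightarrow> 'a::real_normed_vector"
  assumes L: "L-lipschitz_on {0..1} \<gamma>"
  shows "absolutely_continuous_curve \<gamma>"
  unfolding absolutely_continuous_curve_def
proof (intro allI impI)
  fix \<epsilon> :: real assume \<epsilon>: "\<epsilon> > 0"
  have L0: "L \<ge> 0" by (rule lipschitz_on_nonneg[OF L])
  show "\<exists>\<delta>>0. \<forall>d. d division_of \<Union>d \<and> \<Union>d \<subseteq> {0..1} \<and> (\<Sum>k\<in>d. measure lborel k) < \<delta> \<longrightarrow>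
        (\<Sum>k\<in>d. norm (\<gamma> (Sup k) - \<gamma> (Inf k))) < \<epsilon>"
  proof (intro exI conjI allI impI)
    \<comment> \<open>The summand 1 covers \<open>L = 0\<close> and makes the final inequality
      strict.\<close>
    show "\<epsilon> / (L + 1) > 0" using \<epsilon> L0 by simp
    fix d :: "real set set"
    assume d: "d division_of \<Union>d \<and> \<Union>d \<subseteq> {0..1} \<and> (\<Sum>k\<in>d. measure lborel k) < \<epsilon> / (L + 1)"
    have "norm (\<gamma> (Sup k) - \<gamma> (Inf k)) \<le> L * measure lborel k" if "k \<in> d" for k
    proof -
      have "k \<noteq> {}" "\<exists>a b. k = cbox a b" using division_ofD(3,4)[of d "\<Union>d" k] d that by auto
      then obtain a b where ab: "k = {a..b}" "a \<le> b" by auto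
      have "k \<subseteq> {0..1}" using d that by blast
      then have "a \<in> {0..1}" "b \<in> {0..1}" using ab by auto
      then have "dist (\<gamma> b) (\<gamma> a) \<le> L * dist b a" by (intro lipschitz_onD[OF L])
      then show ?thesis using ab by (simp add: dist_norm)
    qed
    then have "(\<Sum>k\<in>d. norm (\<gamma> (Sup k) - \<gamma> (Inf k))) \<le> (\<Sum>k\<in>d. L * measure lborel k)"
      by (rule sum_mono)
    also have "\<dots> = L * (\<Sum>k\<in>d. measure lborel k)" by (simp add: sum_distrib_left)
    also have "\<dots> \<le> L * (\<epsilon> / (L + 1))" using d L0 by (intro mult_left_mono) auto
    also have "\<dots> < \<epsilon>" using \<epsilon> L0 by (simp add: field_simps)
    finally show "(\<Sum>k\<in>d. norm (\<gamma> (Sup k) - \<gamma> (Inf k))) < \<epsilon>" .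
  qed
qed

lemma rectifiable_join_nonneg: "rectifiable_join G x y l \<Longrightarrow> l \<ge> 0"
  unfolding rectifiable_join_def by (auto intro: has_integral_nonneg)

lemma rectifiable_join_refl:
  assumes "x \<in> G"
  shows "rectifiable_join G x x 0"
  unfolding rectifiable_join_def
  by (rule exI[of _ "\<lambda>t. x"], rule exI[of _ 0], rule exI[of _ "{}"])
    (use assms in \<open>auto intro!: lipschitz_onI\<close>)

lemma geodesic_dist_le_rectifiable_join:
  assumes "rectifiable_join G x y l"
  shows "geodesic_dist G x y \<le> ennreal l"
proof -
  obtain \<gamma> L S where g: "L-lipschitz_on {0..1} \<gamma>" "\<gamma> ` {0..1} \<subseteq> G" "\<gamma> 0 = x" "\<gamma> 1 = y"
    "((\<lambda>t. norm (vector_derivative \<gamma> (at t))) has_integral l) {0..1}"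
    using assms unfolding rectifiable_join_def by blast
  have "geodesic_dist G x y \<le> ennreal (curve_length \<gamma>)"
    unfolding geodesic_dist_def
    by (rule INF_lower) (use g lipschitz_imp_absolutely_continuous_curve in auto)
  also have "curve_length \<gamma> = l"
    unfolding curve_length_def by (rule integral_unique[OF g(5)])
  finally show ?thesis .
qed

text \<open>Concatenation with a segment, each piece traversed at double speed. It yields both the
  connectedness argument and the Lipschitz property of the infimum of lengths.\<close>

lemma rectifiable_join_segment:
  assumes "rectifiable_join G x y l" "closed_segment y z \<subseteq> G"
  shows "rectifiable_join G x z (l + dist y z)"
proof -
  obtain \<gamma> L S where L: "L-lipschitz_on {0..1} \<gamma>" and im: "\<gamma> ` {0..1} \<subseteq> G"
    and ends: "\<gamma> 0 = x" "\<gamma> 1 = y" and S: "finite S" "\<And>t. t \<in> {0..1} - S \<Longrightarrow> \<gamma> differentiable (at t)"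
    and int: "((\<lambda>t. norm (vector_derivative \<gamma> (at t))) has_integral l) {0..1}"
    using assms(1) unfolding rectifiable_join_def by blast
  have L0: "L \<ge> 0" by (rule lipschitz_on_nonneg[OF L])
  \<comment> \<open>The two clipped parameters put both pieces into a single formula, so the
    Lipschitz estimate needs no case distinction at the junction.\<close>
  define \<eta> where "\<eta> t = \<gamma> (min (2 * t) 1) + max (2 * t - 1) 0 *\<^sub>R (z - y)" for t
  have lip: "(2 * L + 2 * norm (z - y))-lipschitz_on {0..1} \<eta>"
  proof (rule lipschitz_onI)
    fix s t :: real assume st: "s \<in> {0..1}" "t \<in> {0..1}"
    have "dist (\<eta> s) (\<eta> t) \<le> dist (\<gamma> (min (2 * s) 1)) (\<gamma> (min (2 * t) 1)) +
        dist (max (2 * s - 1) 0 *\<^sub>R (z - y)) (max (2 * t - 1) 0 *\<^sub>R (z - y))"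
      unfolding \<eta>_def by (rule dist_triangle_add)
    also have "\<dots> \<le> L * dist (min (2 * s) 1) (min (2 * t) 1) + dist (max (2 * s - 1) 0) (max (2 * t - 1) 0) * norm (z - y)"
      using st by (intro add_mono lipschitz_onD[OF L])
        (auto simp: dist_norm simp flip: scaleR_diff_left)
    also have "\<dots> \<le> L * (2 * dist s t) + (2 * dist s t) * norm (z - y)"
    proof (intro add_mono mult_left_mono mult_right_mono L0 norm_ge_zero)
      show "dist (min (2 * s) 1) (min (2 * t) 1) \<le> 2 * dist s t"
        "dist (max (2 * s - 1) 0) (max (2 * t - 1) 0) \<le> 2 * dist s t"
        by (auto simp: dist_real_def min_def max_def abs_if)
    qed
    finally show "dist (\<eta> s) (\<eta> t) \<le> (2 * L + 2 * norm (z - y)) * dist s t"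
      by (simp add: algebra_simps)
  qed (use L0 in simp)
  have d1: "(\<eta> has_vector_derivative 2 *\<^sub>R vector_derivative \<gamma> (at (2 * t))) (at t)"
    if t: "0 < t" "t < 1/2" "2 * t \<notin> S" for t
  proof -
    have "(\<gamma> has_vector_derivative vector_derivative \<gamma> (at (2 * t))) (at (2 * t))"
      using S(2)[of "2 * t"] t by (simp add: vector_derivative_works)
    then have "((\<gamma> \<circ> (\<lambda>s. 2 * s)) has_vector_derivative 2 *\<^sub>R vector_derivative \<gamma> (at (2 * t))) (at t)"
      by (intro vector_diff_chain_at) (auto intro!: derivative_eq_intros)
    then show ?thesis
      by (rule has_vector_derivative_transform_within_open[of _ _ _ "{0<..<1/2}"])
        (use t in \<open>auto simp: \<eta>_def\<close>)
  qed
  have d2: "(\<eta> has_vector_derivative 2 *\<^sub>R (z - y)) (at t)" if t: "1/2 < t" "t < 1" for t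
  proof -
    have "((\<lambda>s. \<gamma> 1 + (2 * s - 1) *\<^sub>R (z - y)) has_vector_derivative 2 *\<^sub>R (z - y)) (at t)"
      by (auto intro!: derivative_eq_intros)
    then show ?thesis
      by (rule has_vector_derivative_transform_within_open[of _ _ _ "{1/2<..<1}"])
        (use t in \<open>auto simp: \<eta>_def\<close>)
  qed
  \<comment> \<open>The rescaled exceptional points, together with the junction and the endpoints,
    where the two-sided derivative is left uncomputed.\<close>
  define T where "T = (\<lambda>s. s / 2) ` S \<union> {0, 1/2, 1}"
  have T: "finite T" using S(1) by (simp add: T_def)
  have nT: "2 * t \<notin> S" if "t \<notin> T" for t
    using that imageI[of "2 * t" S "\<lambda>s. s / 2"] by (auto simp: T_def)
  have diff: "\<eta> differentiable (at t)" if "t \<in> {0..1} - T" for t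
  proof (cases "t < 1/2")
    case True
    then show ?thesis
      using d1[of t] that nT[of t] by (auto simp: T_def intro: differentiableI_vector)
  next
    case False
    then show ?thesis
      using d2[of t] that by (auto simp: T_def intro: differentiableI_vector)
  qed
  \<comment> \<open>The factor 2 of the chain rule compensates for halving the parameter
    interval.\<close>
  have int1: "((\<lambda>t. norm (vector_derivative \<eta> (at t))) has_integral l) {0..1/2}"
  proof (rule has_integral_spike_finite[OF T])
    have "((\<lambda>t. norm (vector_derivative \<gamma> (at (2 * t)))) has_integral (1 / \<bar>2\<bar>) *\<^sub>R l) ((\<lambda>x. x / 2) ` {0..1})"
      by (rule has_integral_stretch_real[OF int]) simp
    moreover have "(\<lambda>x::real. x / 2) ` {0..1} = {0..1/2}" by (simp add: image_divide_atLeastAtMost)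
    ultimately show "((\<lambda>t. 2 * norm (vector_derivative \<gamma> (at (2 * t)))) has_integral l) {0..1/2}"
      using has_integral_mult_right[of _ "l / 2" "{0..1/2}" 2] by simp
    show "norm (vector_derivative \<eta> (at t)) = 2 * norm (vector_derivative \<gamma> (at (2 * t)))"
      if "t \<in> {0..1/2} - T" for t
      using vector_derivative_at[OF d1[of t]] that nT[of t] by (auto simp: T_def)
  qed
  have int2: "((\<lambda>t. norm (vector_derivative \<eta> (at t))) has_integral dist y z) {1/2..1}"
  proof (rule has_integral_spike_finite[OF T])
    show "((\<lambda>t::real. 2 * norm (z - y)) has_integral dist y z) {1/2..1}"
      using has_integral_const_real[of "2 * norm (z - y)" "1/2" 1] by (simp add: dist_norm norm_minus_commute)
    show "norm (vector_derivative \<eta> (at t)) = 2 * norm (z - y)" if "t \<in> {1/2..1} - T" for t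
      using vector_derivative_at[OF d2[of t]] that by (auto simp: T_def)
  qed
  have "((\<lambda>t. norm (vector_derivative \<eta> (at t))) has_integral l + dist y z) {0..1}"
    by (rule has_integral_combine[OF _ _ int1 int2]) auto
  moreover have "\<eta> ` {0..1} \<subseteq> G"
  proof (rule image_subsetI)
    fix t :: real assume t: "t \<in> {0..1}"
    show "\<eta> t \<in> G"
    proof (cases "t \<le> 1/2")
      case True
      then show ?thesis using im t by (auto simp: \<eta>_def)
    next
      case False
      then have "\<eta> t \<in> closed_segment y z"
        using t ends unfolding closed_segment_def \<eta>_def
        by (auto intro!: exI[of _ "2 * t - 1"] simp: algebra_simps)
      then show ?thesis using assms(2) by blast
    qed
  qed
  moreover have "\<eta> 0 = x" "\<eta> 1 = z" using ends by (auto simp: \<eta>_def)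
  ultimately show ?thesis
    unfolding rectifiable_join_def using lip T diff by blast
qed

text \<open>The set of points reachable from \<open>x\<close> is open and so is its complement in
  \<open>G\<close>, since reachability is constant on each ball inside \<open>G\<close>.\<close>

lemma domain_rectifiable_join:
  assumes G: "is_domain G" and x: "x \<in> G" and y: "y \<in> G"
  shows "\<exists>l. rectifiable_join G x y l"
proof -
  define T where "T = {y \<in> G. \<exists>l. rectifiable_join G x y l}"
  have op: "open G" and con: "connected G" using G by (auto simp: is_domain_def)
  have step: "z \<in> T \<longleftrightarrow> w \<in> T" if b: "ball w r \<subseteq> G" "z \<in> ball w r" for z w r
  proof -
    have r: "w \<in> ball w r" using b(2) by (auto intro: le_less_trans[OF zero_le_dist])
    have "closed_segment z w \<subseteq> G" "closed_segment w z \<subseteq> G"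
      using closed_segment_subset[OF b(2) r convex_ball] closed_segment_subset[OF r b(2) convex_ball] b(1)
      by blast+
    then show ?thesis
      using rectifiable_join_segment[of G x z _ w] rectifiable_join_segment[of G x w _ z] b r
      unfolding T_def by blast
  qed
  have "open T"
    unfolding open_contains_ball
  proof
    fix w assume w: "w \<in> T"
    then obtain r where r: "r > 0" "ball w r \<subseteq> G" using op by (auto simp: T_def open_contains_ball)
    then show "\<exists>e>0. ball w e \<subseteq> T" using step[OF r(2)] w by blast
  qed
  moreover have "open (G - T)"
    unfolding open_contains_ball
  proof
    fix w assume w: "w \<in> G - T"
    then obtain r where r: "r > 0" "ball w r \<subseteq> G" using op by (auto simp: open_contains_ball)
    then show "\<exists>e>0. ball w e \<subseteq> G - T" using step[OF r(2)] w by blast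
  qed
  moreover have "x \<in> T" using rectifiable_join_refl[OF x] x by (auto simp: T_def)
  moreover have "T \<subseteq> G" by (auto simp: T_def)
  ultimately have "G - T = {}"
    using connectedD[OF con, of T "G - T"] x by blast
  then show ?thesis using y by (auto simp: T_def)
qed

text \<open>\<open>d\<close> is the infimum of lengths over the restricted class of joins. It is
  finite on \<open>G\<close> and dominates the geodesic distance, which is all that a bound on the
  diameter requires. Appending the straight segment gives the Lipschitz estimate inside
  balls.\<close>

lemma geodesic_dist_Lipschitz_majorant:
  assumes G: "is_domain G" and x: "x \<in> G"
  obtains d where "d x = (0::real)" "\<And>y. y \<in> G \<Longrightarrow> geodesic_dist G x y \<le> ennreal (d y)"
    "\<And>y z r. ball y r \<subseteq> G \<Longrightarrow> z \<in> ball y r \<Longrightarrow> \<bar>d z - d y\<bar> \<le> dist z y"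
proof -
  define A where "A y = {l. rectifiable_join G x y l}" for y
  define d where "d y = Inf (A y)" for y
  have bdd: "bdd_below (A y)" for y
    by (rule bdd_belowI[of _ 0]) (auto simp: A_def rectifiable_join_nonneg)
  have ne: "A y \<noteq> {}" if "y \<in> G" for y
    using domain_rectifiable_join[OF G x that] by (auto simp: A_def)
  have le: "d z \<le> d y + dist y z" if "closed_segment y z \<subseteq> G" for y z
  proof -
    have y: "y \<in> G" using that by auto
    have "d z - dist y z \<le> d y"
      unfolding d_def[of y]
    proof (rule cInf_greatest[OF ne[OF y]])
      fix l assume "l \<in> A y"
      then have "l + dist y z \<in> A z" using rectifiable_join_segment[OF _ that] by (auto simp: A_def)
      then have "d z \<le> l + dist y z" unfolding d_def by (rule cInf_lower[OF _ bdd])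
      then show "d z - dist y z \<le> l" by simp
    qed
    then show ?thesis by simp
  qed
  show thesis
  proof
    have "d x \<ge> 0" unfolding d_def
      by (rule cInf_greatest[OF ne[OF x]]) (auto simp: A_def rectifiable_join_nonneg)
    moreover have "d x \<le> 0" unfolding d_def
      by (rule cInf_lower[OF _ bdd]) (simp add: A_def rectifiable_join_refl[OF x])
    ultimately show "d x = 0" by simp
    show "geodesic_dist G x y \<le> ennreal (d y)" if y: "y \<in> G" for y
    proof (rule ennreal_le_epsilon)
      fix e :: real assume e: "e > 0"
      obtain l where l: "l \<in> A y" "l < d y + e"
        using cInf_less_iff[OF ne[OF y] bdd, of "d y + e"] e unfolding d_def[of y] by auto
      have "d y \<ge> 0" unfolding d_def
        by (rule cInf_greatest[OF ne[OF y]]) (auto simp: A_def rectifiable_join_nonneg)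
      have "geodesic_dist G x y \<le> ennreal l"
        using l(1) by (intro geodesic_dist_le_rectifiable_join) (simp add: A_def)
      also have "\<dots> \<le> ennreal (d y + e)" using l(2) by (intro ennreal_leI) simp
      also have "\<dots> = ennreal (d y) + ennreal e" using \<open>d y \<ge> 0\<close> e by (simp add: ennreal_plus)
      finally show "geodesic_dist G x y \<le> ennreal (d y) + ennreal e" .
    qed
    show "\<bar>d z - d y\<bar> \<le> dist z y" if b: "ball y r \<subseteq> G" "z \<in> ball y r" for y z r
    proof -
      have r: "y \<in> ball y r" using b(2) by (auto intro: le_less_trans[OF zero_le_dist])
      have "closed_segment z y \<subseteq> G" "closed_segment y z \<subseteq> G"
        using closed_segment_subset[OF b(2) r convex_ball] closed_segment_subset[OF r b(2) convex_ball] b(1)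
        by blast+
      then show ?thesis using le[of z y] le[of y z] by (simp add: dist_commute)
    qed
  qed
qed

subsection \<open>Composition with the geodesic distance\<close>

lemma sum_powr_le:
  fixes a :: "'i \<Rightarrow> real"
  assumes J: "finite J" and a: "\<And>j. j \<in> J \<Longrightarrow> a j \<ge> 0" and c: "c \<ge> 0" and q: "q > 0"
  shows "(c * (\<Sum>j\<in>J. a j)) powr q \<le> (\<Sum>j\<in>J. (c * card J) powr q * a j powr q)"
proof (cases "J = {}")
  case False
  \<comment> \<open>Some summand is at least the average; its power alone controls that of the sum,
    for every positive exponent.\<close>
  have "\<exists>j\<in>J. (\<Sum>j\<in>J. a j) \<le> card J * a j"
  proof (rule ccontr)
    assume "\<not> ?thesis"
    then have lt: "card J * a j < (\<Sum>j\<in>J. a j)" if "j \<in> J" for j using that by force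
    have "(\<Sum>j\<in>J. card J * a j) < (\<Sum>j\<in>J. \<Sum>j\<in>J. a j)"
      by (rule sum_strict_mono[OF J False lt])
    then show False by (simp add: sum_distrib_left)
  qed
  then obtain j where j: "j \<in> J" "(\<Sum>j\<in>J. a j) \<le> card J * a j" by blast
  have "(c * (\<Sum>j\<in>J. a j)) powr q \<le> (c * card J * a j) powr q"
    using j c q by (intro powr_mono2) (auto simp: mult.assoc intro!: mult_left_mono sum_nonneg mult_nonneg_nonneg a)
  also have "\<dots> = (c * card J) powr q * a j powr q"
    using a[OF j(1)] c by (simp add: powr_mult)
  also have "\<dots> \<le> (\<Sum>j\<in>J. (c * card J) powr q * a j powr q)"
    using j(1) J by (intro member_le_sum) auto
  finally show ?thesis .
qed simp

text \<open>The point is the order of quantifiers: \<open>B\<close> depends on the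
  \<open>g j\<close> and \<open>c\<close> but not on \<open>f\<close>. Later this makes the seminorm
  bound the same for all base points.\<close>

lemma Lp_norm_uniform_bound:
  fixes g :: "'i::finite \<Rightarrow> 'a::euclidean_space \<Rightarrow> 'b::euclidean_space"
  assumes p: "p > 0" and meas: "\<And>j. g j \<in> borel_measurable (lebesgue_on \<Omega>)"
    and fin: "\<And>j. Lp_norm p \<Omega> (g j) < \<infinity>" and c: "c \<ge> 0"
  obtains B where "B \<ge> 0" "\<And>f. f \<in> borel_measurable (lebesgue_on \<Omega>) \<Longrightarrow>
    AE x in lebesgue_on \<Omega>. norm (f x :: 'b) \<le> c * (\<Sum>j\<in>UNIV. norm (g j x)) \<Longrightarrow> Lp_norm p \<Omega> f \<le> ennreal B"
proof (cases "p = \<infinity>")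
  case True
  define e where "e j = enn2real (esssup (lebesgue_on \<Omega>) (\<lambda>x. ennreal (norm (g j x))))" for j
  have e: "esssup (lebesgue_on \<Omega>) (\<lambda>x. ennreal (norm (g j x))) = ennreal (e j)" for j
    using fin[of j] True by (simp add: Lp_norm_def e_def ennreal_enn2real)
  have e0: "e j \<ge> 0" for j by (simp add: e_def)
  have le: "AE x in lebesgue_on \<Omega>. norm (g j x) \<le> e j" for j
    using esssup_AE[where M = "lebesgue_on \<Omega>" and f = "\<lambda>x. ennreal (norm (g j x))"] e0[of j]
    unfolding e by (simp add: ennreal_le_iff)
  show thesis
  proof
    show "c * (\<Sum>j\<in>UNIV. e j) \<ge> 0" using c e0 by (intro mult_nonneg_nonneg sum_nonneg) auto
    fix f :: "'a \<Rightarrow> 'b"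
    assume f: "f \<in> borel_measurable (lebesgue_on \<Omega>)"
      and b: "AE x in lebesgue_on \<Omega>. norm (f x) \<le> c * (\<Sum>j\<in>UNIV. norm (g j x))"
    have "AE x in lebesgue_on \<Omega>. \<forall>j. norm (g j x) \<le> e j"
      using le by (simp add: AE_all_countable)
    with b have "AE x in lebesgue_on \<Omega>. ennreal (norm (f x)) \<le> ennreal (c * (\<Sum>j\<in>UNIV. e j))"
    proof eventually_elim
      case (elim x)
      have "c * (\<Sum>j\<in>UNIV. norm (g j x)) \<le> c * (\<Sum>j\<in>UNIV. e j)"
        using c elim(2) by (intro mult_left_mono sum_mono) auto
      then show ?case using elim(1) by (intro ennreal_leI) linarith
    qed
    moreover have "(\<lambda>x. ennreal (norm (f x))) \<in> borel_measurable (lebesgue_on \<Omega>)"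
      using f by measurable
    ultimately show "Lp_norm p \<Omega> f \<le> ennreal (c * (\<Sum>j\<in>UNIV. e j))"
      using True by (simp add: Lp_norm_def esssup_I)
  qed
next
  case False
  define q where "q = enn2real p"
  have q: "q > 0" using p False by (simp add: q_def enn2real_positive_iff top.not_eq_extremum)
  define I where "I f = (\<integral>\<^sup>+x. ennreal (norm (f x) powr q) \<partial>lebesgue_on \<Omega>)" for f :: "'a \<Rightarrow> 'b"
  have Lp: "Lp_norm p \<Omega> f = (if I f = \<infinity> then \<infinity> else ennreal (enn2real (I f) powr (1 / q)))" for f :: "'a \<Rightarrow> 'b"
    using False by (simp add: Lp_norm_def I_def q_def Let_def)
  have I: "I (g j) < \<infinity>" for j
    using fin[of j] unfolding Lp by (auto split: if_splits simp: less_top)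
  define m where "m = (c * real CARD('i)) powr q"
  define T where "T = (\<Sum>j\<in>UNIV. ennreal m * I (g j))"
  have T: "T < \<infinity>" unfolding T_def using I by (simp add: ennreal_mult_less_top)
  note [measurable] = meas
  show thesis
  proof
    show "enn2real T powr (1 / q) \<ge> 0" by simp
    fix f :: "'a \<Rightarrow> 'b"
    assume f: "f \<in> borel_measurable (lebesgue_on \<Omega>)"
      and b: "AE x in lebesgue_on \<Omega>. norm (f x) \<le> c * (\<Sum>j\<in>UNIV. norm (g j x))"
    have "I f \<le> (\<integral>\<^sup>+x. (\<Sum>j\<in>UNIV. ennreal m * ennreal (norm (g j x) powr q)) \<partial>lebesgue_on \<Omega>)"
      unfolding I_def
    proof (rule nn_integral_mono_AE)
      show "AE x in lebesgue_on \<Omega>. ennreal (norm (f x) powr q) \<le> (\<Sum>j\<in>UNIV. ennreal m * ennreal (norm (g j x) powr q))"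
        using b
      proof eventually_elim
        case (elim x)
        have "norm (f x) powr q \<le> (c * (\<Sum>j\<in>UNIV. norm (g j x))) powr q"
          using elim q by (intro powr_mono2) auto
        also have "\<dots> \<le> (\<Sum>j\<in>UNIV. m * norm (g j x) powr q)"
          unfolding m_def by (rule sum_powr_le) (use c q in auto)
        finally have "ennreal (norm (f x) powr q) \<le> ennreal (\<Sum>j\<in>UNIV. m * norm (g j x) powr q)"
          by (rule ennreal_leI)
        also have "\<dots> = (\<Sum>j\<in>UNIV. ennreal (m * norm (g j x) powr q))"
          by (rule sum_ennreal[symmetric]) (simp add: m_def)
        finally show ?case by (simp add: ennreal_mult m_def)
      qed
    qed
    also have "\<dots> = T"
      unfolding T_def I_def by (subst nn_integral_sum) (auto simp: nn_integral_cmult)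
    finally have le: "I f \<le> T" .
    then have "enn2real (I f) powr (1 / q) \<le> enn2real T powr (1 / q)"
      using T q by (intro powr_mono2 enn2real_mono) auto
    then show "Lp_norm p \<Omega> f \<le> ennreal (enn2real T powr (1 / q))"
      unfolding Lp using le T by (auto intro: ennreal_leI)
  qed
qed

lemma locally_integrable_measurable_on:
  fixes g :: "'a::euclidean_space \<Rightarrow> 'b::euclidean_space"
  assumes "open \<Omega>" "locally_integrable \<Omega> g"
  shows "g \<in> borel_measurable (lebesgue_on \<Omega>)"
  using locally_integrable_measurable[OF assms] assms(1)
  by (subst borel_measurable_restrict_space_iff) auto

lemma weak_gradient_works:
  assumes "f \<in> sobolev_space p \<Omega>"
  shows "has_weak_gradient \<Omega> f (weak_gradient \<Omega> f)"
proof -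
  have "\<exists>g. has_weak_gradient \<Omega> f g" using assms by (simp add: sobolev_space_def)
  then show ?thesis unfolding weak_gradient_def by (rule someI_ex)
qed

text \<open>For each coordinate \<open>i\<close> the functional sending \<open>\<psi>\<close> to
  minus the integral of \<open>f\<close> against its partial derivative is linear and dominated by
  \<open>G i\<close>. Its representing functions are assembled into a vector field.\<close>

lemma weak_gradient_exists:
  fixes f :: "real ^ 'n::finite \<Rightarrow> real"
  assumes \<Omega>: "open \<Omega>" and f: "locally_integrable \<Omega> f"
    and G: "\<And>i. locally_integrable \<Omega> (G i)" "\<And>i x. G i x \<ge> 0"
    and bound: "\<And>\<psi> i. test_function \<Omega> \<psi> \<Longrightarrow>
      \<bar>LINT x:\<Omega>|lebesgue. f x * partial_deriv i \<psi> x\<bar> \<le> (LINT x:\<Omega>|lebesgue. G i x * \<bar>\<psi> x\<bar>)"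
  shows "\<exists>g. has_weak_gradient \<Omega> f g"
proof -
  have "\<exists>h. locally_integrable \<Omega> h \<and> (\<forall>\<psi>. test_function \<Omega> \<psi> \<longrightarrow>
     - (LINT x:\<Omega>|lebesgue. f x * partial_deriv i \<psi> x) = (LINT x:\<Omega>|lebesgue. h x * \<psi> x))" for i
  proof (rule weak_functional_representation[OF \<Omega> G, of "\<lambda>\<psi>. - (LINT x:\<Omega>|lebesgue. f x * partial_deriv i \<psi> x)" i])
    fix \<psi> \<eta> :: "real ^ 'n \<Rightarrow> real" and c :: real
    assume t: "test_function \<Omega> \<psi>" "test_function \<Omega> \<eta>"
    have "partial_deriv i (\<lambda>x. \<psi> x + c * \<eta> x) x = partial_deriv i \<psi> x + c * partial_deriv i \<eta> x" for x
    proof -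
      have "((\<lambda>x. \<psi> x + c * \<eta> x) has_derivative
          (\<lambda>h. frechet_derivative \<psi> (at x) h + c * frechet_derivative \<eta> (at x) h)) (at x)"
        by (intro has_derivative_add has_derivative_mult_right t[THEN test_function_has_derivative])
      then show ?thesis using partial_deriv_eqI by (fastforce simp: partial_deriv_def)
    qed
    then have "(LINT x:\<Omega>|lebesgue. f x * partial_deriv i (\<lambda>x. \<psi> x + c * \<eta> x) x) =
        (LINT x:\<Omega>|lebesgue. f x * partial_deriv i \<psi> x + c * (f x * partial_deriv i \<eta> x))"
      by (simp add: distrib_left mult_ac)
    also have "\<dots> = (LINT x:\<Omega>|lebesgue. f x * partial_deriv i \<psi> x) + c * (LINT x:\<Omega>|lebesgue. f x * partial_deriv i \<eta> x)"
      using t[THEN test_function_partial_deriv, THEN test_function_imp_cc_function, THEN locally_integrable_mult[OF f], of i]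
      by simp
    finally show "- (LINT x:\<Omega>|lebesgue. f x * partial_deriv i (\<lambda>x. \<psi> x + c * \<eta> x) x) =
        - (LINT x:\<Omega>|lebesgue. f x * partial_deriv i \<psi> x) + c * - (LINT x:\<Omega>|lebesgue. f x * partial_deriv i \<eta> x)"
      by simp
  next
    show "\<bar>- (LINT x:\<Omega>|lebesgue. f x * partial_deriv i \<psi> x)\<bar> \<le> (LINT x:\<Omega>|lebesgue. G i x * \<bar>\<psi> x\<bar>)"
      if "test_function \<Omega> \<psi>" for \<psi> using bound[OF that] by simp
  qed blast
  then obtain h where h: "\<And>i. locally_integrable \<Omega> (h i)"
    "\<And>i \<psi>. test_function \<Omega> \<psi> \<Longrightarrow>
     - (LINT x:\<Omega>|lebesgue. f x * partial_deriv i \<psi> x) = (LINT x:\<Omega>|lebesgue. h i x * \<psi> x)"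
    by metis
  have "has_weak_gradient \<Omega> f (\<lambda>x. \<chi> i. h i x)"
    unfolding has_weak_gradient_def
  proof (intro conjI allI impI)
    show "locally_integrable \<Omega> (\<lambda>x. \<chi> i. h i x)"
      unfolding locally_integrable_def
    proof (intro allI impI)
      fix K assume "compact K \<and> K \<subseteq> \<Omega>"
      then have hK: "h i absolutely_integrable_on K" for i using h(1) by (simp add: locally_integrable_def)
      show "(\<lambda>x. \<chi> i. h i x) absolutely_integrable_on K"
        by (rule absolutely_integrable_componentwise) (use hK in \<open>auto simp: Basis_vec_def inner_axis\<close>)
    qed
    show "(LINT x:\<Omega>|lebesgue. f x * partial_deriv i \<psi> x) = - (LINT x:\<Omega>|lebesgue. (\<chi> i. h i x) $ i * \<psi> x)"
      if "test_function \<Omega> \<psi>" for \<psi> i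
      using h(2)[OF that, of i] by simp
  qed
  then show ?thesis by blast
qed

text \<open>Holds for an arbitrary weak gradient, in particular for the chosen one. The one-sided
  comparison is applied to the component and to its negative.\<close>

lemma weak_gradient_component_le:
  fixes f :: "real ^ 'n::finite \<Rightarrow> real"
  assumes \<Omega>: "open \<Omega>" and g: "has_weak_gradient \<Omega> f g" and G: "locally_integrable \<Omega> G"
    and bound: "\<And>\<psi>. test_function \<Omega> \<psi> \<Longrightarrow>
      \<bar>LINT x:\<Omega>|lebesgue. f x * partial_deriv i \<psi> x\<bar> \<le> (LINT x:\<Omega>|lebesgue. G x * \<bar>\<psi> x\<bar>)"
  shows "AE x in lebesgue. x \<in> \<Omega> \<longrightarrow> \<bar>g x $ i\<bar> \<le> G x"
proof -
  have gi: "locally_integrable \<Omega> (\<lambda>x. g x $ i)"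
    using g by (intro locally_integrable_component) (simp add: has_weak_gradient_def)
  have b: "\<bar>LINT x:\<Omega>|lebesgue. g x $ i * \<psi> x\<bar> \<le> (LINT x:\<Omega>|lebesgue. G x * \<bar>\<psi> x\<bar>)"
    if "test_function \<Omega> \<psi>" for \<psi>
    using bound[OF that] g that by (simp add: has_weak_gradient_def)
  have "AE x in lebesgue. x \<in> \<Omega> \<longrightarrow> g x $ i \<le> G x"
    by (rule weak_bound_imp_AE_le[OF \<Omega> gi G]) (use b in force)
  moreover have "AE x in lebesgue. x \<in> \<Omega> \<longrightarrow> - (g x $ i) \<le> G x"
  proof (rule weak_bound_imp_AE_le[OF \<Omega> _ G])
    show "locally_integrable \<Omega> (\<lambda>x. - (g x $ i))"
      using gi by (simp add: locally_integrable_def set_integrable_def)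
    show "(LINT x:\<Omega>|lebesgue. - (g x $ i) * \<psi> x) \<le> (LINT x:\<Omega>|lebesgue. G x * \<bar>\<psi> x\<bar>)"
      if "test_function \<Omega> \<psi>" for \<psi>
      using b[OF that] by (simp add: set_lebesgue_integral_def)
  qed
  ultimately show ?thesis by eventually_elim auto
qed

text \<open>The compact image of \<open>K\<close> has a uniform distance to the complement of
  \<Omega>', so by uniform continuity of \<open>\<phi>\<close> near \<open>K\<close> the values at
  close points share a ball inside \<Omega>'. Bounding the Euclidean norm by the sum of coordinates
  gives the form required by the partial derivative bound.\<close>

lemma local_Lipschitz_compose_bound:
  fixes \<phi> :: "'a::euclidean_space \<Rightarrow> real ^ 'm::finite" and d :: "real ^ 'm \<Rightarrow> real"
  assumes \<Omega>: "open \<Omega>" "open \<Omega>'" and \<phi>: "continuous_on \<Omega> \<phi>" "\<phi> ` \<Omega> \<subseteq> \<Omega>'"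
    and d: "\<And>y z r. ball y r \<subseteq> \<Omega>' \<Longrightarrow> z \<in> ball y r \<Longrightarrow> \<bar>d z - d y\<bar> \<le> dist z y"
    and K: "compact K" "K \<subseteq> \<Omega>"
  shows "\<exists>\<delta>>0. \<forall>x\<in>K. \<forall>y. dist x y < \<delta> \<longrightarrow> \<bar>d (\<phi> y) - d (\<phi> x)\<bar> \<le> (\<Sum>j\<in>UNIV. \<bar>\<phi> y $ j - \<phi> x $ j\<bar>)"
proof -
  obtain \<delta> K' where K': "\<delta> > 0" "compact K'" "K' \<subseteq> \<Omega>" "\<And>x. x \<in> K \<Longrightarrow> cball x \<delta> \<subseteq> K'"
    using compact_thickening[OF K(1) \<Omega>(1) K(2)] by metis
  have "compact (\<phi> ` K)" by (rule compact_continuous_image[OF continuous_on_subset[OF \<phi>(1) K(2)] K(1)])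
  moreover have "\<phi> ` K \<subseteq> \<Omega>'" using \<phi>(2) K(2) by blast
  ultimately obtain \<epsilon> where \<epsilon>: "\<epsilon> > 0" "(\<Union>z\<in>\<phi> ` K. ball z \<epsilon>) \<subseteq> \<Omega>'"
    using compact_subset_open_imp_ball_epsilon_subset[OF _ \<Omega>(2)] by metis
  have "uniformly_continuous_on K' \<phi>"
    by (rule compact_uniformly_continuous[OF continuous_on_subset[OF \<phi>(1) K'(3)] K'(2)])
  then obtain \<delta>' where \<delta>': "\<delta>' > 0" "\<And>x y. x \<in> K' \<Longrightarrow> y \<in> K' \<Longrightarrow> dist y x < \<delta>' \<Longrightarrow> dist (\<phi> y) (\<phi> x) < \<epsilon>"
    using \<epsilon>(1) unfolding uniformly_continuous_on_def by metis
  show ?thesis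
  proof (intro exI conjI ballI allI impI)
    show "min \<delta> \<delta>' > 0" using K'(1) \<delta>'(1) by simp
    fix x y assume x: "x \<in> K" and y: "dist x y < min \<delta> \<delta>'"
    have "x \<in> K'" "y \<in> K'" using K'(4)[OF x] K'(1) y by (auto simp: subset_iff)
    then have "dist (\<phi> y) (\<phi> x) < \<epsilon>" using y by (intro \<delta>'(2)) (auto simp: dist_commute)
    then have "\<bar>d (\<phi> y) - d (\<phi> x)\<bar> \<le> dist (\<phi> y) (\<phi> x)"
      using \<epsilon>(2) x by (intro d[of _ \<epsilon>]) (auto simp: dist_commute)
    also have "\<dots> \<le> (\<Sum>j\<in>UNIV. \<bar>(\<phi> y - \<phi> x) $ j\<bar>)" unfolding dist_norm by (rule norm_le_l1_cart)
    finally show "\<bar>d (\<phi> y) - d (\<phi> x)\<bar> \<le> (\<Sum>j\<in>UNIV. \<bar>\<phi> y $ j - \<phi> x $ j\<bar>)" by simp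
  qed
qed

theorem theorem1p1:
  fixes \<Omega> \<Omega>' :: "(real ^ 'n::finite) set"
    and \<phi> :: "real ^ 'n \<Rightarrow> real ^ 'n"
    and p :: ennreal
  assumes "CARD('n) \<ge> 2"
    and "is_domain \<Omega>" and "is_domain \<Omega>'"
    and "p > of_nat CARD('n)"
    and "supports_poincare p \<Omega>"
    and "\<exists>\<phi>'. homeomorphism \<Omega> \<Omega>' \<phi> \<phi>'"
    and "sobolev_map p \<Omega> \<phi>"
  shows "geodesic_diameter \<Omega>' < \<infinity>"
proof -
  have \<Omega>: "open \<Omega>" and \<Omega>': "open \<Omega>'" using assms(2,3) by (simp_all add: is_domain_def)
  have p: "p > 0" using assms(4) by (rule le_less_trans[rotated]) simp
  obtain \<phi>' where hom: "homeomorphism \<Omega> \<Omega>' \<phi> \<phi>'" using assms(6) by blast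
  have \<phi>: "continuous_on \<Omega> \<phi>" "\<phi> ` \<Omega> \<subseteq> \<Omega>'" and \<phi>': "\<And>y. y \<in> \<Omega>' \<Longrightarrow> \<phi>' y \<in> \<Omega> \<and> \<phi> (\<phi>' y) = y"
    using hom unfolding homeomorphism_def by auto
  define g where "g j = weak_gradient \<Omega> (\<lambda>x. \<phi> x $ j)" for j
  have sob: "(\<lambda>x. \<phi> x $ j) \<in> sobolev_space p \<Omega>" for j
    using assms(7) by (simp add: sobolev_map_def)
  have g: "has_weak_gradient \<Omega> (\<lambda>x. \<phi> x $ j) (g j)" for j
    unfolding g_def by (rule weak_gradient_works[OF sob])
  have gl: "locally_integrable \<Omega> (g j)" for j using g by (simp add: has_weak_gradient_def)
  have gm: "g j \<in> borel_measurable (lebesgue_on \<Omega>)" for j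
    by (rule locally_integrable_measurable_on[OF \<Omega> gl])
  have gp: "Lp_norm p \<Omega> (g j) < \<infinity>" for j
    using sob[of j] by (simp add: sobolev_space_def sobolev_seminorm_def g_def)
  obtain B where B: "B \<ge> 0" "\<And>f :: real ^ 'n \<Rightarrow> real ^ 'n. f \<in> borel_measurable (lebesgue_on \<Omega>) \<Longrightarrow>
    AE x in lebesgue_on \<Omega>. norm (f x) \<le> real CARD('n) * (\<Sum>j\<in>UNIV. norm (g j x)) \<Longrightarrow> Lp_norm p \<Omega> f \<le> ennreal B"
    by (rule Lp_norm_uniform_bound[where g = g and c = "real CARD('n)", OF p gm gp of_nat_0_le_iff]) blast
  define G where "G i x = (\<Sum>j\<in>UNIV. \<bar>g j x $ i\<bar>)" for i x
  have Gl: "locally_integrable \<Omega> (G i)" for i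
    unfolding G_def by (intro locally_integrable_sum locally_integrable_abs locally_integrable_component gl) simp
  have G0: "G i x \<ge> 0" for i x by (simp add: G_def sum_nonneg)
  \<comment> \<open>Stated for every \<open>d\<close> with the local Lipschitz estimate, after
    \<open>B\<close> has been fixed, so that one bound serves all base points.\<close>
  have sobolev: "(\<lambda>x. d (\<phi> x)) \<in> sobolev_space p \<Omega>" "sobolev_seminorm p \<Omega> (\<lambda>x. d (\<phi> x)) \<le> ennreal B"
      "continuous_on \<Omega> (\<lambda>x. d (\<phi> x))"
    if d: "\<And>y z r. ball y r \<subseteq> \<Omega>' \<Longrightarrow> z \<in> ball y r \<Longrightarrow> \<bar>d z - d y\<bar> \<le> dist z y" for d :: "real ^ 'n \<Rightarrow> real"
  proof -
    let ?f = "\<lambda>x. d (\<phi> x)"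
    have "continuous_on \<Omega>' d"
      unfolding continuous_on_iff
    proof (intro ballI allI impI)
      fix y and e :: real assume y: "y \<in> \<Omega>'" and e: "e > 0"
      obtain r where r: "r > 0" "ball y r \<subseteq> \<Omega>'" using \<Omega>' y by (auto simp: open_contains_ball)
      show "\<exists>\<delta>>0. \<forall>z\<in>\<Omega>'. dist z y < \<delta> \<longrightarrow> dist (d z) (d y) < e"
      proof (intro exI conjI ballI impI)
        show "min r e > 0" using r e by simp
        show "dist (d z) (d y) < e" if "dist z y < min r e" for z
          using d[OF r(2), of z] that by (auto simp: dist_commute dist_real_def)
      qed
    qed
    then show fc: "continuous_on \<Omega> ?f"
      using continuous_on_compose2 \<phi> by blast
    have fl: "locally_integrable \<Omega> ?f" by (rule continuous_imp_locally_integrable[OF fc])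
    have bound: "\<bar>LINT x:\<Omega>|lebesgue. ?f x * partial_deriv i \<psi> x\<bar> \<le> (LINT x:\<Omega>|lebesgue. G i x * \<bar>\<psi> x\<bar>)"
      if "test_function \<Omega> \<psi>" for \<psi> i
      unfolding G_def
    proof (rule LINT_partial_deriv_bound[OF \<Omega> fc finite])
      show "continuous_on \<Omega> (\<lambda>x. \<phi> x $ j)" for j
        using \<phi>(1) by (rule continuous_on_component)
      show "locally_integrable \<Omega> (\<lambda>x. g j x $ i)" for j by (rule locally_integrable_component[OF gl])
      show "(LINT x:\<Omega>|lebesgue. \<phi> x $ j * partial_deriv i \<eta> x) = - (LINT x:\<Omega>|lebesgue. g j x $ i * \<eta> x)"
        if "test_function \<Omega> \<eta>" for j \<eta> using g that by (simp add: has_weak_gradient_def)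
    qed (use that local_Lipschitz_compose_bound[OF \<Omega> \<Omega>' \<phi> d] in auto)
    have ex: "\<exists>h. has_weak_gradient \<Omega> ?f h" by (rule weak_gradient_exists[OF \<Omega> fl Gl G0 bound])
    define h where "h = weak_gradient \<Omega> ?f"
    have h: "has_weak_gradient \<Omega> ?f h" unfolding h_def weak_gradient_def by (rule someI_ex[OF ex])
    have "AE x in lebesgue. \<forall>i. x \<in> \<Omega> \<longrightarrow> \<bar>h x $ i\<bar> \<le> G i x"
      unfolding AE_all_countable by (intro allI weak_gradient_component_le[OF \<Omega> h Gl bound])
    then have "AE x in lebesgue. x \<in> \<Omega> \<longrightarrow> norm (h x) \<le> real CARD('n) * (\<Sum>j\<in>UNIV. norm (g j x))"
    \<comment> \<open>The factor \<open>CARD('n)\<close> comes from summing the same bound over all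
      components of the gradient.\<close>
    proof eventually_elim
      case (elim x)
      show ?case
      proof
        assume x: "x \<in> \<Omega>"
        have "norm (h x) \<le> (\<Sum>i\<in>UNIV. \<bar>h x $ i\<bar>)" by (rule norm_le_l1_cart)
        also have "\<dots> \<le> (\<Sum>i\<in>(UNIV :: 'n set). \<Sum>j\<in>UNIV. norm (g j x))"
        proof (rule sum_mono)
          fix i
          have "\<bar>h x $ i\<bar> \<le> G i x" using elim x by blast
          also have "\<dots> \<le> (\<Sum>j\<in>UNIV. norm (g j x))"
            unfolding G_def by (intro sum_mono component_le_norm_cart)
          finally show "\<bar>h x $ i\<bar> \<le> (\<Sum>j\<in>UNIV. norm (g j x))" .
        qed
        finally show "norm (h x) \<le> real CARD('n) * (\<Sum>j\<in>UNIV. norm (g j x))" by simp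
      qed
    qed
    then have "AE x in lebesgue_on \<Omega>. norm (h x) \<le> real CARD('n) * (\<Sum>j\<in>UNIV. norm (g j x))"
      using \<Omega> by (subst AE_restrict_space_iff) auto
    moreover have "h \<in> borel_measurable (lebesgue_on \<Omega>)"
      using h by (intro locally_integrable_measurable_on[OF \<Omega>]) (simp add: has_weak_gradient_def)
    ultimately show le: "sobolev_seminorm p \<Omega> ?f \<le> ennreal B"
      unfolding sobolev_seminorm_def h_def[symmetric] by (intro B(2))
    show "?f \<in> sobolev_space p \<Omega>"
      unfolding sobolev_space_def using fl ex le by (auto intro: le_less_trans)
  qed
  obtain K where K: "\<And>f h. f \<in> sobolev_space p \<Omega> \<Longrightarrow> cont_representative \<Omega> f h \<Longrightarrow>
      (INF c. C_norm \<Omega> (\<lambda>x. h x - c)) \<le> ennreal K * sobolev_seminorm p \<Omega> f"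
    using assms(5) unfolding supports_poincare_def by blast
  \<comment> \<open>The maximum allows a negative \<open>K\<close>, which \<open>ennreal\<close>
    sends to 0. The summand 1 makes the inequality strict, so some \<open>c\<close> comes within
    \<open>M\<close> although the infimum need not be attained.\<close>
  define M where "M = max K 0 * B + 1"
  have "geodesic_dist \<Omega>' x y \<le> ennreal (2 * M)" if x: "x \<in> \<Omega>'" and y: "y \<in> \<Omega>'" for x y
  proof -
    obtain d where d: "d x = (0::real)" "\<And>y. y \<in> \<Omega>' \<Longrightarrow> geodesic_dist \<Omega>' x y \<le> ennreal (d y)"
      "\<And>y z r. ball y r \<subseteq> \<Omega>' \<Longrightarrow> z \<in> ball y r \<Longrightarrow> \<bar>d z - d y\<bar> \<le> dist z y"
      using geodesic_dist_Lipschitz_majorant[OF assms(3) x] by metis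
    let ?f = "\<lambda>x. d (\<phi> x)"
    note fd = sobolev[where d = d, OF d(3)]
    have "cont_representative \<Omega> ?f ?f"
      using fd(3) by (simp add: cont_representative_def)
    then have "(INF c. C_norm \<Omega> (\<lambda>x. ?f x - c)) \<le> ennreal K * sobolev_seminorm p \<Omega> ?f"
      using K[where f = ?f and h = ?f, OF fd(1)] by simp
    also have "\<dots> \<le> ennreal (max K 0) * ennreal B"
      by (intro mult_mono fd(2) ennreal_leI) auto
    also have "\<dots> = ennreal (max K 0 * B)" by (rule ennreal_mult[symmetric]) (use B(1) in auto)
    also have "\<dots> < ennreal M"
      unfolding M_def using B(1) by (intro ennreal_lessI) (auto intro: add_nonneg_pos)
    finally obtain c where c: "C_norm \<Omega> (\<lambda>x. ?f x - c) < ennreal M"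
      by (auto simp: INF_less_iff)
    have le: "\<bar>?f a - c\<bar> < M" if "a \<in> \<Omega>" for a
    proof -
      have "ennreal \<bar>?f a - c\<bar> \<le> C_norm \<Omega> (\<lambda>x. ?f x - c)"
        unfolding C_norm_def using that by (rule SUP_upper)
      then have "ennreal \<bar>?f a - c\<bar> < ennreal M" using c by (rule le_less_trans)
      then show ?thesis by (simp add: ennreal_less_iff)
    qed
    \<comment> \<open>At the preimage of \<open>x\<close> the function \<open>?f\<close> is 0, so
      \<open>\<bar>c\<bar> < M\<close>; at the preimage of \<open>y\<close> it equals
      \<open>d y\<close>, which is within \<open>M\<close> of \<open>c\<close>.\<close>
    have "d y \<le> 2 * M"
      using le[of "\<phi>' x"] le[of "\<phi>' y"] \<phi>'[OF x] \<phi>'[OF y] d(1) by (simp add: abs_less_iff)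
    then show ?thesis using d(2)[OF y] by (meson ennreal_leI order_trans)
  qed
  then have "geodesic_diameter \<Omega>' \<le> ennreal (2 * M)"
    unfolding geodesic_diameter_def by (intro SUP_least)
  then show ?thesis by (rule le_less_trans) simp
qed

end
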